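(* For all integers $s\ge 33$ and $n\ge 3s+3$, $m(n,s)=M(n,s)$, where $$m(n,s)=\max\{|\mathcal{F}|:\ \mathcal{F}\text{ is a 3-uniform hypergraph with } |V(\mathcal{F})|=n \text{ and } \nu(\mathcal{F})=s\}$$ and $$M(n,s)=\max\left\{\binom{3s+2}{3},\ \binom n3-\binom{n-s}3\right\}.$$ That is, every 3-uniform hypergraph on $n\ge 3s+3$ vertices with matching number $s\ge 33$ has at most $\max\left\{\binom{3s+2}{3},\binom n3-\binom{n-s}3\right\}$ edges, and this bound is attained.
   Context: A 3-uniform hypergraph (3-graph) $\mathcal{F}$ is a family of 3-element subsets (edges) of a finite vertex set $V(\mathcal{F})$; $|\mathcal{F}|$ denotes the number of edges. $\nu(\mathcal{F})$ denotes the matching number of $\mathcal{F}$, i.e. the maximum number of pairwise disjoint edges of $\mathcal{F}$. *)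

theory Defs
  imports Complex_Main
begin

definition three_graph :: "'a set \<Rightarrow> 'a set set \<Rightarrow> bool" where
  "three_graph V F \<longleftrightarrow> finite V \<and> (\<forall>e\<in>F. e \<subseteq> V \<and> card e = 3)"

definition is_matching :: "'a set set \<Rightarrow> 'a set set \<Rightarrow> bool" where
  "is_matching F N \<longleftrightarrow> N \<subseteq> F \<and> pairwise disjnt N"

text \<open>The maximum is meaningful for finite \<open>F\<close>: the set then is finite and, because of the
  empty matching, nonempty.\<close>

definition matching_number :: "'a set set \<Rightarrow> nat" where
  "matching_number F = Max {card N |N. is_matching F N}"

text \<open>Vertices are taken to be natural numbers, which is no restriction up to isomorphism. The set
  of edge numbers is bounded by \<open>n choose 3\<close>; it is nonempty iff \<open>3 * s \<le> n\<close>.\<close>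

definition max_edges :: "nat \<Rightarrow> nat \<Rightarrow> nat" where
  "max_edges n s = Max {card F |(V :: nat set) (F :: nat set set).
     three_graph V F \<and> card V = n \<and> matching_number F = s}"

definition edge_bound :: "nat \<Rightarrow> nat \<Rightarrow> nat" where
  "edge_bound n s = max ((3 * s + 2) choose 3) ((n choose 3) - ((n - s) choose 3))"

end

theory Submission
  imports Defs
begin

text \<open>By shifting, the family may be assumed shifted on \<open>{..<n}\<close>. Peel off initial vertices as long as each
  of them lowers the matching number; if \<open>s\<close> vertices are peeled off, they cover all edges.
  Otherwise the rest (again written with \<open>n\<close> and \<open>s\<close>) has a matching \<open>M 0, ..., M (s - 1)\<close> that
  partitions \<open>{1..3 * s}\<close> and avoids the vertex \<open>0\<close>. Then every edge has at least two vertices in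
  \<open>{0..3 * s}\<close>, and with \<open>G\<close> the graph of all pairs there that form an edge with \<open>3 * s + 2\<close>, the
  number of edges is at most
  \<open>(3 * s + 2 choose 3) - m + (n - 3 * s - 2) * |G|\<close>, where \<open>m\<close> counts the non-edges inside
  \<open>{..<3 * s + 2}\<close>. The argument of Erdos and Gallai gives \<open>|G| \<le> (5 * s^2 + s) / 2\<close>. The main point is
  \<open>m \<ge> y * |G|\<close> for \<open>y\<close> about \<open>0.54 * (s - 2)\<close>: averaging over all triples of matching edges, pairs
  of \<open>G\<close> between three matching edges force, by exchange arguments, a proportional number of
  transversal non-edges. Since \<open>y\<close> exceeds \<open>n - 3 * s - 2\<close> at the point where the two extremal
  families have equal size, the bound follows.\<close>

section \<open>Matchings and shifting\<close>

text \<open>Peeling is what frees the vertex \<open>0\<close>: with it there are three spare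
  vertices, \<open>0\<close>, \<open>3 * s + 1\<close> and \<open>3 * s + 2\<close>, and every
  exchange argument splits \<open>k\<close> matching edges together with these three into
  \<open>k + 1\<close> edges. After peeling at least one vertex, the rest is compared with the star
  alone, because star sizes add up along the peeling. For small \<open>n\<close> that comparison
  would fail. Hence isolated vertices are first added until one more vertex would make the star at
  least as large as the clique. The size of \<open>y\<close> is governed by \<open>L_table\<close>:
  7 pairs are only known to force 4 non-edges, so the argument keeps \<open>y / (s - 2)\<close>
  below \<open>4/7\<close>, and lower-order terms bring it to \<open>0.54\<close>. The crossing of
  the two extremal sizes asks for about \<open>0.486\<close>. The estimate cannot be argued triple
  by triple: if no vertex of the third matching edge is joined to \<open>0\<close> and
  \<open>3 * s + 2\<close>, one to three pairs may come with at most one non-edge. Such bad triples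
  are paid for by triples with 12 non-edges and by the positive weights of the others.\<close>

definition has_matching :: "'a set set \<Rightarrow> nat \<Rightarrow> bool" where
  "has_matching F k \<longleftrightarrow> (\<exists>N. is_matching F N \<and> finite N \<and> card N = k)"

definition shifted :: "nat set set \<Rightarrow> bool" where
  "shifted F \<longleftrightarrow> (\<forall>e\<in>F. \<forall>x\<in>e. \<forall>y<x. y \<notin> e \<longrightarrow> insert y (e - {x}) \<in> F)"

definition shift_edge :: "'a \<Rightarrow> 'a \<Rightarrow> 'a set set \<Rightarrow> 'a set \<Rightarrow> 'a set" where
  "shift_edge y x F e =
    (if x \<in> e \<and> y \<notin> e \<and> insert y (e - {x}) \<notin> F then insert y (e - {x}) else e)"

lemma inj_on_shift_edge: "inj_on (shift_edge y x F) F"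
proof (rule inj_onI)
  fix e f assume *: "e \<in> F" "f \<in> F" "shift_edge y x F e = shift_edge y x F f"
  show "e = f"
  proof (cases "x \<in> e \<and> y \<notin> e \<and> insert y (e - {x}) \<notin> F")
    case e: True
    show ?thesis
    proof (cases "x \<in> f \<and> y \<notin> f \<and> insert y (f - {x}) \<notin> F")
      case True
      then have "insert y (e - {x}) = insert y (f - {x})" using * e by (simp add: shift_edge_def)
      then have "e - {x} = f - {x}" using e True by (auto simp: set_eq_iff)
      then show ?thesis using e True by (auto simp: set_eq_iff)
    next
      case False
      then show ?thesis using * e by (auto simp: shift_edge_def)
    qed
  next
    case e: False
    show ?thesis
    proof (cases "x \<in> f \<and> y \<notin> f \<and> insert y (f - {x}) \<notin> F")
      case True
      then show ?thesis using * e by (auto simp: shift_edge_def)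
    next
      case False
      then show ?thesis using * e by (auto simp: shift_edge_def split: if_splits)
    qed
  qed
qed

text \<open>All edges created by the shift contain \<open>y\<close>, so a matching uses at most one
  of them, \<open>e'\<close>. It is moved back to \<open>e\<close>. If another edge \<open>f\<close>
  then clashes at \<open>x\<close>, it was left in place only because
  \<open>insert y (f - {x})\<close> was already in \<open>F\<close>, and this set replaces
  it.\<close>

lemma has_matching_unshift:
  assumes "has_matching (shift_edge y x F ` F) k"
  shows "has_matching F k"
proof -
  obtain N where N: "N \<subseteq> shift_edge y x F ` F" "pairwise disjnt N" "finite N" "card N = k"
    using assms by (auto simp: has_matching_def is_matching_def)
  have disj: "e \<inter> f = {}" if "e \<in> N" "f \<in> N" "e \<noteq> f" for e f
    using N(2) that by (auto simp: pairwise_def disjnt_def)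
  show ?thesis
  proof (cases "N \<subseteq> F")
    case True
    then show ?thesis using N by (auto simp: has_matching_def is_matching_def)
  next
    case False
    then obtain e' where e': "e' \<in> N" "e' \<notin> F" by blast
    then obtain e where e: "e \<in> F" "e' = shift_edge y x F e" using N by blast
    then have e1: "x \<in> e" "y \<notin> e" "e' = insert y (e - {x})"
      using e' by (auto simp: shift_edge_def split: if_splits)
    then have xe': "x \<notin> e'" "y \<in> e'" by auto
    have other: "f \<in> F" "y \<notin> f" "x \<in> f \<longrightarrow> insert y (f - {x}) \<in> F" if f: "f \<in> N" "f \<noteq> e'" for f
    proof -
      show y: "y \<notin> f" using disj[OF f(1) e'(1) f(2)] xe' by blast
      obtain g where g: "g \<in> F" "f = shift_edge y x F g" using N f by blast
      then show "f \<in> F" using y by (auto simp: shift_edge_def split: if_splits)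
      show "x \<in> f \<longrightarrow> insert y (f - {x}) \<in> F"
        using g y e1(1,2) by (auto simp: shift_edge_def split: if_splits)
    qed
    have k: "k = Suc (card (N - {e'}))"
      using N e' card.remove by metis
    show ?thesis
    proof (cases "\<exists>f\<in>N - {e'}. x \<in> f")
      case False
      let ?N = "insert e (N - {e'})"
      have d: "e \<inter> f = {}" if "f \<in> N - {e'}" for f
      proof -
        have "e' \<inter> f = {}" using disj[of e' f] e'(1) that by blast
        moreover have "x \<notin> f" using that False by blast
        ultimately show ?thesis using e1(3) by blast
      qed
      then have "e \<notin> N - {e'}" using e1(1) False by blast
      then have "card ?N = k" using k N by simp
      moreover have "pairwise disjnt ?N"
        using d disj by (auto simp: pairwise_insert disjnt_def pairwise_def)
      moreover have "?N \<subseteq> F" using e other by auto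
      ultimately show ?thesis using N unfolding has_matching_def is_matching_def
        by (intro exI[of _ ?N]) auto
    next
      case True
      then obtain f where f: "f \<in> N" "f \<noteq> e'" "x \<in> f" by blast
      define f' where "f' = insert y (f - {x})"
      define R where "R = N - {e'} - {f}"
      let ?N = "insert e (insert f' R)"
      have yf: "y \<notin> f" using other f by blast
      have ef: "e' \<inter> f = {}" using disj e' f by auto
      have k2: "k = Suc (Suc (card R))" unfolding R_def
        using k N f by (metis card.remove Diff_iff finite_Diff insertE empty_iff insert_iff)
      have R: "e' \<inter> g = {}" "f \<inter> g = {}" if "g \<in> R" for g
        using that disj[OF e'(1)] disj[OF f(1)] by (auto simp: R_def)
      have eR: "e \<inter> g = {}" if "g \<in> R" for g using R[OF that] e1 f(3) by blast
      have fR: "f' \<inter> g = {}" if "g \<in> R" for g using R[OF that] e1 f(3) by (auto simp: f'_def)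
      have eff: "e \<inter> f' = {}" using ef e1 f(3) by (auto simp: f'_def)
      have "e \<notin> R" "e \<noteq> f'" using eR[of e] eff e1(1) by blast+
      moreover have "f' \<notin> R" using fR[of f'] by (auto simp: f'_def)
      ultimately have "card ?N = k" using k2 N by (simp add: R_def)
      moreover have "pairwise disjnt ?N"
        using eR fR eff disj by (auto simp: pairwise_insert disjnt_def pairwise_def R_def)
      moreover have "?N \<subseteq> F" using e other f by (auto simp: f'_def R_def)
      moreover have "finite ?N" using N by (simp add: R_def)
      ultimately show ?thesis unfolding has_matching_def is_matching_def
        by (intro exI[of _ ?N]) auto
    qed
  qed
qed

text \<open>Among the families of the same size without a \<open>k\<close>-matching, one with the
  least total of all vertex labels is shifted, since a further shift would lower the total.\<close>

lemma exists_shifted: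
  fixes F :: "nat set set"
  assumes F: "\<And>e. e \<in> F \<Longrightarrow> e \<subseteq> {..<n} \<and> card e = 3" and "\<not> has_matching F k"
  shows "\<exists>F'. (\<forall>e\<in>F'. e \<subseteq> {..<n} \<and> card e = 3) \<and> \<not> has_matching F' k
    \<and> card F' = card F \<and> shifted F'"
proof -
  define P where "P F' \<longleftrightarrow> (\<forall>e\<in>F'. e \<subseteq> {..<n} \<and> card e = 3) \<and> \<not> has_matching F' k
    \<and> card F' = card F" for F' :: "nat set set"
  define m where "m F' = (\<Sum>e\<in>F'. \<Sum>e)" for F' :: "nat set set"
  have "P F" using assms by (simp add: P_def)
  then obtain F' where F': "P F'" and min: "\<And>H. P H \<Longrightarrow> m F' \<le> m H"
    using ex_has_least_nat[of P F m] by blast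
  have fin: "finite F'" using F' finite_subset[of F' "Pow {..<n}"] by (auto simp: P_def)
  have "shifted F'"
  proof (rule ccontr)
    assume "\<not> shifted F'"
    then obtain e x y where e: "e \<in> F'" "x \<in> e" "y < x" "y \<notin> e" "insert y (e - {x}) \<notin> F'"
      by (auto simp: shifted_def)
    let ?S = "shift_edge y x F'"
    have fe: "finite f" if "f \<in> F'" for f
      using F' that finite_subset[of f "{..<n}"] by (auto simp: P_def)
    have sum_le: "\<Sum>(?S f) \<le> \<Sum>f" if "f \<in> F'" for f
      using e(3) fe[OF that] by (auto simp: shift_edge_def sum.remove)
    have sum_less: "\<Sum>(?S e) < \<Sum>e"
      using e fe[OF e(1)] by (auto simp: shift_edge_def sum.remove)
    have "m (?S ` F') = (\<Sum>f\<in>F'. \<Sum>(?S f))"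
      unfolding m_def by (subst sum.reindex[OF inj_on_shift_edge]) simp
    also have "\<dots> < m F'" unfolding m_def
      using sum_le sum_less e(1) fin by (intro sum_strict_mono_ex1) auto
    finally have "m (?S ` F') < m F'" .
    moreover have "P (?S ` F')" unfolding P_def
    proof (intro conjI ballI)
      fix f assume "f \<in> ?S ` F'"
      then obtain g where g: "g \<in> F'" "f = ?S g" by blast
      have gn: "g \<subseteq> {..<n}" "card g = 3" using g F' by (auto simp: P_def)
      have "x < n" using e F' by (auto simp: P_def)
      then show "f \<subseteq> {..<n}" using g gn e(3) by (auto simp: shift_edge_def)
      show "card f = 3" using g gn fe[OF g(1)] by (auto simp: shift_edge_def card.remove)
    next
      show "\<not> has_matching (?S ` F') k"
        using F' has_matching_unshift[of y x F' k] unfolding P_def by blast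
      show "card (?S ` F') = card F"
        using F' card_image[OF inj_on_shift_edge, of y x F'] by (simp add: P_def)
    qed
    ultimately show False using min by fastforce
  qed
  then show ?thesis using F' unfolding P_def by blast
qed

text \<open>The vertices are lowered in increasing order, so that no new vertex collides with one
  still to be lowered.\<close>

lemma shifted_sorted:
  assumes "shifted F" "{a, b, c} \<in> F" "a < b" "b < c" "a' < b'" "b' < c'" "a' \<le> a" "b' \<le> b" "c' \<le> c"
  shows "{a', b', c'} \<in> F"
proof -
  have step: "insert y (e - {x}) \<in> F" if "e \<in> F" "x \<in> e" "y \<le> x" "y \<notin> e - {x}" for e x y
    using assms(1) that unfolding shifted_def
    by (cases "y = x") (auto simp: insert_absorb)
  have "insert a' ({a, b, c} - {a}) \<in> F" by (rule step) (use assms in auto)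
  then have 1: "{a', b, c} \<in> F" using assms by (simp add: insert_Diff_if)
  have "insert b' ({a', b, c} - {b}) \<in> F" by (rule step[OF 1]) (use assms in auto)
  then have 2: "{a', b', c} \<in> F" using assms by (simp add: insert_Diff_if insert_commute)
  have "insert c' ({a', b', c} - {c}) \<in> F" by (rule step[OF 2]) (use assms in auto)
  then show ?thesis using assms by (simp add: insert_Diff_if insert_commute)
qed

lemma shifted_dom_aux:
  assumes "shifted F" "{a, b, c} \<in> F" "a < b" "b < c" "a' \<le> a" "b' \<le> b" "c' \<le> c"
    "a' \<noteq> b'" "b' \<noteq> c'" "a' \<noteq> c'"
  shows "{a', b', c'} \<in> F"
proof -
  note S = shifted_sorted[OF assms(1-4)]
  consider "a' < b'" "b' < c'" | "a' < c'" "c' < b'" | "b' < a'" "a' < c'" | "b' < c'" "c' < a'"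
    | "c' < a'" "a' < b'" | "c' < b'" "b' < a'" using assms(8-10) by linarith
  then show ?thesis
  proof cases
    case 1 show ?thesis by (rule S) (use 1 assms in auto)
  next
    case 2 have "{a', c', b'} \<in> F" by (rule S) (use 2 assms in auto)
    then show ?thesis by (simp add: insert_commute)
  next
    case 3 have "{b', a', c'} \<in> F" by (rule S) (use 3 assms in auto)
    then show ?thesis by (simp add: insert_commute)
  next
    case 4 have "{b', c', a'} \<in> F" by (rule S) (use 4 assms in auto)
    then show ?thesis by (simp add: insert_commute)
  next
    case 5 have "{c', a', b'} \<in> F" by (rule S) (use 5 assms in auto)
    then show ?thesis by (simp add: insert_commute)
  next
    case 6 have "{c', b', a'} \<in> F" by (rule S) (use 6 assms in auto)
    then show ?thesis by (simp add: insert_commute)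
  qed
qed

text \<open>Coordinatewise domination survives sorting both triples, so the sorted case
  suffices.\<close>

lemma shifted_dominated:
  assumes F: "shifted F" "{a, b, c} \<in> F" and ne: "a \<noteq> b" "b \<noteq> c" "a \<noteq> c"
    and le: "a' \<le> a" "b' \<le> b" "c' \<le> c" and ne': "a' \<noteq> b'" "b' \<noteq> c'" "a' \<noteq> c'"
  shows "{a', b', c'} \<in> F"
proof -
  consider "a < b" "b < c" | "a < c" "c < b" | "b < a" "a < c" | "b < c" "c < a"
    | "c < a" "a < b" | "c < b" "b < a" using ne by linarith
  then show ?thesis
  proof cases
    case 1 then show ?thesis using shifted_dom_aux[of F a b c a' b' c'] assms by blast
  next
    case 2 then show ?thesis using shifted_dom_aux[of F a c b a' c' b'] assms
      by (auto simp: insert_commute)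
  next
    case 3 then show ?thesis using shifted_dom_aux[of F b a c b' a' c'] assms
      by (auto simp: insert_commute)
  next
    case 4 then show ?thesis using shifted_dom_aux[of F b c a b' c' a'] assms
      by (auto simp: insert_commute)
  next
    case 5 then show ?thesis using shifted_dom_aux[of F c a b c' a' b'] assms
      by (auto simp: insert_commute)
  next
    case 6 then show ?thesis using shifted_dom_aux[of F c b a c' b' a'] assms
      by (auto simp: insert_commute)
  qed
qed

section \<open>Exchange arguments\<close>

lemma has_matching_list:
  assumes "set es \<subseteq> F" "sorted_wrt disjnt es" "{} \<notin> F"
  shows "has_matching F (length es)"
proof -
  have "distinct es \<and> pairwise disjnt (set es)" using assms
  proof (induction es)
    case (Cons e es)
    then have "e \<noteq> {}" "\<forall>f\<in>set es. disjnt e f" by auto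
    moreover from this have "e \<notin> set es" by (auto simp: disjnt_def)
    moreover have "distinct es \<and> pairwise disjnt (set es)" using Cons by simp
    ultimately show ?case by (simp add: pairwise_insert disjnt_sym)
  qed simp
  then show ?thesis using assms unfolding has_matching_def is_matching_def
    by (intro exI[of _ "set es"]) (auto simp: distinct_card)
qed

lemma has_matching_indexed:
  assumes "\<And>i. i < k \<Longrightarrow> e i \<in> F" "\<And>i j. i < j \<Longrightarrow> j < k \<Longrightarrow> e i \<inter> e j = {}" "{} \<notin> F"
  shows "has_matching F k"
proof -
  have "has_matching F (length (map e [0..<k]))"
    by (rule has_matching_list) (use assms in \<open>auto simp: sorted_wrt_iff_nth_less disjnt_def\<close>)
  then show ?thesis by simp
qed

lemma has_matching_mono:
  assumes "has_matching F m" "k \<le> m" shows "has_matching F k"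
proof -
  obtain N where N: "is_matching F N" "finite N" "card N = m"
    using assms by (auto simp: has_matching_def)
  obtain N' where N': "N' \<subseteq> N" "card N' = k"
    using obtain_subset_with_card_n assms(2) N(3) by metis
  then have "is_matching F N'" using N(1) unfolding is_matching_def by (meson pairwise_subset subset_trans)
  then show ?thesis using N' N(2) finite_subset unfolding has_matching_def by blast
qed

text \<open>The matching \<open>M\<close> covers \<open>{1..3 * s}\<close>, which leaves the vertex \<open>0\<close> and the vertices above
  \<open>3 * s\<close> for exchange arguments; only \<open>3 * s + 1\<close> and \<open>3 * s + 2\<close> of the latter are ever needed.\<close>

locale matched_family =
  fixes F :: "nat set set" and s :: nat and M :: "nat \<Rightarrow> nat set"
  assumes edge_card: "e \<in> F \<Longrightarrow> card e = 3"
    and shift: "shifted F"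
    and no_matching: "\<not> has_matching F (Suc s)"
    and M_edge: "i < s \<Longrightarrow> M i \<in> F"
    and M_disjoint: "\<lbrakk>i < s; j < s; i \<noteq> j\<rbrakk> \<Longrightarrow> M i \<inter> M j = {}"
    and M_Union: "(\<Union>i<s. M i) = {1..3 * s}"
begin

lemma M_range: "\<lbrakk>i < s; a \<in> M i\<rbrakk> \<Longrightarrow> 1 \<le> a \<and> a \<le> 3 * s"
  using M_Union by auto

lemma M_finite: "i < s \<Longrightarrow> finite (M i)"
  using M_Union by (metis finite_UN finite_atLeastAtMost finite_lessThan lessThan_iff)

lemma M_distinct: "\<lbrakk>i < s; j < s; i \<noteq> j; a \<in> M i; b \<in> M j\<rbrakk> \<Longrightarrow> a \<noteq> b"
  using M_disjoint by blast

text \<open>The edges \<open>es\<close> replace the matching edges with indices \<open>ks\<close>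
  and are one more in number; using only replaced or spare vertices, they stay disjoint from the
  untouched matching edges. Each application below partitions \<open>k\<close> matching edges plus
  \<open>0\<close>, \<open>3 * s + 1\<close>, \<open>3 * s + 2\<close> into \<open>k + 1\<close>
  edges.\<close>

lemma exchange:
  assumes "set es \<subseteq> F" "sorted_wrt disjnt es" "set ks \<subseteq> {..<s}" "distinct ks" "length es = Suc (length ks)"
    "\<Union> (set es) \<subseteq> {0} \<union> {3 * s <..} \<union> \<Union> (M ` set ks)"
  shows False
proof -
  define R where "R = sorted_list_of_set ({..<s} - set ks)"
  have R: "set R = {..<s} - set ks" "distinct R" by (auto simp: R_def)
  have "length R = s - length ks" unfolding R_def
    using assms(3,4) by (simp add: card_Diff_subset distinct_card)
  moreover have "length ks \<le> s" using assms(3,4) by (metis card_lessThan card_mono distinct_card finite_lessThan)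
  ultimately have len: "length (es @ map M R) = Suc s" using assms(5) by simp
  have "sorted_wrt disjnt (map M R)"
  proof -
    have "sorted_wrt (\<lambda>x y. x \<noteq> y) R" using R(2) by (simp add: sorted_wrt_iff_nth_less nth_eq_iff_index_eq)
    then have "sorted_wrt (\<lambda>x y. disjnt (M x) (M y)) R"
      by (rule sorted_wrt_mono_rel[rotated]) (use R M_disjoint in \<open>auto simp: disjnt_def\<close>)
    then show ?thesis by (simp add: sorted_wrt_map)
  qed
  moreover have "disjnt e (M m)" if "e \<in> set es" "m \<in> set R" for e m
  proof -
    have m: "m < s" "m \<notin> set ks" using that R by auto
    have "M k \<inter> M m = {}" if "k \<in> set ks" for k
      using that m assms(3) M_disjoint[of k m] by blast
    moreover have "x = 0 \<or> 3 * s < x \<or> (\<exists>k\<in>set ks. x \<in> M k)" if "x \<in> e" for x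
      using assms(6) that \<open>e \<in> set es\<close> by auto
    ultimately show ?thesis using M_range[OF m(1)] by (force simp: disjnt_iff)
  qed
  ultimately have "sorted_wrt disjnt (es @ map M R)" using assms(2)
    by (auto simp: sorted_wrt_append)
  moreover have "set (es @ map M R) \<subseteq> F" using assms(1) R M_edge by auto
  moreover have "{} \<notin> F" using edge_card by fastforce
  ultimately have "has_matching F (length (es @ map M R))" using has_matching_list by blast
  then show False using len no_matching by simp
qed

lemma edge_dominated:
  assumes "{a, b, c} \<in> F" "a' \<le> a" "b' \<le> b" "c' \<le> c" "a' \<noteq> b'" "b' \<noteq> c'" "a' \<noteq> c'"
  shows "{a', b', c'} \<in> F"
proof -
  have "card {a, b, c} = 3" using edge_card assms by blast
  then have "a \<noteq> b" "b \<noteq> c" "a \<noteq> c" by (auto simp: card_insert_if split: if_splits)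
  then show ?thesis using shifted_dominated[OF shift assms(1)] assms by blast
qed

lemma M_distinct3: "\<lbrakk>i < s; M i = {a, a', a''}\<rbrakk> \<Longrightarrow> a \<noteq> a' \<and> a' \<noteq> a'' \<and> a \<noteq> a''"
proof -
  assume "i < s" "M i = {a, a', a''}"
  then have "card {a, a', a''} = 3" using edge_card[OF M_edge, of i] by simp
  then show ?thesis by (auto simp: card_insert_if split: if_splits)
qed

lemma two_pairs_kill:
  assumes ij: "i < s" "j < s" "i \<noteq> j"
    and M: "M i = {a, a', a''}" "M j = {b, b', b''}"
    and G: "{a, b, 3 * s + 2} \<in> F" "{a', b', 3 * s + 2} \<in> F"
  shows "{0, a'', b''} \<notin> F"
proof
  assume E: "{0, a'', b''} \<in> F"
  have D: "distinct [a, a', a'', b, b', b'']"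
    using M_disjoint[OF ij] M_distinct3[OF ij(1) M(1)] M_distinct3[OF ij(2) M(2)] unfolding M by auto
  have R: "\<forall>x\<in>M i \<union> M j. 0 < x \<and> x < 3 * s + 1"
    using M_range[OF ij(1)] M_range[OF ij(2)] by fastforce
  \<comment> \<open>Both pairs come with the same vertex \<open>3 * s + 2\<close>; lowering it in
    one of the two edges makes them disjoint.\<close>
  have "{a, b, 3 * s + 1} \<in> F"
    by (rule edge_dominated[OF G(1)]) (use D R M in auto)
  note w = this
  show False
  proof (rule exchange[of "[{a, b, 3 * s + 1}, {a', b', 3 * s + 2}, {0, a'', b''}]" "[i, j]"])
    show "sorted_wrt disjnt [{a, b, 3 * s + 1}, {a', b', 3 * s + 2}, {0, a'', b''}]"
      using D R unfolding M by (auto simp: disjnt_def)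
  qed (use G E w ij M in auto)
qed

lemma dead_pair:
  assumes "{0, a, b} \<notin> F" "a \<noteq> 0" "b \<noteq> 0" "a \<noteq> b"
  shows "{c, a, b} \<notin> F"
proof
  assume "{c, a, b} \<in> F"
  then have "{0, a, b} \<in> F" by (rule edge_dominated) (use assms in auto)
  then show False using assms by simp
qed

lemma antipodal_not_both:
  assumes ijl: "i < s" "j < s" "l < s" "i \<noteq> j" "j \<noteq> l" "i \<noteq> l"
    and M: "M i = {a, a', a''}" "M j = {b, b', b''}" "M l = {c, c', c''}"
    and G: "{a, b, 3 * s + 2} \<in> F" "{0, c, 3 * s + 2} \<in> F"
  shows "{a', b', c'} \<notin> F \<or> {a'', b'', c''} \<notin> F"
proof (rule ccontr)
  assume E: "\<not> ({a', b', c'} \<notin> F \<or> {a'', b'', c''} \<notin> F)"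
  have D: "distinct [a, a', a'', b, b', b'', c, c', c'']"
    using M_disjoint[of i j] M_disjoint[of j l] M_disjoint[of i l] ijl
      M_distinct3[OF ijl(1) M(1)] M_distinct3[OF ijl(2) M(2)] M_distinct3[OF ijl(3) M(3)]
    unfolding M by auto
  have R: "\<forall>x\<in>M i \<union> M j \<union> M l. 0 < x \<and> x < 3 * s + 1"
    using M_range[OF ijl(1)] M_range[OF ijl(2)] M_range[OF ijl(3)] by fastforce
  have w: "{a, b, 3 * s + 1} \<in> F"
    by (rule edge_dominated[OF G(1)]) (use D R M in auto)
  show False
  proof (rule exchange[of "[{a, b, 3 * s + 1}, {0, c, 3 * s + 2}, {a', b', c'}, {a'', b'', c''}]" "[i, j, l]"])
    show "sorted_wrt disjnt [{a, b, 3 * s + 1}, {0, c, 3 * s + 2}, {a', b', c'}, {a'', b'', c''}]"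
      using D R unfolding M by (auto simp: disjnt_def)
  qed (use G E w ijl M in auto)
qed

lemma rainbow_missing:
  assumes ijl: "i < s" "j < s" "l < s" "i \<noteq> j" "j \<noteq> l" "i \<noteq> l"
    and M: "M i = {a, a', a''}" "M j = {b, b', b''}" "M l = {c, c', c''}"
    and G: "{0, a, 3 * s + 2} \<in> F"
  shows "{a', b, c} \<notin> F \<or> {a'', b', c'} \<notin> F \<or> {b'', c'', 3 * s + 1} \<notin> F"
proof (rule ccontr)
  assume E: "\<not> ({a', b, c} \<notin> F \<or> {a'', b', c'} \<notin> F \<or> {b'', c'', 3 * s + 1} \<notin> F)"
  have D: "distinct [a, a', a'', b, b', b'', c, c', c'']"
    using M_disjoint[of i j] M_disjoint[of j l] M_disjoint[of i l] ijl
      M_distinct3[OF ijl(1) M(1)] M_distinct3[OF ijl(2) M(2)] M_distinct3[OF ijl(3) M(3)]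
    unfolding M by auto
  have R: "\<forall>x\<in>M i \<union> M j \<union> M l. 0 < x \<and> x < 3 * s + 1"
    using M_range[OF ijl(1)] M_range[OF ijl(2)] M_range[OF ijl(3)] by fastforce
  show False
  proof (rule exchange[of "[{0, a, 3 * s + 2}, {a', b, c}, {a'', b', c'}, {b'', c'', 3 * s + 1}]" "[i, j, l]"])
    show "sorted_wrt disjnt [{0, a, 3 * s + 2}, {a', b, c}, {a'', b', c'}, {b'', c'', 3 * s + 1}]"
      using D R unfolding M by (auto simp: disjnt_def)
  qed (use G E ijl M in auto)
qed

lemma disjoint_pairs_conflict:
  assumes ix: "i < s" "j < s" "i' < s" "j' < s" "l < s" "distinct [i, j, i', j', l]"
    and M: "M i = {u, u1, u2}" "M j = {v, v1, v2}" "M i' = {p, p1, p2}" "M j' = {q, q1, q2}"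
      "M l = {c1, c2, c3}"
    and G: "{u, v, 3 * s + 2} \<in> F" "{p, q, 3 * s + 2} \<in> F"
    and E: "{u1, v1, c1} \<in> F" "{p1, q1, c2} \<in> F" "{p2, q2, c3} \<in> F" "{0, u2, v2} \<in> F"
  shows False
proof -
  have D: "distinct [u, u1, u2, v, v1, v2, p, p1, p2, q, q1, q2, c1, c2, c3]"
    using M_disjoint[of i j] M_disjoint[of i i'] M_disjoint[of i j'] M_disjoint[of i l]
      M_disjoint[of j i'] M_disjoint[of j j'] M_disjoint[of j l] M_disjoint[of i' j']
      M_disjoint[of i' l] M_disjoint[of j' l] ix
      M_distinct3[OF ix(1) M(1)] M_distinct3[OF ix(2) M(2)] M_distinct3[OF ix(3) M(3)]
      M_distinct3[OF ix(4) M(4)] M_distinct3[OF ix(5) M(5)]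
    unfolding M by auto
  have R: "\<forall>x\<in>M i \<union> M j \<union> M i' \<union> M j' \<union> M l. 0 < x \<and> x < 3 * s + 1"
    using M_range[OF ix(1)] M_range[OF ix(2)] M_range[OF ix(3)] M_range[OF ix(4)] M_range[OF ix(5)]
    by fastforce
  have w: "{u, v, 3 * s + 1} \<in> F"
    by (rule edge_dominated[OF G(1)]) (use D R M in auto)
  show False
  proof (rule exchange[of "[{u, v, 3 * s + 1}, {p, q, 3 * s + 2}, {u1, v1, c1}, {p1, q1, c2},
      {p2, q2, c3}, {0, u2, v2}]" "[i, j, i', j', l]"])
    show "sorted_wrt disjnt [{u, v, 3 * s + 1}, {p, q, 3 * s + 2}, {u1, v1, c1}, {p1, q1, c2},
      {p2, q2, c3}, {0, u2, v2}]"
      using D R unfolding M by (auto simp: disjnt_def)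
  qed (use G E w ix M in auto)
qed

lemma common_index_conflict:
  assumes ix: "i < s" "j < s" "j' < s" "l < s" "distinct [i, j, j', l]"
    and M: "M i = {u, u1, u2}" "M j = {v, v1, v2}" "M j' = {q, q1, q2}" "M l = {c1, c2, c3}"
    and G: "{0, v, 3 * s + 2} \<in> F" "{u, q, 3 * s + 2} \<in> F"
    and E: "{u1, v1, c1} \<in> F" "{u2, q1, c2} \<in> F"
  shows "{v2, q2, c3} \<notin> F"
proof
  assume E3: "{v2, q2, c3} \<in> F"
  have D: "distinct [u, u1, u2, v, v1, v2, q, q1, q2, c1, c2, c3]"
    using M_disjoint[of i j] M_disjoint[of i j'] M_disjoint[of i l]
      M_disjoint[of j j'] M_disjoint[of j l] M_disjoint[of j' l] ix
      M_distinct3[OF ix(1) M(1)] M_distinct3[OF ix(2) M(2)] M_distinct3[OF ix(3) M(3)]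
      M_distinct3[OF ix(4) M(4)]
    unfolding M by auto
  have R: "\<forall>x\<in>M i \<union> M j \<union> M j' \<union> M l. 0 < x \<and> x < 3 * s + 1"
    using M_range[OF ix(1)] M_range[OF ix(2)] M_range[OF ix(3)] M_range[OF ix(4)]
    by fastforce
  have w: "{0, v, 3 * s + 1} \<in> F"
    by (rule edge_dominated[OF G(1)]) (use D R M in auto)
  show False
  proof (rule exchange[of "[{0, v, 3 * s + 1}, {u, q, 3 * s + 2}, {u1, v1, c1}, {u2, q1, c2},
      {v2, q2, c3}]" "[i, j, j', l]"])
    show "sorted_wrt disjnt [{0, v, 3 * s + 1}, {u, q, 3 * s + 2}, {u1, v1, c1}, {u2, q1, c2},
      {v2, q2, c3}]"
      using D R unfolding M by (auto simp: disjnt_def)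
  qed (use G E E3 w ix M in auto)
qed

end

section \<open>Non-edges between three matching edges\<close>

text \<open>Cells of which no two differ in both row and column lie in one line of the array, so
  there are at most three of them.\<close>

lemma bool_matrix_disjoint:
  assumes "4 \<le> (of_bool p00 + of_bool p01 + of_bool p02 + (of_bool p10 + of_bool p11 + of_bool p12)
      + (of_bool p20 + of_bool p21 + of_bool p22) :: nat)"
  shows "(p00 \<and> (p11 \<or> p12 \<or> p21 \<or> p22)) \<or> (p01 \<and> (p10 \<or> p12 \<or> p20 \<or> p22)) \<or>
    (p02 \<and> (p10 \<or> p11 \<or> p20 \<or> p21)) \<or> (p10 \<and> (p21 \<or> p22)) \<or> (p11 \<and> (p20 \<or> p22)) \<or>
    (p12 \<and> (p20 \<or> p21))"
  using assms by (cases p00; cases p01; cases p02; cases p10; cases p11; cases p12; cases p20; cases p21; cases p22; simp)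

text \<open>Three cells without such a pair fill a whole row or column; these are the last six
  alternatives.\<close>

lemma bool_matrix_star:
  assumes "3 \<le> (of_bool p00 + of_bool p01 + of_bool p02 + (of_bool p10 + of_bool p11 + of_bool p12)
      + (of_bool p20 + of_bool p21 + of_bool p22) :: nat)"
  shows "(p00 \<and> (p11 \<or> p12 \<or> p21 \<or> p22)) \<or> (p01 \<and> (p10 \<or> p12 \<or> p20 \<or> p22)) \<or>
    (p02 \<and> (p10 \<or> p11 \<or> p20 \<or> p21)) \<or> (p10 \<and> (p21 \<or> p22)) \<or> (p11 \<and> (p20 \<or> p22)) \<or>
    (p12 \<and> (p20 \<or> p21)) \<or> (p00 \<and> p01 \<and> p02) \<or> (p10 \<and> p11 \<and> p12) \<or> (p20 \<and> p21 \<and> p22) \<or>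
    (p00 \<and> p10 \<and> p20) \<or> (p01 \<and> p11 \<and> p21) \<or> (p02 \<and> p12 \<and> p22)"
  using assms by (cases p00; cases p01; cases p02; cases p10; cases p11; cases p12; cases p20; cases p21; cases p22; simp)

text \<open>Each hypothesis says that an entry of \<open>q\<close> is set as soon as the complementary \<open>2 \<times> 2\<close>
  minor of \<open>p\<close> contains a diagonal.\<close>

lemma bool_matrix_complement:
  fixes p00 p01 p02 p10 p11 p12 p20 p21 p22 q00 q01 q02 q10 q11 q12 q20 q21 q22 :: bool
  assumes "p11 \<and> p22 \<or> p12 \<and> p21 \<Longrightarrow> q00" "p10 \<and> p22 \<or> p12 \<and> p20 \<Longrightarrow> q01" "p10 \<and> p21 \<or> p11 \<and> p20 \<Longrightarrow> q02"
    "p01 \<and> p22 \<or> p02 \<and> p21 \<Longrightarrow> q10" "p00 \<and> p22 \<or> p02 \<and> p20 \<Longrightarrow> q11" "p00 \<and> p21 \<or> p01 \<and> p20 \<Longrightarrow> q12"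
    "p01 \<and> p12 \<or> p02 \<and> p11 \<Longrightarrow> q20" "p00 \<and> p12 \<or> p02 \<and> p10 \<Longrightarrow> q21" "p00 \<and> p11 \<or> p01 \<and> p10 \<Longrightarrow> q22"
  defines "X \<equiv> of_bool p00 + of_bool p01 + of_bool p02 + (of_bool p10 + of_bool p11 + of_bool p12)
      + (of_bool p20 + of_bool p21 + of_bool p22) :: nat"
    and "Y \<equiv> of_bool q00 + of_bool q01 + of_bool q02 + (of_bool q10 + of_bool q11 + of_bool q12)
      + (of_bool q20 + of_bool q21 + of_bool q22) :: nat"
  shows "(4 \<le> X \<longrightarrow> 1 \<le> Y) \<and> (5 \<le> X \<longrightarrow> 3 \<le> Y) \<and> (7 \<le> X \<longrightarrow> 7 \<le> Y)"
proof -
  \<comment> \<open>It suffices to treat the smallest \<open>q\<close> that the hypotheses allow. It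
    is a function of \<open>p\<close>, which leaves the 512 values of \<open>p\<close>.\<close>
  define r00 where "r00 = (p11 \<and> p22 \<or> p12 \<and> p21)"
  define r01 where "r01 = (p10 \<and> p22 \<or> p12 \<and> p20)"
  define r02 where "r02 = (p10 \<and> p21 \<or> p11 \<and> p20)"
  define r10 where "r10 = (p01 \<and> p22 \<or> p02 \<and> p21)"
  define r11 where "r11 = (p00 \<and> p22 \<or> p02 \<and> p20)"
  define r12 where "r12 = (p00 \<and> p21 \<or> p01 \<and> p20)"
  define r20 where "r20 = (p01 \<and> p12 \<or> p02 \<and> p11)"
  define r21 where "r21 = (p00 \<and> p12 \<or> p02 \<and> p10)"
  define r22 where "r22 = (p00 \<and> p11 \<or> p01 \<and> p10)"
  define Z :: nat where "Z = of_bool r00 + of_bool r01 + of_bool r02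
    + (of_bool r10 + of_bool r11 + of_bool r12) + (of_bool r20 + of_bool r21 + of_bool r22)"
  have "Z \<le> Y" unfolding Z_def Y_def
    by (intro add_mono) (use assms(1-9) in \<open>auto simp: r00_def r01_def r02_def r10_def r11_def
      r12_def r20_def r21_def r22_def of_bool_def\<close>)
  moreover have "(4 \<le> X \<longrightarrow> 1 \<le> Z) \<and> (5 \<le> X \<longrightarrow> 3 \<le> Z) \<and> (7 \<le> X \<longrightarrow> 7 \<le> Z)"
    unfolding X_def Z_def r00_def r01_def r02_def r10_def r11_def r12_def r20_def r21_def r22_def
    by (cases p00; cases p01; cases p02; cases p10; cases p11; cases p12; cases p20; cases p21;
        cases p22; simp)
  ultimately show ?thesis by linarith
qed

context matched_family begin

definition L :: "nat \<Rightarrow> nat \<Rightarrow> nat \<Rightarrow> nat" where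
  "L i j l = (\<Sum>a\<in>M i. \<Sum>b\<in>M j. \<Sum>c\<in>M l. of_bool ({a, b, c} \<notin> F))"

definition g :: "nat \<Rightarrow> nat \<Rightarrow> nat" where
  "g i j = (\<Sum>a\<in>M i. \<Sum>b\<in>M j. of_bool ({a, b, 3 * s + 2} \<in> F))"

text \<open>The third vertex is \<open>3 * s + 1\<close> and not \<open>3 * s + 2\<close>, so that
  these non-edges lie inside \<open>{..<3 * s + 2}\<close> and count among the \<open>m\<close> of
  the overview.\<close>

definition miss :: "nat \<Rightarrow> nat \<Rightarrow> nat" where
  "miss i j = (\<Sum>a\<in>M i. \<Sum>b\<in>M j. of_bool ({a, b, 3 * s + 1} \<notin> F))"

text \<open>By shiftedness a pair counted by \<open>g i j\<close> puts both indices into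
  \<open>I\<close> (\<open>pair_in_I\<close>), so indices outside \<open>I\<close> contribute
  nothing to \<open>g\<close>.\<close>

definition I :: "nat set" where
  "I = {i. i < s \<and> (\<exists>a\<in>M i. {0, a, 3 * s + 2} \<in> F)}"

lemma L_swap12: "L i j l = L j i l"
  unfolding L_def by (subst sum.swap) (simp add: insert_commute)

lemma L_swap23: "L i j l = L i l j"
  unfolding L_def by (rule sum.cong[OF refl], subst sum.swap) (simp add: insert_commute)

lemma g_sym: "g i j = g j i"
  unfolding g_def by (subst sum.swap) (simp add: insert_commute)

lemma miss_sym: "miss i j = miss j i"
  unfolding miss_def by (subst sum.swap) (simp add: insert_commute)

lemma M_obtain:
  assumes "i < s" obtains a b c where "M i = {a, b, c}" "a \<noteq> b" "b \<noteq> c" "a \<noteq> c"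
  using edge_card[OF M_edge[OF assms]] by (auto simp: card_3_iff)

lemma M_obtain1:
  assumes "i < s" "a \<in> M i" obtains b c where "M i = {a, b, c}" "a \<noteq> b" "b \<noteq> c" "a \<noteq> c"
proof -
  have "card (M i) = 3" using edge_card M_edge assms by blast
  then have "card (M i - {a}) = 2" using assms M_finite by simp
  then obtain b c where "M i - {a} = {b, c}" "b \<noteq> c" by (auto simp: card_2_iff)
  then show ?thesis using that[of b c] assms(2) by blast
qed

lemma M_obtain2:
  assumes "i < s" "a \<in> M i" "b \<in> M i" "a \<noteq> b"
  obtains c where "M i = {a, b, c}" "b \<noteq> c" "a \<noteq> c"
proof -
  obtain x y where "M i = {a, x, y}" "a \<noteq> x" "x \<noteq> y" "a \<noteq> y" using M_obtain1 assms(1,2) by metis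
  then show ?thesis using that[of x] that[of y] assms by auto
qed

lemma pair_in_I:
  assumes "i < s" "j < s" "i \<noteq> j" "a \<in> M i" "b \<in> M j" "{a, b, 3 * s + 2} \<in> F"
  shows "{0, a, 3 * s + 2} \<in> F" "{0, b, 3 * s + 2} \<in> F"
proof -
  have ab: "0 < a" "a < 3 * s + 1" "0 < b" "b < 3 * s + 1"
    using M_range[OF assms(1,4)] M_range[OF assms(2,5)] by auto
  have "{b, a, 3 * s + 2} \<in> F" using assms(6) by (simp add: insert_commute)
  then show "{0, a, 3 * s + 2} \<in> F" by (rule edge_dominated) (use ab in auto)
  show "{0, b, 3 * s + 2} \<in> F" using assms(6) by (rule edge_dominated) (use ab in auto)
qed

text \<open>If \<open>0\<close> and \<open>a \<in> M i\<close> are joined to \<open>3 * s + 2\<close>, then \<open>(M i - {a}) \<union> {3 * s + 1} \<union> M j \<union> M l\<close> has no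
  perfect matching. Its 9 rainbow matchings along cyclic diagonals are pairwise disjoint, so each
  of them costs a separate non-edge.\<close>

lemma miss_lower:
  assumes ijl: "j < s" "l < s" "i \<noteq> j" "j \<noteq> l" "i \<noteq> l" and "i \<in> I"
  shows "9 \<le> L i j l + miss j l"
proof -
  obtain a where i: "i < s" "a \<in> M i" "{0, a, 3 * s + 2} \<in> F" using assms(6) by (auto simp: I_def)
  obtain a' a'' where Mi: "M i = {a, a', a''}" "a \<noteq> a'" "a' \<noteq> a''" "a \<noteq> a''" using M_obtain1 i by metis
  obtain b0 b1 b2 where Mj: "M j = {b0, b1, b2}" "b0 \<noteq> b1" "b1 \<noteq> b2" "b0 \<noteq> b2" using M_obtain ijl by metis
  obtain c0 c1 c2 where Ml: "M l = {c0, c1, c2}" "c0 \<noteq> c1" "c1 \<noteq> c2" "c0 \<noteq> c2" using M_obtain ijl by metis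
  have key: "1 \<le> of_bool ({a', b, c} \<notin> F) + of_bool ({a'', b', c'} \<notin> F) + (of_bool ({b'', c'', 3 * s + 1} \<notin> F) :: nat)"
    if "{b0, b1, b2} = {b, b', b''}" "{c0, c1, c2} = {c, c', c''}" for b b' b'' c c' c''
    using rainbow_missing[OF i(1) ijl(1,2,3,4,5) Mi(1), of b b' b'' c c' c''] Mj(1) Ml(1) that i(3) by auto
  have 1: "{b0, b1, b2} = {b1, b2, b0}" "{b0, b1, b2} = {b2, b0, b1}"
    "{c0, c1, c2} = {c1, c2, c0}" "{c0, c1, c2} = {c2, c0, c1}" by auto
  show ?thesis
    using key[OF refl refl] key[OF refl 1(3)] key[OF refl 1(4)]
      key[OF 1(1) refl] key[OF 1(1) 1(3)] key[OF 1(1) 1(4)]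
      key[OF 1(2) refl] key[OF 1(2) 1(3)] key[OF 1(2) 1(4)] Mi(2-) Mj(2-) Ml(2-)
    unfolding L_def miss_def Mi(1) Mj(1) Ml(1) by (simp del: sum_of_bool_eq)
qed


definition nd :: "nat \<Rightarrow> nat \<Rightarrow> nat \<Rightarrow> nat" where "nd a b c = of_bool ({a, b, c} \<notin> F)"

lemma nd_le_1: "nd a b c \<le> 1" by (simp add: nd_def)

lemma L_expand:
  assumes "M i = {a0, a1, a2}" "a0 \<noteq> a1" "a1 \<noteq> a2" "a0 \<noteq> a2"
    "M j = {b0, b1, b2}" "b0 \<noteq> b1" "b1 \<noteq> b2" "b0 \<noteq> b2"
    "M l = {c0, c1, c2}" "c0 \<noteq> c1" "c1 \<noteq> c2" "c0 \<noteq> c2"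
  shows "L i j l =
    (nd a0 b0 c0 + nd a0 b0 c1 + nd a0 b0 c2 + (nd a0 b1 c0 + nd a0 b1 c1 + nd a0 b1 c2)
      + (nd a0 b2 c0 + nd a0 b2 c1 + nd a0 b2 c2))
    + (nd a1 b0 c0 + nd a1 b0 c1 + nd a1 b0 c2 + (nd a1 b1 c0 + nd a1 b1 c1 + nd a1 b1 c2)
      + (nd a1 b2 c0 + nd a1 b2 c1 + nd a1 b2 c2))
    + (nd a2 b0 c0 + nd a2 b0 c1 + nd a2 b0 c2 + (nd a2 b1 c0 + nd a2 b1 c1 + nd a2 b1 c2)
      + (nd a2 b2 c0 + nd a2 b2 c1 + nd a2 b2 c2))"
  using assms(2-4,6-8,10-12) unfolding L_def assms(1,5,9) nd_def[symmetric] by simp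

text \<open>For an active triple, antipodal triples of the complementary \<open>2 \<times> 2 \<times> 2\<close> cube are never both
  edges, so at least four of its eight triples are non-edges. Two active triples that differ in
  all (in two) coordinates have cubes meeting in one (in two) triples.\<close>

definition act :: "nat \<Rightarrow> nat \<Rightarrow> nat \<Rightarrow> bool" where
  "act a b c \<longleftrightarrow> {a, b, 3 * s + 2} \<in> F \<and> {0, c, 3 * s + 2} \<in> F \<or>
    {b, c, 3 * s + 2} \<in> F \<and> {0, a, 3 * s + 2} \<in> F \<or> {a, c, 3 * s + 2} \<in> F \<and> {0, b, 3 * s + 2} \<in> F"

lemma act_antipodal:
  assumes ijl: "i < s" "j < s" "l < s" "i \<noteq> j" "j \<noteq> l" "i \<noteq> l"
    and M: "M i = {a, a', a''}" "M j = {b, b', b''}" "M l = {c, c', c''}" and "act a b c"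
  shows "1 \<le> nd a' b' c' + nd a'' b'' c''"
proof -
  have 1: "{a', b', c'} = {b', c', a'}" "{a'', b'', c''} = {b'', c'', a''}"
    "{a', b', c'} = {a', c', b'}" "{a'', b'', c''} = {a'', c'', b''}" by auto
  have "{a', b', c'} \<notin> F \<or> {a'', b'', c''} \<notin> F"
    using assms(10) antipodal_not_both[OF ijl M]
      antipodal_not_both[OF ijl(2,3,1,5) ijl(6)[symmetric] ijl(4)[symmetric] M(2,3,1)]
      antipodal_not_both[OF ijl(1,3,2,6) ijl(5)[symmetric] ijl(4) M(1,3,2)]
    unfolding act_def 1(1,2) 1(3,4)
    by (metis 1)
  then show ?thesis by (auto simp: nd_def)
qed

context
  fixes i j l
  assumes ijl: "i < s" "j < s" "l < s" "i \<noteq> j" "j \<noteq> l" "i \<noteq> l"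
begin

lemma L_ge_4:
  assumes "a \<in> M i" "b \<in> M j" "c \<in> M l" "act a b c"
  shows "4 \<le> L i j l"
proof -
  obtain a1 a2 where Mi: "M i = {a, a1, a2}" "a \<noteq> a1" "a1 \<noteq> a2" "a \<noteq> a2" using M_obtain1 ijl assms by metis
  obtain b1 b2 where Mj: "M j = {b, b1, b2}" "b \<noteq> b1" "b1 \<noteq> b2" "b \<noteq> b2" using M_obtain1 ijl assms by metis
  obtain c1 c2 where Ml: "M l = {c, c1, c2}" "c \<noteq> c1" "c1 \<noteq> c2" "c \<noteq> c2" using M_obtain1 ijl assms by metis
  have M': "M j = {b, b2, b1}" "M l = {c, c2, c1}" using Mj Ml by auto
  note A = act_antipodal[OF ijl _ _ _ assms(4)]
  show ?thesis
    using A[OF Mi(1) Mj(1) Ml(1)] A[OF Mi(1) M'(1) Ml(1)] A[OF Mi(1) Mj(1) M'(2)] A[OF Mi(1) M']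
      L_expand[OF Mi Mj Ml] by linarith
qed

lemma L_ge_6:
  assumes "a \<in> M i" "a' \<in> M i" "b \<in> M j" "b' \<in> M j" "c \<in> M l" "a \<noteq> a'" "b \<noteq> b'" "act a b c" "act a' b' c"
  shows "6 \<le> L i j l"
proof -
  obtain a2 where Mi: "M i = {a, a', a2}" "a' \<noteq> a2" "a \<noteq> a2" using M_obtain2 ijl assms by metis
  obtain b2 where Mj: "M j = {b, b', b2}" "b' \<noteq> b2" "b \<noteq> b2" using M_obtain2 ijl assms by metis
  obtain c1 c2 where Ml: "M l = {c, c1, c2}" "c \<noteq> c1" "c1 \<noteq> c2" "c \<noteq> c2" using M_obtain1 ijl assms by metis
  have M': "M j = {b, b2, b'}" "M l = {c, c2, c1}" "M i = {a', a, a2}" "M j = {b', b, b2}" "M j = {b', b2, b}"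
    using Mi Mj Ml by auto
  note A = act_antipodal[OF ijl _ _ _ assms(8)] and B = act_antipodal[OF ijl _ _ _ assms(9)]
  show ?thesis
    using A[OF Mi(1) Mj(1) Ml(1)] A[OF Mi(1) M'(1) Ml(1)] A[OF Mi(1) Mj(1) M'(2)] A[OF Mi(1) M'(1,2)]
      B[OF M'(3) M'(4) Ml(1)] B[OF M'(3) M'(5) Ml(1)] B[OF M'(3) M'(4) M'(2)] B[OF M'(3) M'(5) M'(2)]
      L_expand[OF Mi(1) assms(6) Mi(2,3) Mj(1) assms(7) Mj(2,3) Ml] nd_le_1[of a2 b2 c1] nd_le_1[of a2 b2 c2]
    by linarith
qed

lemma L_ge_7:
  assumes "a \<in> M i" "a' \<in> M i" "b \<in> M j" "b' \<in> M j" "c \<in> M l" "c' \<in> M l"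
    "a \<noteq> a'" "b \<noteq> b'" "c \<noteq> c'" "act a b c" "act a' b' c'"
  shows "7 \<le> L i j l"
proof -
  obtain a2 where Mi: "M i = {a, a', a2}" "a' \<noteq> a2" "a \<noteq> a2" using M_obtain2 ijl assms by metis
  obtain b2 where Mj: "M j = {b, b', b2}" "b' \<noteq> b2" "b \<noteq> b2" using M_obtain2 ijl assms by metis
  obtain c2 where Ml: "M l = {c, c', c2}" "c' \<noteq> c2" "c \<noteq> c2" using M_obtain2 ijl assms by metis
  have M': "M j = {b, b2, b'}" "M l = {c, c2, c'}" "M i = {a', a, a2}" "M j = {b', b, b2}" "M j = {b', b2, b}"
     "M l = {c', c, c2}" "M l = {c', c2, c}"
    using Mi Mj Ml by auto
  note A = act_antipodal[OF ijl _ _ _ assms(10)] and B = act_antipodal[OF ijl _ _ _ assms(11)]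
  show ?thesis
    using A[OF Mi(1) Mj(1) Ml(1)] A[OF Mi(1) M'(1) Ml(1)] A[OF Mi(1) Mj(1) M'(2)] A[OF Mi(1) M'(1,2)]
      B[OF M'(3) M'(4) M'(6)] B[OF M'(3) M'(5) M'(6)] B[OF M'(3) M'(4) M'(7)] B[OF M'(3) M'(5) M'(7)]
      L_expand[OF Mi(1) assms(7) Mi(2,3) Mj(1) assms(8) Mj(2,3) Ml(1) assms(9) Ml(2,3)] nd_le_1[of a2 b2 c2]
    by linarith
qed

end

text \<open>Since \<open>0\<close> is the smallest vertex, a pair that forms no edge with
  \<open>0\<close> forms none with any other vertex. A dead pair therefore costs three triples in
  \<open>L i j l\<close> for every \<open>l\<close>.\<close>

definition dead :: "nat \<Rightarrow> nat \<Rightarrow> nat" where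
  "dead i j = (\<Sum>a\<in>M i. \<Sum>b\<in>M j. of_bool ({0, a, b} \<notin> F))"

text \<open>Two disjoint pairs of \<open>G\<close> between \<open>M i\<close> and \<open>M j\<close>
  kill the pair of the remaining vertices by \<open>two_pairs_kill\<close>;
  \<open>bool_matrix_complement\<close> counts the pairs killed in this way.\<close>

lemma dead_lower:
  assumes ij: "i < s" "j < s" "i \<noteq> j"
  shows "(4 \<le> g i j \<longrightarrow> 1 \<le> dead i j) \<and> (5 \<le> g i j \<longrightarrow> 3 \<le> dead i j) \<and> (7 \<le> g i j \<longrightarrow> 7 \<le> dead i j)"
proof -
  obtain a0 a1 a2 where Mi: "M i = {a0, a1, a2}" "a0 \<noteq> a1" "a1 \<noteq> a2" "a0 \<noteq> a2" using M_obtain ij by metis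
  obtain b0 b1 b2 where Mj: "M j = {b0, b1, b2}" "b0 \<noteq> b1" "b1 \<noteq> b2" "b0 \<noteq> b2" using M_obtain ij by metis
  let ?p = "\<lambda>a b. {a, b, 3 * s + 2} \<in> F" and ?q = "\<lambda>a b. {0, a, b} \<notin> F"
  have K: "?q a'' b''" if "{a0, a1, a2} = {a, a', a''}" "{b0, b1, b2} = {b, b', b''}"
    "?p a b \<and> ?p a' b' \<or> ?p a b' \<and> ?p a' b" for a a' a'' b b' b''
  proof -
    have "M i = {a, a', a''}" "M j = {b, b', b''}" "M j = {b', b, b''}"
      using that Mi(1) Mj(1) by auto
    then show ?thesis using that(3) two_pairs_kill[OF ij] by blast
  qed
  have g: "g i j = of_bool (?p a0 b0) + of_bool (?p a0 b1) + of_bool (?p a0 b2)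
      + (of_bool (?p a1 b0) + of_bool (?p a1 b1) + of_bool (?p a1 b2))
      + (of_bool (?p a2 b0) + of_bool (?p a2 b1) + of_bool (?p a2 b2))"
    unfolding g_def Mi(1) Mj(1) using Mi(2-) Mj(2-) by (simp del: sum_of_bool_eq)
  have d: "dead i j = of_bool (?q a0 b0) + of_bool (?q a0 b1) + of_bool (?q a0 b2)
      + (of_bool (?q a1 b0) + of_bool (?q a1 b1) + of_bool (?q a1 b2))
      + (of_bool (?q a2 b0) + of_bool (?q a2 b1) + of_bool (?q a2 b2))"
    unfolding dead_def Mi(1) Mj(1) using Mi(2-) Mj(2-) by (simp del: sum_of_bool_eq)
  show ?thesis unfolding g d
    by (rule bool_matrix_complement; erule K[rotated 2]; auto)
qed

lemma L_ge_dead: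
  assumes ijl: "i < s" "j < s" "l < s" "i \<noteq> j" "j \<noteq> l" "i \<noteq> l"
  shows "3 * dead i j \<le> L i j l"
proof -
  have "of_bool ({0, a, b} \<notin> F) * card (M l) \<le> (\<Sum>c\<in>M l. of_bool ({a, b, c} \<notin> F) :: nat)"
    if "a \<in> M i" "b \<in> M j" for a b
  proof (cases "{0, a, b} \<in> F")
    case False
    have ab: "a \<noteq> 0" "b \<noteq> 0" "a \<noteq> b"
      using M_range ijl that M_distinct[OF ijl(1,2,4) that] by fastforce+
    have "{a, b, c} \<notin> F" for c using dead_pair[OF False ab, of c] by (simp add: insert_commute)
    then show ?thesis using False by simp
  qed simp
  then have "(\<Sum>a\<in>M i. \<Sum>b\<in>M j. of_bool ({0, a, b} \<notin> F) * card (M l)) \<le> L i j l"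
    unfolding L_def by (intro sum_mono) auto
  moreover have "card (M l) = 3" using edge_card M_edge ijl by blast
  ultimately show ?thesis unfolding dead_def by (simp add: sum_distrib_left mult.commute del: sum_of_bool_eq)
qed

end

text \<open>With \<open>p\<close> dead rows and \<open>r\<close> dead columns of a \<open>3 \<times> 3\<close> array at least \<open>9 - (3 - p) (3 - r)\<close> entries
  are dead; the linear bound below is tight for \<open>p = r = 3\<close> and \<open>p = r = 0\<close>.\<close>

lemma bool_cross_count:
  fixes e00 e01 e02 e10 e11 e12 e20 e21 e22 :: nat
  assumes "p0 \<Longrightarrow> 1 \<le> e00 \<and> 1 \<le> e01 \<and> 1 \<le> e02" "p1 \<Longrightarrow> 1 \<le> e10 \<and> 1 \<le> e11 \<and> 1 \<le> e12"
    "p2 \<Longrightarrow> 1 \<le> e20 \<and> 1 \<le> e21 \<and> 1 \<le> e22" "r0 \<Longrightarrow> 1 \<le> e00 \<and> 1 \<le> e10 \<and> 1 \<le> e20"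
    "r1 \<Longrightarrow> 1 \<le> e01 \<and> 1 \<le> e11 \<and> 1 \<le> e21" "r2 \<Longrightarrow> 1 \<le> e02 \<and> 1 \<le> e12 \<and> 1 \<le> e22" "1 \<le> e00"
  shows "3 + 4 * (of_bool p0 + of_bool p1 + of_bool p2 + (of_bool r0 + of_bool r1 + of_bool r2))
    \<le> 3 * (e00 + e01 + e02 + (e10 + e11 + e12) + (e20 + e21 + e22))"
  using assms by (cases p0; cases p1; cases p2; cases r0; cases r1; cases r2; simp)

lemma matrix_disjoint:
  assumes A: "a0 \<in> A" "a1 \<in> A" "a2 \<in> A" "a0 \<noteq> a1" "a1 \<noteq> a2" "a0 \<noteq> a2"
    and B: "b0 \<in> B" "b1 \<in> B" "b2 \<in> B" "b0 \<noteq> b1" "b1 \<noteq> b2" "b0 \<noteq> b2"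
    and 4: "4 \<le> (of_bool (Q a0 b0) + of_bool (Q a0 b1) + of_bool (Q a0 b2)
      + (of_bool (Q a1 b0) + of_bool (Q a1 b1) + of_bool (Q a1 b2))
      + (of_bool (Q a2 b0) + of_bool (Q a2 b1) + of_bool (Q a2 b2)) :: nat)"
  shows "\<exists>a\<in>A. \<exists>a'\<in>A. \<exists>b\<in>B. \<exists>b'\<in>B. a \<noteq> a' \<and> b \<noteq> b' \<and> Q a b \<and> Q a' b'"
proof (rule ccontr)
  assume "\<not> ?thesis"
  then have n: "\<not> (Q a b \<and> Q a' b')" if "a \<in> A" "a' \<in> A" "b \<in> B" "b' \<in> B" "a \<noteq> a'" "b \<noteq> b'" for a a' b b'
    using that by blast
  show False using bool_matrix_disjoint[OF 4]
    by (elim disjE conjE) (use n A B in metis)+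
qed

lemma matrix_star:
  assumes A: "a0 \<in> A" "a1 \<in> A" "a2 \<in> A" "a0 \<noteq> a1" "a1 \<noteq> a2" "a0 \<noteq> a2"
    and B: "b0 \<in> B" "b1 \<in> B" "b2 \<in> B" "b0 \<noteq> b1" "b1 \<noteq> b2" "b0 \<noteq> b2"
    and AB: "A = {a0, a1, a2}" "B = {b0, b1, b2}"
    and 3: "3 \<le> (of_bool (Q a0 b0) + of_bool (Q a0 b1) + of_bool (Q a0 b2)
      + (of_bool (Q a1 b0) + of_bool (Q a1 b1) + of_bool (Q a1 b2))
      + (of_bool (Q a2 b0) + of_bool (Q a2 b1) + of_bool (Q a2 b2)) :: nat)"
  shows "(\<exists>a\<in>A. \<exists>a'\<in>A. \<exists>b\<in>B. \<exists>b'\<in>B. a \<noteq> a' \<and> b \<noteq> b' \<and> Q a b \<and> Q a' b')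
    \<or> (\<exists>a\<in>A. \<forall>b\<in>B. Q a b) \<or> (\<exists>b\<in>B. \<forall>a\<in>A. Q a b)"
proof (rule ccontr)
  assume c: "\<not> ?thesis"
  then have n: "\<not> (Q a b \<and> Q a' b')" if "a \<in> A" "a' \<in> A" "b \<in> B" "b' \<in> B" "a \<noteq> a'" "b \<noteq> b'" for a a' b b'
    using that by blast
  have r: "\<not> (Q a b0 \<and> Q a b1 \<and> Q a b2)" if "a \<in> A" for a using c that unfolding AB(2) by blast
  have q: "\<not> (Q a0 b \<and> Q a1 b \<and> Q a2 b)" if "b \<in> B" for b using c that unfolding AB(1) by blast
  show False using bool_matrix_star[OF 3]
    by (elim disjE conjE) (use n r q A B in metis)+
qed

section \<open>Non-edges of a triple of matching edges in terms of its number of pairs of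
  \<open>G\<close>\<close>

context matched_family begin

abbreviation P :: "nat \<Rightarrow> nat \<Rightarrow> bool" where "P a b \<equiv> {a, b, 3 * s + 2} \<in> F"
abbreviation N1 :: "nat \<Rightarrow> bool" where "N1 a \<equiv> {0, a, 3 * s + 2} \<in> F"

lemma g_expand:
  assumes "M i = {a0, a1, a2}" "a0 \<noteq> a1" "a1 \<noteq> a2" "a0 \<noteq> a2"
    "M j = {b0, b1, b2}" "b0 \<noteq> b1" "b1 \<noteq> b2" "b0 \<noteq> b2"
  shows "g i j = of_bool (P a0 b0) + of_bool (P a0 b1) + of_bool (P a0 b2)
      + (of_bool (P a1 b0) + of_bool (P a1 b1) + of_bool (P a1 b2))
      + (of_bool (P a2 b0) + of_bool (P a2 b1) + of_bool (P a2 b2))"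
  unfolding g_def assms(1,5) using assms(2-4,6-8) by (simp del: sum_of_bool_eq)

lemma g_disjoint:
  assumes ij: "i < s" "j < s" and "4 \<le> g i j"
  shows "\<exists>a\<in>M i. \<exists>a'\<in>M i. \<exists>b\<in>M j. \<exists>b'\<in>M j. a \<noteq> a' \<and> b \<noteq> b' \<and> P a b \<and> P a' b'"
proof -
  obtain a0 a1 a2 where Mi: "M i = {a0, a1, a2}" "a0 \<noteq> a1" "a1 \<noteq> a2" "a0 \<noteq> a2" using M_obtain ij by metis
  obtain b0 b1 b2 where Mj: "M j = {b0, b1, b2}" "b0 \<noteq> b1" "b1 \<noteq> b2" "b0 \<noteq> b2" using M_obtain ij by metis
  show ?thesis
    by (rule matrix_disjoint[OF _ _ _ Mi(2-) _ _ _ Mj(2-) assms(3)[unfolded g_expand[OF Mi Mj]]])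
      (simp_all add: Mi(1) Mj(1))
qed

lemma g_star:
  assumes ij: "i < s" "j < s" and "3 \<le> g i j"
  shows "(\<exists>a\<in>M i. \<exists>a'\<in>M i. \<exists>b\<in>M j. \<exists>b'\<in>M j. a \<noteq> a' \<and> b \<noteq> b' \<and> P a b \<and> P a' b')
    \<or> (\<exists>a\<in>M i. \<forall>b\<in>M j. P a b) \<or> (\<exists>b\<in>M j. \<forall>a\<in>M i. P a b)"
proof -
  obtain a0 a1 a2 where Mi: "M i = {a0, a1, a2}" "a0 \<noteq> a1" "a1 \<noteq> a2" "a0 \<noteq> a2" using M_obtain ij by metis
  obtain b0 b1 b2 where Mj: "M j = {b0, b1, b2}" "b0 \<noteq> b1" "b1 \<noteq> b2" "b0 \<noteq> b2" using M_obtain ij by metis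
  show ?thesis
    by (rule matrix_star[OF _ _ _ Mi(2-) _ _ _ Mj(2-) Mi(1) Mj(1) assms(3)[unfolded g_expand[OF Mi Mj]]])
      (simp_all add: Mi(1) Mj(1))
qed

lemma g_pos:
  assumes "1 \<le> g i j" shows "\<exists>a\<in>M i. \<exists>b\<in>M j. P a b"
proof (rule ccontr)
  assume "\<not> ?thesis"
  then have "g i j = 0" unfolding g_def by (intro sum.neutral ballI) auto
  then show False using assms by simp
qed

lemma L_rot: "L j l i = L i j l" "L i l j = L i j l" "L j i l = L i j l" "L l i j = L i j l" "L l j i = L i j l"
  using L_swap12 L_swap23 by metis+

context
  fixes i j l
  assumes ijl: "i < s" "j < s" "l < s" "i \<noteq> j" "j \<noteq> l" "i \<noteq> l"
begin

lemma dead_conseq: "5 \<le> g i j \<Longrightarrow> 9 \<le> L i j l" "7 \<le> g i j \<Longrightarrow> 21 \<le> L i j l" "4 \<le> g i j \<Longrightarrow> 3 \<le> L i j l"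
  using dead_lower[OF ijl(1,2,4)] L_ge_dead[OF ijl] by linarith+

lemma L_ge_4_I: "l \<in> I \<Longrightarrow> 1 \<le> g i j \<Longrightarrow> 4 \<le> L i j l"
  using g_pos[of i j] L_ge_4[OF ijl] unfolding I_def act_def by blast

lemma L_ge_6_disjoint:
  assumes "l \<in> I" "a \<in> M i" "a' \<in> M i" "b \<in> M j" "b' \<in> M j" "a \<noteq> a'" "b \<noteq> b'" "P a b" "P a' b'"
  shows "6 \<le> L i j l"
proof -
  obtain c where "c \<in> M l" "N1 c" using assms by (auto simp: I_def)
  then show ?thesis using assms L_ge_6[OF ijl, of a a' b b' c] by (auto simp: act_def)
qed

text \<open>Two active triples differing in exactly two coordinates are needed. If two vertices of
  \<open>M l\<close> satisfy \<open>N1\<close>, they share \<open>a\<close>. Otherwise all pairs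
  into \<open>M l\<close> end in the single vertex \<open>c\<close>, so \<open>g j l\<close> is at
  most 3, and the remaining two pairs of \<open>g i l\<close> yield \<open>P a' c\<close> with
  \<open>a'\<close> different from \<open>a\<close>; then the active triples share
  \<open>c\<close>.\<close>

lemma L_ge_6_star:
  assumes "l \<in> I" "a \<in> M i" "\<forall>b\<in>M j. P a b" "5 \<le> g j l + g i l"
  shows "6 \<le> L i j l"
proof -
  obtain b0 b1 b2 where Mj: "M j = {b0, b1, b2}" "b0 \<noteq> b1" "b1 \<noteq> b2" "b0 \<noteq> b2" using M_obtain ijl by metis
  have Pb: "P a b0" "P a b1" "P a b2" using assms(3) Mj(1) by auto
  obtain c where c: "c \<in> M l" "N1 c" using assms by (auto simp: I_def)
  obtain c1 c2 where Ml: "M l = {c, c1, c2}" "c \<noteq> c1" "c1 \<noteq> c2" "c \<noteq> c2" using M_obtain1 ijl c by metis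
  show ?thesis
  proof (cases "N1 c1 \<or> N1 c2")
    case True
    then obtain c' where c': "c' \<in> M l" "c' \<noteq> c" "N1 c'" using Ml by auto
    have "act b0 c a" "act b1 c' a" using c c' Pb by (auto simp: act_def insert_commute)
    then have "6 \<le> L j l i" using L_ge_6[of j l i b0 b1 c c' a] ijl assms(2) c c' Mj by auto
    then show ?thesis using L_rot by metis
  next
    case False
    have no: "\<not> P x c1 \<and> \<not> P x c2" if "x \<in> M i \<or> x \<in> M j" for x
    proof -
      have c12: "c1 \<in> M l" "c2 \<in> M l" using Ml by auto
      have k: "x \<in> M k \<Longrightarrow> k < s \<Longrightarrow> k \<noteq> l \<Longrightarrow> \<not> P x c1 \<and> \<not> P x c2" for k
        using pair_in_I(2)[of k l x c1] pair_in_I(2)[of k l x c2] c12 ijl False by auto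
      show ?thesis using that k[of i] k[of j] ijl by auto
    qed
    obtain a1 a2 where Mi: "M i = {a, a1, a2}" "a \<noteq> a1" "a1 \<noteq> a2" "a \<noteq> a2" using M_obtain1 ijl assms by metis
    have n: "\<not> P a c1" "\<not> P a c2" "\<not> P a1 c1" "\<not> P a1 c2" "\<not> P a2 c1" "\<not> P a2 c2"
      "\<not> P b0 c1" "\<not> P b0 c2" "\<not> P b1 c1" "\<not> P b1 c2" "\<not> P b2 c1" "\<not> P b2 c2"
      using no Mi(1) Mj(1) by auto
    have "g j l = of_bool (P b0 c) + of_bool (P b1 c) + of_bool (P b2 c)"
      using g_expand[OF Mj Ml] n by simp
    then have "g j l \<le> 3" by simp
    moreover have "g i l = of_bool (P a c) + of_bool (P a1 c) + of_bool (P a2 c)"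
      using g_expand[OF Mi Ml] n by simp
    ultimately have "P a1 c \<or> P a2 c" using assms(4) by (auto simp: of_bool_def split: if_splits)
    then obtain a' where a': "a' \<in> M i" "a' \<noteq> a" "P a' c" using Mi by auto
    have "N1 b1" using pair_in_I(2)[of i j a b1] ijl assms(2) Mj Pb by auto
    then have "act a' b1 c" "act a b0 c" using a' Pb c by (auto simp: act_def)
    then show ?thesis using L_ge_6[OF ijl, of a' a b1 b0 c] a' assms(2) c Mj by auto
  qed
qed

text \<open>Two disjoint pairs between \<open>M i\<close> and \<open>M j\<close> are completed to
  active triples by two different vertices of \<open>M l\<close>; the pairs between
  \<open>M i\<close> and \<open>M l\<close> serve to provide \<open>N1\<close> for these two
  vertices.\<close>

lemma L_ge_7_I:
  assumes "4 \<le> g i j" "4 \<le> g i l" shows "7 \<le> L i j l"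
proof -
  obtain a a' b b' where ab: "a \<in> M i" "a' \<in> M i" "b \<in> M j" "b' \<in> M j" "a \<noteq> a'" "b \<noteq> b'" "P a b" "P a' b'"
    using g_disjoint[OF ijl(1,2) assms(1)] by blast
  obtain x x' c c' where xc: "x \<in> M i" "x' \<in> M i" "c \<in> M l" "c' \<in> M l" "x \<noteq> x'" "c \<noteq> c'" "P x c" "P x' c'"
    using g_disjoint[OF ijl(1,3) assms(2)] by blast
  have "N1 c" "N1 c'" using pair_in_I(2)[OF ijl(1,3,6)] xc by auto
  then show ?thesis using L_ge_7[OF ijl, of a a' b b' c c'] ab xc by (auto simp: act_def)
qed

text \<open>A dead pair \<open>b0\<close>, \<open>c0\<close> is a dead entry in the array of
  \<open>M j\<close> and \<open>M l\<close> for each of the three vertices of \<open>M i\<close>.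
  Dead pairs at such a vertex are dead rows and columns of its array, so summing
  \<open>bool_cross_count\<close> over \<open>M i\<close> gives \<open>3 * L i j l\<close> at least
  \<open>9 + 4 * 3 + 4 * 3 = 33\<close>.\<close>

lemma L_ge_11:
  assumes "5 \<le> g i j" "5 \<le> g i l" "4 \<le> g j l" shows "11 \<le> L i j l"
proof -
  have d: "3 \<le> dead i j" "3 \<le> dead i l" "1 \<le> dead j l"
    using dead_lower ijl assms by auto
  have "\<exists>b\<in>M j. \<exists>c\<in>M l. {0, b, c} \<notin> F"
  proof (rule ccontr)
    assume "\<not> ?thesis"
    then have "dead j l = 0" unfolding dead_def by (intro sum.neutral ballI) auto
    then show False using d by simp
  qed
  then obtain b0 c0 where bc: "b0 \<in> M j" "c0 \<in> M l" "{0, b0, c0} \<notin> F" by blast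
  obtain a0 a1 a2 where Mi: "M i = {a0, a1, a2}" "a0 \<noteq> a1" "a1 \<noteq> a2" "a0 \<noteq> a2" using M_obtain ijl by metis
  obtain b1 b2 where Mj: "M j = {b0, b1, b2}" "b0 \<noteq> b1" "b1 \<noteq> b2" "b0 \<noteq> b2" using M_obtain1 ijl bc by metis
  obtain c1 c2 where Ml: "M l = {c0, c1, c2}" "c0 \<noteq> c1" "c1 \<noteq> c2" "c0 \<noteq> c2" using M_obtain1 ijl bc by metis
  have nz: "x \<noteq> 0" if "x \<in> M i \<union> M j \<union> M l" for x using M_range ijl that by fastforce
  have dp: "1 \<le> nd a b c" if "{0, a, b} \<notin> F \<or> {0, a, c} \<notin> F \<or> {0, b, c} \<notin> F" "a \<in> M i" "b \<in> M j" "c \<in> M l" for a b c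
  proof -
    have ne: "a \<noteq> b" "a \<noteq> c" "b \<noteq> c" "a \<noteq> 0" "b \<noteq> 0" "c \<noteq> 0"
      using M_distinct[of i j a b] M_distinct[of i l a c] M_distinct[of j l b c] nz ijl that by auto
    have "{a, b, c} \<notin> F"
      using that(1) dead_pair[of a b c] dead_pair[of a c b] dead_pair[of b c a] ne
      by (auto simp: insert_commute)
    then show ?thesis by (simp add: nd_def)
  qed
  let ?E = "\<lambda>a. nd a b0 c0 + nd a b0 c1 + nd a b0 c2 + (nd a b1 c0 + nd a b1 c1 + nd a b1 c2)
      + (nd a b2 c0 + nd a b2 c1 + nd a b2 c2)"
  define dd where "dd a b = (of_bool ({0, a, b} \<notin> F) :: nat)" for a b
  have E: "3 + 4 * (dd a b0 + dd a b1 + dd a b2 + (dd a c0 + dd a c1 + dd a c2)) \<le> 3 * ?E a" if "a \<in> M i" for a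
    unfolding dd_def by (rule bool_cross_count) (intro conjI dp; use that bc Mj(1) Ml(1) in auto)+
  have "dead i j = dd a0 b0 + dd a0 b1 + dd a0 b2 + (dd a1 b0 + dd a1 b1 + dd a1 b2) + (dd a2 b0 + dd a2 b1 + dd a2 b2)"
    unfolding dead_def dd_def[symmetric] Mi(1) Mj(1) using Mi(2-) Mj(2-) by simp
  moreover have "dead i l = dd a0 c0 + dd a0 c1 + dd a0 c2 + (dd a1 c0 + dd a1 c1 + dd a1 c2) + (dd a2 c0 + dd a2 c1 + dd a2 c2)"
    unfolding dead_def dd_def[symmetric] Mi(1) Ml(1) using Mi(2-) Ml(2-) by simp
  moreover have "L i j l = ?E a0 + ?E a1 + ?E a2" using L_expand[OF Mi Mj Ml] by simp
  moreover have "a0 \<in> M i" "a1 \<in> M i" "a2 \<in> M i" using Mi by auto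
  note E[OF this(1)] E[OF this(2)] E[OF this(3)]
  moreover define EE pp rr where "EE a = ?E a" and "pp a = dd a b0 + dd a b1 + dd a b2"
    and "rr a = dd a c0 + dd a c1 + dd a c2" for a
  ultimately have "3 + 4 * (pp a0 + rr a0) \<le> 3 * EE a0" "3 + 4 * (pp a1 + rr a1) \<le> 3 * EE a1"
    "3 + 4 * (pp a2 + rr a2) \<le> 3 * EE a2" "L i j l = EE a0 + EE a1 + EE a2"
    "dead i j = pp a0 + pp a1 + pp a2" "dead i l = rr a0 + rr a1 + rr a2"
    by (simp_all only: EE_def pp_def rr_def)
  then have h: "9 + 4 * dead i j + 4 * dead i l \<le> 3 * L i j l" by simp
  have "4 * dead i j \<ge> 12" "4 * dead i l \<ge> 12" using d(1,2) by simp_all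
  with h have "33 \<le> 3 * L i j l" by linarith
  then show ?thesis by presburger
qed

end

lemma L_ge_6_aux:
  assumes ijl: "i \<noteq> j" "j \<noteq> l" "i \<noteq> l" "i \<in> I" "j \<in> I" "l \<in> I"
    and "3 \<le> g i j" "8 \<le> g i j + g j l + g i l"
  shows "6 \<le> L i j l"
proof (cases "4 \<le> g i j")
  case True
  have s: "i < s" "j < s" "l < s" using ijl by (auto simp: I_def)
  from g_disjoint[OF s(1,2) True] show ?thesis using L_ge_6_disjoint[OF s ijl(1-3,6)] by blast
next
  case False
  have s: "i < s" "j < s" "l < s" using ijl by (auto simp: I_def)
  from g_star[OF s(1,2) assms(7)] show ?thesis
  proof (elim disjE)
    assume "\<exists>a\<in>M i. \<exists>a'\<in>M i. \<exists>b\<in>M j. \<exists>b'\<in>M j. a \<noteq> a' \<and> b \<noteq> b' \<and> P a b \<and> P a' b'"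
    then show ?thesis using L_ge_6_disjoint[OF s ijl(1-3,6)] by blast
  next
    assume "\<exists>a\<in>M i. \<forall>b\<in>M j. P a b"
    then show ?thesis using L_ge_6_star[OF s ijl(1-3,6)] False assms(8) by auto
  next
    assume "\<exists>b\<in>M j. \<forall>a\<in>M i. P a b"
    then obtain b where "b \<in> M j" "\<forall>a\<in>M i. P b a" by (auto simp: insert_commute)
    then have "6 \<le> L j i l" using L_ge_6_star[of j i l b] s ijl False assms(8) by auto
    then show ?thesis using L_rot by metis
  qed
qed

text \<open>The thresholds come from pigeonhole on the three summands of \<open>G\<close>: 8 forces
  a summand of at least 3, 11 one of at least 5 or two of at least 4, 13 one of at least 5, 16 one
  of at least 7 or the pattern 5, 5, 4, and 19 one of at least 7.\<close>

lemma L_table: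
  assumes ijl: "i \<noteq> j" "j \<noteq> l" "i \<noteq> l" "i \<in> I" "j \<in> I" "l \<in> I"
  defines "G \<equiv> g i j + g j l + g i l"
  shows "1 \<le> G \<Longrightarrow> 4 \<le> L i j l" "8 \<le> G \<Longrightarrow> 6 \<le> L i j l" "11 \<le> G \<Longrightarrow> 7 \<le> L i j l"
    "13 \<le> G \<Longrightarrow> 9 \<le> L i j l" "16 \<le> G \<Longrightarrow> 11 \<le> L i j l" "19 \<le> G \<Longrightarrow> 21 \<le> L i j l"
proof -
  have s: "i < s" "j < s" "l < s" using ijl by (auto simp: I_def)
  have o: "j \<noteq> i" "l \<noteq> j" "l \<noteq> i" using ijl by auto
  have gs: "g j i = g i j" "g l j = g j l" "g l i = g i l" using g_sym by auto
  note rot = L_rot[of i j l]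
  show "4 \<le> L i j l" if "1 \<le> G"
  proof -
    have "1 \<le> g i j \<or> 1 \<le> g j l \<or> 1 \<le> g i l" using that unfolding G_def by linarith
    then show ?thesis using L_ge_4_I[of i j l] L_ge_4_I[of j l i] L_ge_4_I[of i l j] s ijl o rot by auto
  qed
  show "6 \<le> L i j l" if "8 \<le> G"
  proof -
    have "3 \<le> g i j \<or> 3 \<le> g j l \<or> 3 \<le> g i l" using that unfolding G_def by linarith
    then show ?thesis using L_ge_6_aux[of i j l] L_ge_6_aux[of j l i] L_ge_6_aux[of i l j] s ijl o rot gs that
      unfolding G_def by (auto simp: algebra_simps)
  qed
  have 9: "9 \<le> L i j l" if "5 \<le> g i j \<or> 5 \<le> g j l \<or> 5 \<le> g i l"
    using that dead_conseq(1)[of i j l] dead_conseq(1)[of j l i] dead_conseq(1)[of i l j] s ijl o rot by auto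
  have 21: "21 \<le> L i j l" if "7 \<le> g i j \<or> 7 \<le> g j l \<or> 7 \<le> g i l"
    using that dead_conseq(2)[of i j l] dead_conseq(2)[of j l i] dead_conseq(2)[of i l j] s ijl o rot by auto
  show "7 \<le> L i j l" if "11 \<le> G"
  proof (cases "5 \<le> g i j \<or> 5 \<le> g j l \<or> 5 \<le> g i l")
    case True
    then show ?thesis using 9 by linarith
  next
    case False
    then have "4 \<le> g i j \<and> 4 \<le> g i l \<or> 4 \<le> g i j \<and> 4 \<le> g j l \<or> 4 \<le> g j l \<and> 4 \<le> g i l"
      using that unfolding G_def by linarith
    then show ?thesis using L_ge_7_I[of i j l] L_ge_7_I[of j i l] L_ge_7_I[of l j i] s ijl o rot gs by auto
  qed
  show "9 \<le> L i j l" if "13 \<le> G" by (rule 9) (use that in \<open>unfold G_def, linarith\<close>)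
  show "21 \<le> L i j l" if "19 \<le> G" by (rule 21) (use that in \<open>unfold G_def, linarith\<close>)
  show "11 \<le> L i j l" if "16 \<le> G"
  proof (cases "7 \<le> g i j \<or> 7 \<le> g j l \<or> 7 \<le> g i l")
    case True
    then show ?thesis using 21 by linarith
  next
    case False
    then have "5 \<le> g i j \<and> 5 \<le> g i l \<and> 4 \<le> g j l \<or> 5 \<le> g i j \<and> 5 \<le> g j l \<and> 4 \<le> g i l
      \<or> 5 \<le> g j l \<and> 5 \<le> g i l \<and> 4 \<le> g i j"
      using that unfolding G_def by linarith
    then show ?thesis using L_ge_11[of i j l] L_ge_11[of j i l] L_ge_11[of l j i] s ijl o rot gs by auto
  qed
qed


lemma L_ge_2:
  assumes "i < s" "j < s" "l < s"
    and "a \<in> M i" "b \<in> M j" "c \<in> M l" "{a, b, c} \<notin> F"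
    and "a' \<in> M i" "b' \<in> M j" "c' \<in> M l" "{a', b', c'} \<notin> F" and "(a, b, c) \<noteq> (a', b', c')"
  shows "2 \<le> L i j l"
proof -
  let ?f = "\<lambda>(a, b, c). of_bool ({a, b, c} \<notin> F) :: nat"
  have "(\<Sum>t\<in>{(a, b, c), (a', b', c')}. ?f t) \<le> (\<Sum>t\<in>M i \<times> M j \<times> M l. ?f t)"
    by (rule sum_mono2) (use assms M_finite in auto)
  moreover have "(\<Sum>t\<in>{(a, b, c), (a', b', c')}. ?f t) = 2" using assms by simp
  moreover have "L i j l = (\<Sum>t\<in>M i \<times> M j \<times> M l. ?f t)"
    unfolding L_def by (simp add: sum.cartesian_product split_def del: sum_of_bool_eq)
  ultimately show ?thesis by simp
qed

text \<open>For bad triples the non-edges do not pay for the pairs counted by \<open>g\<close>.\<close>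

definition bad :: "nat \<Rightarrow> nat \<Rightarrow> nat \<Rightarrow> bool" where
  "bad i j l \<longleftrightarrow> 1 \<le> g i j \<and> g i j \<le> 3 \<and> L i j l \<le> 1"

lemma bad_sym: "bad i j l \<longleftrightarrow> bad j i l"
  by (simp add: bad_def g_sym[of i j] L_rot(3)[of i j l])

text \<open>Each of the two triples has at most one non-edge. This leaves a \<open>c\<close> for
  which \<open>{u1, v1, c}\<close> is an edge, and it makes \<open>{0, u2, v2}\<close> an edge,
  because a dead pair would cost three. Of the two ways to distribute the other vertices of
  \<open>M l\<close> over \<open>p1, q1\<close> and \<open>p2, q2\<close>, one non-edge spoils only
  one. Five matching edges would thus become six edges.\<close>

lemma bad_disjoint:
  assumes ix: "i < s" "j < s" "i' < s" "j' < s" "l < s" "distinct [i, j, i', j', l]"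
    and "bad i j l" "bad i' j' l"
  shows False
proof -
  have L1: "L i j l \<le> 1" "L i' j' l \<le> 1" using assms by (auto simp: bad_def)
  obtain u v where uv: "u \<in> M i" "v \<in> M j" "P u v" using g_pos assms(7) unfolding bad_def by blast
  obtain p q where pq: "p \<in> M i'" "q \<in> M j'" "P p q" using g_pos assms(8) unfolding bad_def by blast
  obtain u1 u2 where Mi: "M i = {u, u1, u2}" "u \<noteq> u1" "u1 \<noteq> u2" "u \<noteq> u2" using M_obtain1 ix uv by metis
  obtain v1 v2 where Mj: "M j = {v, v1, v2}" "v \<noteq> v1" "v1 \<noteq> v2" "v \<noteq> v2" using M_obtain1 ix uv by metis
  obtain p1 p2 where Mp: "M i' = {p, p1, p2}" "p \<noteq> p1" "p1 \<noteq> p2" "p \<noteq> p2" using M_obtain1 ix pq by metis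
  obtain q1 q2 where Mq: "M j' = {q, q1, q2}" "q \<noteq> q1" "q1 \<noteq> q2" "q \<noteq> q2" using M_obtain1 ix pq by metis
  obtain x0 x1 x2 where Ml0: "M l = {x0, x1, x2}" "x0 \<noteq> x1" "x1 \<noteq> x2" "x0 \<noteq> x2" using M_obtain ix by metis
  have mem: "u1 \<in> M i" "u2 \<in> M i" "v1 \<in> M j" "v2 \<in> M j" "p1 \<in> M i'" "p2 \<in> M i'" "q1 \<in> M j'" "q2 \<in> M j'"
    "x0 \<in> M l" "x1 \<in> M l"
    using Mi(1) Mj(1) Mp(1) Mq(1) Ml0(1) by auto
  have "{u1, v1, x0} \<in> F \<or> {u1, v1, x1} \<in> F"
    using L_ge_2[of i j l u1 v1 x0 u1 v1 x1] L1 mem Ml0 ix by force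
  then obtain c where c: "c \<in> M l" "{u1, v1, c} \<in> F" using mem by blast
  obtain c' c'' where Ml: "M l = {c, c', c''}" "c \<noteq> c'" "c' \<noteq> c''" "c \<noteq> c''" using M_obtain1 ix c by metis
  have cm: "c' \<in> M l" "c'' \<in> M l" using Ml by auto
  have uv2: "{0, u2, v2} \<in> F"
  proof (rule ccontr)
    assume n: "{0, u2, v2} \<notin> F"
    have ne: "u2 \<noteq> 0" "v2 \<noteq> 0" "u2 \<noteq> v2"
      using M_range[of i u2] M_range[of j v2] M_distinct[of i j u2 v2] mem ix by auto
    have "{u2, v2, x} \<notin> F" for x using dead_pair[OF n ne, of x] by (simp add: insert_commute)
    then show False using L_ge_2[of i j l u2 v2 c u2 v2 c'] mem Ml c cm ix L1 by auto
  qed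
  have dis: "{a, b, x} \<in> F \<or> {a', b', x'} \<in> F"
    if "a \<in> M i'" "b \<in> M j'" "x \<in> M l" "a' \<in> M i'" "b' \<in> M j'" "x' \<in> M l" "(a, b, x) \<noteq> (a', b', x')" for a b x a' b' x'
    using L_ge_2[of i' j' l a b x a' b' x'] that ix L1 by force
  have "{p1, q1, c'} \<in> F \<and> {p2, q2, c''} \<in> F \<or> {p1, q1, c''} \<in> F \<and> {p2, q2, c'} \<in> F"
    using dis[of p1 q1 c' p1 q1 c''] dis[of p1 q1 c' p2 q2 c'] dis[of p2 q2 c'' p1 q1 c''] dis[of p2 q2 c'' p2 q2 c']
      mem cm Ml Mp(3) by blast
  moreover have "M l = {c, c'', c'}" using Ml by auto
  ultimately show False
    using disjoint_pairs_conflict[OF ix Mi(1) Mj(1) Mp(1) Mq(1) _ uv(3) pq(3) c(2) _ _ uv2] Ml(1) by blast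
qed

text \<open>The 12 non-edges are all triples of a vertex of \<open>M j\<close> other than
  \<open>v\<close>, a vertex of \<open>M j'\<close> other than \<open>q\<close> and any vertex of
  \<open>M l\<close>: an edge there would extend to an exchange by
  \<open>common_index_conflict\<close>.\<close>

lemma bad_common:
  assumes ix: "i < s" "j < s" "j' < s" "l < s" "distinct [i, j, j', l]"
    and "bad i j l" "bad i j' l"
  shows "12 \<le> L j j' l"
proof -
  have L1: "L i j l \<le> 1" "L i j' l \<le> 1" using assms by (auto simp: bad_def)
  obtain u' v where uv: "u' \<in> M i" "v \<in> M j" "P u' v" using g_pos assms(6) unfolding bad_def by blast
  obtain u q where uq: "u \<in> M i" "q \<in> M j'" "P u q" using g_pos assms(7) unfolding bad_def by blast
  have v: "N1 v" using pair_in_I(2)[of i j u' v] uv ix by auto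
  obtain u1 u2 where Mi: "M i = {u, u1, u2}" "u \<noteq> u1" "u1 \<noteq> u2" "u \<noteq> u2" using M_obtain1 ix uq by metis
  obtain v1 v2 where Mj: "M j = {v, v1, v2}" "v \<noteq> v1" "v1 \<noteq> v2" "v \<noteq> v2" using M_obtain1 ix uv by metis
  obtain q1 q2 where Mq: "M j' = {q, q1, q2}" "q \<noteq> q1" "q1 \<noteq> q2" "q \<noteq> q2" using M_obtain1 ix uq by metis
  obtain c1 c2 c3 where Ml: "M l = {c1, c2, c3}" "c1 \<noteq> c2" "c2 \<noteq> c3" "c1 \<noteq> c3" using M_obtain ix by metis
  have kill: "nd y2 r2 z3 = 1"
    if "M j = {v, y1, y2}" "M j' = {q, r1, r2}" "M l = {z1, z2, z3}" "z1 \<noteq> z2" for y1 y2 r1 r2 z1 z2 z3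
  proof -
    have M': "M i = {u, u2, u1}" "M l = {z2, z1, z3}" using Mi(1) that(3) by auto
    have mem: "u1 \<in> M i" "u2 \<in> M i" "y1 \<in> M j" "r1 \<in> M j'" "z1 \<in> M l" "z2 \<in> M l"
      using Mi(1) that by auto
    have A: "{a, y1, x} \<in> F \<or> {a', y1, x'} \<in> F"
      if "a \<in> M i" "x \<in> M l" "a' \<in> M i" "x' \<in> M l" "(a, x) \<noteq> (a', x')" for a x a' x'
      using L_ge_2[of i j l a y1 x a' y1 x'] that ix L1 mem by force
    have B: "{a, r1, x} \<in> F \<or> {a', r1, x'} \<in> F"
      if "a \<in> M i" "x \<in> M l" "a' \<in> M i" "x' \<in> M l" "(a, x) \<noteq> (a', x')" for a x a' x'
      using L_ge_2[of i j' l a r1 x a' r1 x'] that ix L1 mem by force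
    \<comment> \<open>The three alternatives use different triples on both sides, and each side has
      at most one non-edge, so one alternative survives.\<close>
    have "{u1, y1, z1} \<in> F \<and> {u2, r1, z2} \<in> F \<or> {u2, y1, z1} \<in> F \<and> {u1, r1, z2} \<in> F \<or>
      {u1, y1, z2} \<in> F \<and> {u2, r1, z1} \<in> F"
      using A[of u1 z1 u2 z1] A[of u1 z1 u1 z2] A[of u2 z1 u1 z2]
        B[of u2 z2 u1 z2] B[of u2 z2 u2 z1] B[of u1 z2 u2 z1] mem Mi(3) \<open>z1 \<noteq> z2\<close> by blast
    then have "{y2, r2, z3} \<notin> F"
      using common_index_conflict[OF ix Mi(1) that(1,2,3) v uq(3)]
        common_index_conflict[OF ix M'(1) that(1,2,3) v uq(3)]
        common_index_conflict[OF ix Mi(1) that(1,2) M'(2) v uq(3)] by blast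
    then show ?thesis by (simp add: nd_def)
  qed
  have M': "M j = {v, v2, v1}" "M j' = {q, q2, q1}" "M l = {c2, c3, c1}" "M l = {c3, c1, c2}"
    using Mj Mq Ml by auto
  note k1 = kill[OF Mj(1) Mq(1) Ml(1,2)] kill[OF Mj(1) Mq(1) M'(3) Ml(3)] kill[OF Mj(1) Mq(1) M'(4) Ml(4)[symmetric]]
    and k2 = kill[OF M'(1) Mq(1) Ml(1,2)] kill[OF M'(1) Mq(1) M'(3) Ml(3)] kill[OF M'(1) Mq(1) M'(4) Ml(4)[symmetric]]
    and k3 = kill[OF Mj(1) M'(2) Ml(1,2)] kill[OF Mj(1) M'(2,3) Ml(3)] kill[OF Mj(1) M'(2,4) Ml(4)[symmetric]]
    and k4 = kill[OF M'(1,2) Ml(1,2)] kill[OF M'(1,2,3) Ml(3)] kill[OF M'(1,2,4) Ml(4)[symmetric]]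
  show ?thesis unfolding L_expand[OF Mj Mq Ml] using k1 k2 k3 k4 by linarith
qed

lemma g_zero:
  assumes "i < s" "j < s" "i \<noteq> j" "i \<notin> I \<or> j \<notin> I" shows "g i j = 0"
proof (rule ccontr)
  assume "g i j \<noteq> 0"
  then obtain a b where "a \<in> M i" "b \<in> M j" "P a b" using g_pos[of i j] by (auto simp: Suc_le_eq)
  then show False using pair_in_I[OF assms(1,2,3)] assms unfolding I_def by blast
qed

lemma g_le_9: assumes "i < s" "j < s" shows "g i j \<le> 9"
proof -
  have "g i j \<le> (\<Sum>a\<in>M i. \<Sum>b\<in>M j. 1)" unfolding g_def by (intro sum_mono) auto
  also have "\<dots> = 9" using edge_card[OF M_edge] assms by simp
  finally show ?thesis .
qed

text \<open>The weights are chosen such that the sum over all ordered index triples is \<open>s - 2\<close> times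
  the difference in \<open>weighted_count\<close>; the last term pays for the pairs of \<open>G\<close> that contain \<open>0\<close>
  or lie inside some \<open>M i\<close>.\<close>

definition W :: "real \<Rightarrow> nat \<Rightarrow> nat \<Rightarrow> nat \<Rightarrow> real" where
  "W y i j l = (real s - 2) * L i j l - y * (g i j + g j l + g i l) + (miss i j + miss j l + miss i l)
    - 12 * y / (real s - 1) * (of_bool (i \<in> I) + of_bool (j \<in> I) + of_bool (l \<in> I))"

lemma W_swap12: "W y i j l = W y j i l"
  using g_sym[of i j] miss_sym[of i j] L_swap12[of i j l] by (simp add: W_def)

lemma W_swap23: "W y i j l = W y i l j"
  using g_sym[of j l] miss_sym[of j l] L_swap23[of i j l] by (simp add: W_def)

section \<open>Lower bounds for the weights, by the number of indices in \<open>I\<close>\<close>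

context
  fixes y :: real
  assumes y: "0 \<le> y" "50 * y \<le> 27 * (real s - 2)" "12 * y + 14 \<le> 7 * (real s - 2)" and s: "23 \<le> s"
begin

lemma kappa: "0 \<le> 12 * y / (real s - 1)" "12 * y / (real s - 1) \<le> 648 / 100"
  using y s by (auto simp: field_simps)

text \<open>In each range of \<open>L_table\<close> the non-edges outweigh \<open>y\<close> times
  the upper end of the range. Asymptotically the tightest ratio is 4 non-edges for 7 pairs. The
  range up to 12 pairs with 7 non-edges is the source of the assumption
  \<open>12 * y + 14 \<le> 7 * (real s - 2)\<close>, where 14 covers
  \<open>3 * 6.48 - 27 + 3 * 7\<close>.\<close>

lemma W_III:
  assumes "i \<noteq> j" "j \<noteq> l" "i \<noteq> l" "i \<in> I" "j \<in> I" "l \<in> I"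
  shows "0 \<le> W y i j l"
proof -
  define G where "G = g i j + g j l + g i l"
  define Q where "Q = miss i j + miss j l + miss i l"
  define k where "k = 12 * y / (real s - 1)"
  have k: "0 \<le> k" "k \<le> 648/100" using kappa by (auto simp: k_def)
  have ii: "i < s" "j < s" "l < s" using assms by (auto simp: I_def)
  have W: "W y i j l = (real s - 2) * L i j l - y * G + Q - 3 * k"
    using assms by (simp add: W_def G_def Q_def k_def)
  have "9 \<le> L i j l + miss j l" "9 \<le> L i j l + miss i l" "9 \<le> L i j l + miss i j"
    using miss_lower[of j l i] miss_lower[of i l j] miss_lower[of i j l] ii assms L_rot[of i j l] by auto
  then have "27 \<le> 3 * L i j l + Q" unfolding Q_def by linarith
  then have Q: "27 - 3 * real (L i j l) \<le> Q" by linarith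
  \<comment> \<open>Using the bound for \<open>Q\<close> trades three units of the coefficient of
    \<open>L\<close> for the constant 27. This is profitable below 9 non-edges; from 9 on
    \<open>low'\<close> is used.\<close>
  have low: "W y i j l \<ge> (real s - 5) * m + 27 - y * G - 3 * k" if "m \<le> L i j l" for m :: nat
  proof -
    have "(real s - 5) * m \<le> (real s - 5) * L i j l" using that s by (intro mult_left_mono) auto
    then show ?thesis unfolding W using Q by (simp add: algebra_simps)
  qed
  have low': "W y i j l \<ge> (real s - 2) * m - y * G - 3 * k" if "m \<le> L i j l" for m :: nat
  proof -
    have "(real s - 2) * m \<le> (real s - 2) * L i j l" using that s by (intro mult_left_mono) auto
    then show ?thesis unfolding W by simp
  qed
  have yG: "y * G \<le> y * m" if "G \<le> m" for m :: nat using that y by (intro mult_left_mono) auto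
  note tab = L_table[OF assms, folded G_def]
  have "G \<le> 27" using g_le_9[of i j] g_le_9[of j l] g_le_9[of i l] ii unfolding G_def by linarith
  then consider "G = 0" | "1 \<le> G" "G \<le> 7" | "8 \<le> G" "G \<le> 10" | "11 \<le> G" "G \<le> 12" | "13 \<le> G" "G \<le> 15"
    | "16 \<le> G" "G \<le> 18" | "19 \<le> G" "G \<le> 27" by linarith
  then show ?thesis
  proof cases
    case 1 then show ?thesis using low[of 0] k by simp
  next
    case 2 then show ?thesis using low[of 4] tab(1) yG[of 7] k y s by simp
  next
    case 3 then show ?thesis using low[of 6] tab(2) yG[of 10] k y s by simp
  next
    case 4 then show ?thesis using low[of 7] tab(3) yG[of 12] k y s by simp
  next
    case 5 then show ?thesis using low'[of 9] tab(4) yG[of 15] k y s by simp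
  next
    case 6 then show ?thesis using low'[of 11] tab(5) yG[of 18] k y s by simp
  next
    case 7 then show ?thesis using low'[of 21] tab(6) yG[of 27] k y s by simp
  qed
qed

text \<open>Only \<open>g i j\<close> has to be paid for. Triples that are not bad keep 5 in
  reserve. A bad one loses at most \<open>3 * 0.54 * (s - 2)\<close>. With 12 non-edges against at
  most 9 pairs, \<open>(12 - 9 * 0.54) * (s - 2)\<close> remains, less \<open>2 * 6.48\<close> for
  the two indices in \<open>I\<close>.\<close>

lemma W_IIO:
  assumes "i \<noteq> j" "i \<in> I" "j \<in> I" "l \<notin> I" "l < s"
  shows "\<not> bad i j l \<Longrightarrow> 5 \<le> W y i j l" "bad i j l \<Longrightarrow> 5 - 162/100 * (real s - 2) \<le> W y i j l"
    "12 \<le> L i j l \<Longrightarrow> 714/100 * (real s - 2) - 1296/100 \<le> W y i j l"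
proof -
  define k where "k = 12 * y / (real s - 1)"
  have k: "0 \<le> k" "k \<le> 648/100" using kappa by (auto simp: k_def)
  have ii: "i < s" "j < s" "l < s" "j \<noteq> l" "i \<noteq> l" using assms by (auto simp: I_def)
  define Q where "Q = miss i j + miss j l + miss i l"
  have "g j l = 0" "g i l = 0" using g_zero ii assms by auto
  then have W: "W y i j l = (real s - 2) * L i j l - y * g i j + Q - 2 * k"
    using assms by (simp add: W_def Q_def k_def)
  have "9 \<le> L i j l + miss j l" "9 \<le> L i j l + miss i l"
    using miss_lower[of j l i] miss_lower[of i l j] ii assms L_rot[of i j l] by auto
  then have "18 \<le> 2 * L i j l + Q" unfolding Q_def by linarith
  then have Q: "18 - 2 * real (L i j l) \<le> Q" by linarith
  have low: "W y i j l \<ge> (real s - 4) * m + 18 - y * g i j - 2 * k" if "m \<le> L i j l" for m :: nat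
  proof -
    have "(real s - 4) * m \<le> (real s - 4) * L i j l" using that s by (intro mult_left_mono) auto
    then show ?thesis unfolding W using Q by (simp add: algebra_simps)
  qed
  have low': "W y i j l \<ge> (real s - 2) * m - y * g i j - 2 * k" if "m \<le> L i j l" for m :: nat
  proof -
    have "(real s - 2) * m \<le> (real s - 2) * L i j l" using that s by (intro mult_left_mono) auto
    then show ?thesis unfolding W by simp
  qed
  have yG: "y * g i j \<le> y * m" if "g i j \<le> m" for m :: nat using that y by (intro mult_left_mono) auto
  note d = dead_conseq[OF ii(1-3) assms(1) ii(4,5)]
  show "714/100 * (real s - 2) - 1296/100 \<le> W y i j l" if "12 \<le> L i j l"
  proof -
    have "(real s - 2) * 12 - y * g i j - 2 * k \<le> W y i j l" using low'[of 12] that by simp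
    moreover have "y * g i j \<le> y * 9" using yG[of 9] g_le_9[OF ii(1,2)] by simp
    ultimately show ?thesis using k y by argo
  qed
  show "5 - 162/100 * (real s - 2) \<le> W y i j l" if "bad i j l"
  proof -
    have "18 - y * g i j - 2 * k \<le> W y i j l" using low[of 0] by simp
    moreover have "y * g i j \<le> y * 3" using yG[of 3] that by (simp add: bad_def)
    ultimately show ?thesis using k y by argo
  qed
  show "5 \<le> W y i j l" if nb: "\<not> bad i j l"
  proof -
    consider "g i j = 0" | "g i j \<le> 3" "2 \<le> L i j l" | "g i j = 4" | "5 \<le> g i j" "g i j \<le> 6" | "7 \<le> g i j"
      using nb unfolding bad_def by linarith
    then show ?thesis
    proof cases
      case 1 then show ?thesis using low[of 0] k by simp
    next
      case 2 then show ?thesis using low[of 2] yG[of 3] k y s by simp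
    next
      case 3 then show ?thesis using low[of 3] d(3) k y s by simp
    next
      case 4 then show ?thesis using low'[of 9] d(1) yG[of 6] k y s by simp
    next
      case 5 then show ?thesis using low'[of 21] d(2) yG[of 9] g_le_9[OF ii(1,2)] k y s by simp
    qed
  qed
qed

lemma W_IOO:
  assumes "j \<noteq> l" "i \<in> I" "j \<notin> I" "l \<notin> I" "j < s" "l < s"
  shows "5/2 \<le> W y i j l"
proof -
  define k where "k = 12 * y / (real s - 1)"
  have k: "0 \<le> k" "k \<le> 648/100" using kappa by (auto simp: k_def)
  have ii: "i < s" "i \<noteq> j" "i \<noteq> l" using assms by (auto simp: I_def)
  have "g i j = 0" "g j l = 0" "g i l = 0" using g_zero ii assms by auto
  then have W: "W y i j l = (real s - 2) * L i j l + (miss i j + miss j l + miss i l) - k"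
    using assms by (simp add: W_def k_def)
  have "9 \<le> real (L i j l) + miss j l"
    using miss_lower[of j l i] ii assms by linarith
  moreover have "real (L i j l) \<le> (real s - 2) * L i j l" using mult_right_mono[of 1 "real s - 2" "real (L i j l)"] s by simp
  ultimately show ?thesis unfolding W using k by simp
qed

lemma W_OOO:
  assumes "i \<noteq> j" "j \<noteq> l" "i \<noteq> l" "i \<notin> I" "j \<notin> I" "l \<notin> I" "i < s" "j < s" "l < s"
  shows "0 \<le> W y i j l"
proof -
  have "g i j = 0" "g j l = 0" "g i l = 0" using g_zero assms by auto
  then show ?thesis using assms s by (simp add: W_def)
qed

end
end

section \<open>Averaging over triples of matching edges\<close>

definition tsum :: "'a set \<Rightarrow> 'a set \<Rightarrow> 'a set \<Rightarrow> ('a \<Rightarrow> 'a \<Rightarrow> 'a \<Rightarrow> real) \<Rightarrow> real" where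
  "tsum X Y Z f = (\<Sum>i\<in>X. \<Sum>j\<in>Y. \<Sum>l\<in>Z. if i \<noteq> j \<and> j \<noteq> l \<and> i \<noteq> l then f i j l else 0)"

lemma tsum_swap12: "tsum X Y Z f = tsum Y X Z (\<lambda>i j l. f j i l)"
  unfolding tsum_def by (subst sum.swap) (auto intro!: sum.cong)

lemma tsum_swap23: "tsum X Y Z f = tsum X Z Y (\<lambda>i j l. f i l j)"
  unfolding tsum_def by (rule sum.cong[OF refl], subst sum.swap) (auto intro!: sum.cong)

lemma tsum_Un1:
  assumes "finite A" "finite B" "A \<inter> B = {}" shows "tsum (A \<union> B) Y Z f = tsum A Y Z f + tsum B Y Z f"
  unfolding tsum_def by (rule sum.union_disjoint[OF assms])

text \<open>By symmetry the odd index may stand in any of three positions, which gives the factors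
  3.\<close>

lemma tsum_symmetric_split:
  assumes AB: "finite A" "finite B" "A \<inter> B = {}"
    and f: "\<And>i j l. f i j l = f j i l" "\<And>i j l. f i j l = f i l j"
  shows "tsum (A \<union> B) (A \<union> B) (A \<union> B) f
    = tsum A A A f + 3 * tsum A A B f + 3 * tsum A B B f + tsum B B B f"
proof -
  have s12: "tsum X Y Z f = tsum Y X Z f" for X Y Z
  proof -
    have "(\<lambda>i j l. f j i l) = f" by (intro ext) (rule f(1))
    then show ?thesis using tsum_swap12[of X Y Z f] by simp
  qed
  have s23: "tsum X Y Z f = tsum X Z Y f" for X Y Z
  proof -
    have "(\<lambda>i j l. f i l j) = f" by (intro ext) (rule f(2))
    then show ?thesis using tsum_swap23[of X Y Z f] by simp
  qed
  have U2: "tsum X (A \<union> B) Z f = tsum X A Z f + tsum X B Z f" for X Z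
    using tsum_Un1[OF AB] s12 by metis
  have U3: "tsum X Y (A \<union> B) f = tsum X Y A f + tsum X Y B f" for X Y
    using U2 s23 by metis
  show ?thesis unfolding tsum_Un1[OF AB] U2 U3
    using s12[of B A A] s23[of A B A] s12[of B A B] s23[of B B A] by simp
qed

lemma tsum_add: "tsum X Y Z (\<lambda>i j l. f i j l + h i j l) = tsum X Y Z f + tsum X Y Z h"
  unfolding tsum_def sum.distrib[symmetric] by (intro sum.cong refl) simp

lemma tsum_scale: "tsum X Y Z (\<lambda>i j l. c * f i j l) = c * tsum X Y Z f"
  unfolding tsum_def sum_distrib_left by (intro sum.cong refl) simp

lemma sum_if_ne2:
  fixes c :: real
  assumes "finite J"
  shows "(\<Sum>l\<in>J. if l \<noteq> i \<and> l \<noteq> j then c else 0) = real (card (J - {i, j})) * c"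
proof -
  have "J \<inter> {l. l \<noteq> i \<and> l \<noteq> j} = J - {i, j}" by auto
  then show ?thesis using assms by (simp add: sum.If_cases)
qed

lemma tsum_pair:
  assumes J: "finite J" "card J \<ge> 2"
  shows "tsum J J J (\<lambda>i j l. f i j) = (real (card J) - 2) * (\<Sum>i\<in>J. \<Sum>j\<in>J. if i \<noteq> j then f i j else 0)"
proof -
  have "(\<Sum>l\<in>J. if i \<noteq> j \<and> j \<noteq> l \<and> i \<noteq> l then f i j else 0) = (real (card J) - 2) * (if i \<noteq> j then f i j else 0)"
    if "i \<in> J" "j \<in> J" for i j
  proof (cases "i = j")
    case False
    have "card (J - {i, j}) = card J - 2" using J False that by (simp add: card_Diff_subset)
    moreover have "(\<Sum>l\<in>J. if i \<noteq> j \<and> j \<noteq> l \<and> i \<noteq> l then f i j else 0)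
        = (\<Sum>l\<in>J. if l \<noteq> i \<and> l \<noteq> j then f i j else 0)" using False by (intro sum.cong) auto
    ultimately show ?thesis using False J(2) unfolding sum_if_ne2[OF J(1)]
      by (simp add: of_nat_diff)
  qed simp
  then show ?thesis unfolding tsum_def by (simp add: sum_distrib_left)
qed

lemma sum_pairs_single:
  assumes J: "finite J" "card J \<ge> 1"
  shows "(\<Sum>i\<in>J. \<Sum>j\<in>J. if i \<noteq> j then f i else (0::real)) = (real (card J) - 1) * (\<Sum>i\<in>J. f i)"
proof -
  have "(\<Sum>j\<in>J. if i \<noteq> j then f i else 0) = (real (card J) - 1) * f i" if "i \<in> J" for i
  proof -
    have "J \<inter> {j. i \<noteq> j} = J - {i}" by auto
    moreover have "card (J - {i}) = card J - 1" using that J by simp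
    ultimately show ?thesis using J by (simp add: sum.If_cases of_nat_diff)
  qed
  then show ?thesis by (simp add: sum_distrib_left)
qed

context matched_family begin

context
  fixes y :: real
  assumes y: "0 \<le> y" "50 * y \<le> 27 * (real s - 2)" "12 * y + 14 \<le> 7 * (real s - 2)" and s: "23 \<le> s"
begin

lemma finite_I: "finite I"
  by (rule finite_subset[of _ "{..<s}"]) (auto simp: I_def)

text \<open>Bad pairs for a fixed \<open>l\<close> meet pairwise. Given one bad pair \<open>{i0, j0}\<close>, the transposition of
  \<open>i0\<close> and \<open>j0\<close> maps every other bad pair to one with at least 12 non-edges, which compensates it.\<close>

lemma sum_IIO:
  assumes l: "l < s" "l \<notin> I"
  shows "5 * real (card I) * (real (card I) - 1) - 324/100 * (real s - 2)
    \<le> (\<Sum>p | p \<in> I \<times> I \<and> fst p \<noteq> snd p. W y (fst p) (snd p) l)"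
proof -
  define S where "S = {p. p \<in> I \<times> I \<and> fst p \<noteq> snd p}"
  define w where "w p = W y (fst p) (snd p) l" for p
  have fS: "finite S" unfolding S_def by (rule finite_subset[of _ "I \<times> I"]) (use finite_I in auto)
  have S: "S = I \<times> I - (\<lambda>i. (i, i)) ` I" by (auto simp: S_def)
  have "card S = card I * card I - card I" unfolding S
    using finite_I by (subst card_Diff_subset) (auto simp: card_cartesian_product card_image inj_on_def)
  moreover have "card I \<le> card I * card I" by simp
  ultimately have cS: "real (card S) = real (card I) * (real (card I) - 1)"
    by (simp add: of_nat_diff algebra_simps)
  note WB = W_IIO[OF y s]
  have nb: "5 \<le> w p" if "p \<in> S" "\<not> bad (fst p) (snd p) l" for p
    using WB(1) that l by (auto simp: S_def w_def)
  have b: "5 - 162/100 * (real s - 2) \<le> w p" if "p \<in> S" for p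
  proof (cases "bad (fst p) (snd p) l")
    case True then show ?thesis using WB(2) that l by (auto simp: S_def w_def)
  next
    case False
    have "0 \<le> 162/100 * (real s - 2)" using s by simp
    then show ?thesis using nb[OF that False] by linarith
  qed
  have good: "714/100 * (real s - 2) - 1296/100 \<le> w p" if "p \<in> S" "12 \<le> L (fst p) (snd p) l" for p
    using WB(3) that l by (auto simp: S_def w_def)
  have "5 * real (card S) - 324/100 * (real s - 2) \<le> (\<Sum>p\<in>S. w p)"
  proof (cases "\<exists>p\<in>S. bad (fst p) (snd p) l")
    case False
    then have "real (card S) * 5 \<le> (\<Sum>p\<in>S. w p)" using nb by (intro sum_bounded_below) auto
    moreover have "0 \<le> 324/100 * (real s - 2)" using s by simp
    ultimately show ?thesis by linarith
  next
    case True
    then obtain i0 j0 where 0: "i0 \<in> I" "j0 \<in> I" "i0 \<noteq> j0" "bad i0 j0 l" by (auto simp: S_def)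
    define t where "t x = (if x = i0 then j0 else if x = j0 then i0 else x)" for x
    have tt: "t (t x) = x" for x by (auto simp: t_def)
    have tI: "t x \<in> I \<longleftrightarrow> x \<in> I" for x using 0 by (auto simp: t_def)
    define \<tau> where "\<tau> = map_prod t t"
    have \<tau>\<tau>: "\<tau> (\<tau> p) = p" for p by (cases p) (simp add: \<tau>_def tt)
    have \<tau>S: "\<tau> p \<in> S" if "p \<in> S" for p
      using that tI tt by (cases p) (auto simp: \<tau>_def S_def, metis)
    have bij: "bij_betw \<tau> S S"
      by (rule bij_betw_byWitness[where f' = \<tau>]) (use \<tau>\<tau> \<tau>S in auto)
    define E where "E = {(i0, j0), (j0, i0)}"
    have ES: "E \<subseteq> S" "card E = 2" using 0 by (auto simp: E_def S_def)
    have \<tau>E: "\<tau> p \<in> E \<longleftrightarrow> p \<in> E" for p using \<open>i0 \<noteq> j0\<close> by (cases p) (auto simp: E_def \<tau>_def t_def)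
    have lt: "x < s \<and> x \<noteq> l" if "x \<in> I" for x using that l by (auto simp: I_def)
    have L12: "12 \<le> L (fst (\<tau> p)) (snd (\<tau> p)) l" if p: "p \<in> S" "p \<notin> E" "bad (fst p) (snd p) l" for p
    proof -
      obtain i j where ij: "p = (i, j)" by (cases p)
      have h: "i \<in> I" "j \<in> I" "i \<noteq> j" "bad i j l" using p ij by (auto simp: S_def)
      note lts = lt[OF h(1)] lt[OF h(2)] lt[OF 0(1)] lt[OF 0(2)]
      have "\<not> distinct [i, j, i0, j0, l]"
        using bad_disjoint[of i j i0 j0 l] h(4) 0(4) lts l(1) by blast
      then consider "i = i0" "j \<noteq> j0" | "i = j0" "j \<noteq> i0" | "j = i0" "i \<noteq> j0" | "j = j0" "i \<noteq> i0"
        using p(2) h(3) \<open>i0 \<noteq> j0\<close> lts unfolding ij E_def by auto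
      then show ?thesis
      proof cases
        case 1
        then have "12 \<le> L j0 j l" using bad_common[of i0 j0 j l] h 0 lts l by auto
        then show ?thesis using 1 h(3) by (simp add: ij \<tau>_def t_def)
      next
        case 2
        then have "12 \<le> L i0 j l" using bad_common[of j0 i0 j l] h 0 lts l bad_sym[of i0 j0 l] by auto
        then show ?thesis using 2 h(3) \<open>i0 \<noteq> j0\<close> by (simp add: ij \<tau>_def t_def)
      next
        case 3
        then have "12 \<le> L i j0 l" using bad_common[of i0 i j0 l] h 0 lts l bad_sym[of i i0 l] by auto
        then show ?thesis using 3 h(3) \<open>i0 \<noteq> j0\<close> by (simp add: ij \<tau>_def t_def)
      next
        case 4
        then have "12 \<le> L i i0 l"
          using bad_common[of j0 i i0 l] h 0 lts l bad_sym[of i j0 l] bad_sym[of i0 j0 l] by auto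
        then show ?thesis using 4 h(3) \<open>i0 \<noteq> j0\<close> by (simp add: ij \<tau>_def t_def)
      qed
    qed
    have s21: "21 \<le> real s - 2" using s by simp
    have pair: "10 \<le> w p + w (\<tau> p)" if p: "p \<in> S" "p \<notin> E" for p
    proof (cases "bad (fst p) (snd p) l")
      case True
      then show ?thesis using b[OF p(1)] good[OF \<tau>S[OF p(1)] L12[OF p True]] s21 by argo
    next
      case F: False
      show ?thesis
      proof (cases "bad (fst (\<tau> p)) (snd (\<tau> p)) l")
        case True
        then have "12 \<le> L (fst p) (snd p) l" using L12[of "\<tau> p"] \<tau>\<tau> \<tau>S \<tau>E p by metis
        then show ?thesis using b[OF \<tau>S[OF p(1)]] good[OF p(1)] s21 by argo
      next
        case False
        then show ?thesis using nb[OF p(1) F] nb[OF \<tau>S[OF p(1)]] by simp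
      qed
    qed
    have pE: "10 - 324/100 * (real s - 2) \<le> w p + w (\<tau> p)" if "p \<in> S" for p
      using b[OF that] b[OF \<tau>S[OF that]] by argo
    \<comment> \<open>Adding the weights of \<open>p\<close> and its image counts everything twice.
      The two elements of \<open>E\<close> lose \<open>c\<close> each in the doubled sum, hence
      \<open>c\<close> in total.\<close>
    define c where "c = 324/100 * (real s - 2)"
    have "(\<Sum>p\<in>S. 10 - (if p \<in> E then c else 0)) \<le> (\<Sum>p\<in>S. w p + w (\<tau> p))"
      using pair pE unfolding c_def by (intro sum_mono) auto
    moreover have "(\<Sum>p\<in>S. w (\<tau> p)) = (\<Sum>p\<in>S. w p)"
      using sum.reindex_bij_betw[OF bij] .
    moreover have "(\<Sum>p\<in>S. (if p \<in> E then c else 0)) = 2 * c"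
      using ES fS by (simp add: sum.If_cases Int_absorb1)
    ultimately show ?thesis unfolding c_def[symmetric] by (simp add: sum.distrib sum_subtractf)
  qed
  then show ?thesis using cS by (simp add: S_def w_def)
qed

lemma tsum_W_nonneg: "0 \<le> tsum {..<s} {..<s} {..<s} (W y)"
proof -
  define O' where "O' = {..<s} - I"
  define q where "q = card I"
  have IO: "{..<s} = I \<union> O'" "finite O'" "I \<inter> O' = {}" by (auto simp: O'_def I_def)
  have cI: "card I \<le> s" using card_mono[of "{..<s}" I] by (auto simp: I_def)
  have cO: "real (card O') = real s - q"
    using cI card_Un_disjoint[OF finite_I IO(2,3)] IO(1) by (simp add: q_def) (metis card_lessThan of_nat_add add_diff_cancel_left')
  have lt: "x < s" if "x \<in> I \<or> x \<in> O'" for x using that by (auto simp: I_def O'_def)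
  have nI: "x \<notin> I" if "x \<in> O'" for x using that by (auto simp: O'_def)
  have 1: "0 \<le> tsum I I I (W y)" unfolding tsum_def
    using W_III[OF y s] by (intro sum_nonneg) auto
  have 4: "0 \<le> tsum O' O' O' (W y)" unfolding tsum_def
    using W_OOO[OF y s] lt nI by (intro sum_nonneg) auto
  have 2: "real (card O') * (5 * real q * (real q - 1) - 324/100 * (real s - 2)) \<le> tsum I I O' (W y)"
  proof -
    have "tsum I I O' (W y) = (\<Sum>l\<in>O'. \<Sum>i\<in>I. \<Sum>j\<in>I. if i \<noteq> j then W y i j l else 0)"
    proof -
      have "tsum I I O' (W y) = (\<Sum>i\<in>I. \<Sum>j\<in>I. \<Sum>l\<in>O'. if i \<noteq> j then W y i j l else 0)"
        unfolding tsum_def using IO(3) by (intro sum.cong refl) auto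
      also have "\<dots> = (\<Sum>i\<in>I. \<Sum>l\<in>O'. \<Sum>j\<in>I. if i \<noteq> j then W y i j l else 0)"
        by (rule sum.cong[OF refl], rule sum.swap)
      also have "\<dots> = (\<Sum>l\<in>O'. \<Sum>i\<in>I. \<Sum>j\<in>I. if i \<noteq> j then W y i j l else 0)"
        by (rule sum.swap)
      finally show ?thesis .
    qed
    moreover have "5 * real q * (real q - 1) - 324/100 * (real s - 2) \<le> (\<Sum>i\<in>I. \<Sum>j\<in>I. if i \<noteq> j then W y i j l else 0)"
      if "l \<in> O'" for l
    proof -
      have "{p. p \<in> I \<times> I \<and> fst p \<noteq> snd p} = I \<times> I \<inter> {p. fst p \<noteq> snd p}" by auto
      then have "(\<Sum>p | p \<in> I \<times> I \<and> fst p \<noteq> snd p. W y (fst p) (snd p) l)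
        = (\<Sum>p\<in>I \<times> I. if fst p \<noteq> snd p then W y (fst p) (snd p) l else 0)"
        using finite_I by (simp add: sum.inter_restrict)
      also have "\<dots> = (\<Sum>i\<in>I. \<Sum>j\<in>I. if i \<noteq> j then W y i j l else 0)"
        by (simp add: sum.cartesian_product split_def)
      finally show ?thesis using sum_IIO[of l] that lt nI unfolding q_def by simp
    qed
    ultimately show ?thesis using sum_bounded_below[of O' _ "\<lambda>l. \<Sum>i\<in>I. \<Sum>j\<in>I. if i \<noteq> j then W y i j l else 0"]
      by simp
  qed
  have 3: "5/2 * real q * (real (card O') * (real (card O') - 1)) \<le> tsum I O' O' (W y)"
  proof (cases "O' = {}")
    case True
    then show ?thesis by (simp add: tsum_def)
  next
    case False
    have "tsum I O' O' (W y) \<ge> (\<Sum>i\<in>I. \<Sum>j\<in>O'. \<Sum>l\<in>O'. if j \<noteq> l then 5/2 else 0)"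
      unfolding tsum_def using W_IOO[OF y s] lt nI by (intro sum_mono) auto
    moreover have "(\<Sum>j\<in>O'. \<Sum>l\<in>O'. if j \<noteq> l then 5/2 else 0) = (real (card O') - 1) * (\<Sum>j\<in>O'. 5/2)"
      using False IO(2) by (intro sum_pairs_single) (auto simp: Suc_le_eq card_gt_0_iff)
    ultimately show ?thesis by (simp add: q_def algebra_simps)
  qed
  \<comment> \<open>For each \<open>l\<close> outside \<open>I\<close> the bad pairs may cost
    \<open>3.24 * (s - 2)\<close>. As \<open>s - 2 = (q - 1) + (c - 1)\<close> with \<open>c\<close>
    the size of \<open>O'\<close>, for \<open>q \<ge> 2\<close> the reserve
    \<open>5 * q * (q - 1)\<close> pays the first part and the weights \<open>5/2\<close> of the
    triples with one index in \<open>I\<close> pay the second. For \<open>q \<le> 1\<close> there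
    are no pairs in \<open>I\<close>.\<close>
  have "0 \<le> tsum I I O' (W y) + tsum I O' O' (W y)"
  proof (cases "q \<le> 1")
    case True
    have "tsum I I O' (W y) = 0"
    proof -
      have "i = j" if "i \<in> I" "j \<in> I" for i j
        using True that finite_I unfolding q_def by (metis card_le_Suc0_iff_eq One_nat_def)
      then show ?thesis unfolding tsum_def by (intro sum.neutral ballI) auto
    qed
    moreover have "0 \<le> tsum I O' O' (W y)" unfolding tsum_def
      using W_IOO[OF y s] lt nI by (intro sum_nonneg) (auto intro: order_trans[of 0 "5/2"])
    ultimately show ?thesis by simp
  next
    case False
    then have q2: "2 \<le> real q" by simp
    define c where "c = real (card O')"
    show ?thesis
    proof (cases "c = 0")
      case True
      then have "O' = {}" using IO(2) by (simp add: c_def)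
      then show ?thesis by (simp add: tsum_def)
    next
      case False
      then have c1: "1 \<le> c" by (simp add: c_def)
      have sc: "real s = c + q" using cO by (simp add: c_def)
      have "2 * (real q - 1) \<le> real q * (real q - 1)" "2 * (c - 1) \<le> real q * (c - 1)"
        by (rule mult_right_mono; use q2 c1 in simp)+
      then have "0 \<le> 5 * (real q * (real q - 1)) - 324/100 * (real s - 2) + 5/2 * (real q * (c - 1))"
        using q2 c1 sc by argo
      then have "0 \<le> c * (5 * (real q * (real q - 1)) - 324/100 * (real s - 2) + 5/2 * (real q * (c - 1)))"
        using c1 by simp
      then show ?thesis using 2 3 unfolding c_def by (simp add: algebra_simps)
    qed
  qed
  then show ?thesis
    using tsum_symmetric_split[OF finite_I IO(2,3), of "W y"] W_swap12 W_swap23 1 4 unfolding IO(1)[symmetric]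
    by simp
qed

lemma weighted_count:
  "3 * y * ((\<Sum>i<s. \<Sum>j<s. if i \<noteq> j then real (g i j) else 0) + 12 * real (card I))
    \<le> tsum {..<s} {..<s} {..<s} (\<lambda>i j l. real (L i j l))
      + 3 * (\<Sum>i<s. \<Sum>j<s. if i \<noteq> j then real (miss i j) else 0)"
proof -
  let ?J = "{..<s}"
  let ?T = "tsum ?J ?J ?J"
  define k where "k = 12 * y / (real s - 1)"
  define G where "G = (\<Sum>i<s. \<Sum>j<s. if i \<noteq> j then real (g i j) else 0)"
  define Q where "Q = (\<Sum>i<s. \<Sum>j<s. if i \<noteq> j then real (miss i j) else 0)"
  have perm: "?T (\<lambda>i j l. f j l) = ?T (\<lambda>i j l. f i j)" "?T (\<lambda>i j l. f i l) = ?T (\<lambda>i j l. f i j)" for f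
  proof -
    show 2: "?T (\<lambda>i j l. f i l) = ?T (\<lambda>i j l. f i j)" by (subst tsum_swap23) simp
    show "?T (\<lambda>i j l. f j l) = ?T (\<lambda>i j l. f i j)" by (subst tsum_swap12) (simp add: 2)
  qed
  have pr: "?T (\<lambda>i j l. f i j) = (real s - 2) * (\<Sum>i<s. \<Sum>j<s. if i \<noteq> j then f i j else 0)" for f
    using tsum_pair[of ?J f] s by simp
  have sg: "?T (\<lambda>i j l. f i) = (real s - 2) * ((real s - 1) * (\<Sum>i<s. f i))" for f :: "nat \<Rightarrow> real"
    using pr[of "\<lambda>i j. f i"] sum_pairs_single[of ?J f] s by simp
  have sg': "?T (\<lambda>i j l. f j) = ?T (\<lambda>i j l. f i)" "?T (\<lambda>i j l. f l) = ?T (\<lambda>i j l. f i)" for f :: "nat \<Rightarrow> real"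
    using perm(1)[of "\<lambda>i j. f i"] perm(2)[of "\<lambda>i j. f j"] tsum_swap12[of ?J ?J ?J "\<lambda>i j l. f j"] by auto
  have cI: "(\<Sum>i<s. of_bool (i \<in> I)) = real (card I)"
  proof -
    have "{..<s} \<inter> I = I" by (auto simp: I_def)
    then show ?thesis by simp
  qed
  have W: "W y = (\<lambda>i j l. (real s - 2) * real (L i j l) + (- y) * (real (g i j) + (real (g j l) + real (g i l)))
     + (real (miss i j) + (real (miss j l) + real (miss i l)))
     + (- k) * (of_bool (i \<in> I) + (of_bool (j \<in> I) + of_bool (l \<in> I))))"
    by (intro ext) (simp add: W_def k_def algebra_simps)
  have g1: "?T (\<lambda>i j l. real (g i j)) = (real s - 2) * G" "?T (\<lambda>i j l. real (g j l)) = (real s - 2) * G"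
    "?T (\<lambda>i j l. real (g i l)) = (real s - 2) * G"
    using pr[of "\<lambda>i j. real (g i j)"] perm[of "\<lambda>i j. real (g i j)"] by (simp_all add: G_def)
  have m1: "?T (\<lambda>i j l. real (miss i j)) = (real s - 2) * Q" "?T (\<lambda>i j l. real (miss j l)) = (real s - 2) * Q"
    "?T (\<lambda>i j l. real (miss i l)) = (real s - 2) * Q"
    using pr[of "\<lambda>i j. real (miss i j)"] perm[of "\<lambda>i j. real (miss i j)"] by (simp_all add: Q_def)
  have i1: "?T (\<lambda>i j l. of_bool (i \<in> I)) = (real s - 2) * ((real s - 1) * real (card I))"
    "?T (\<lambda>i j l. of_bool (j \<in> I)) = (real s - 2) * ((real s - 1) * real (card I))"
    "?T (\<lambda>i j l. of_bool (l \<in> I)) = (real s - 2) * ((real s - 1) * real (card I))"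
    using sg'[of "\<lambda>i. of_bool (i \<in> I)"] sg[of "\<lambda>i. of_bool (i \<in> I)", unfolded cI] by simp_all
  have "?T (W y) = (real s - 2) * ?T (\<lambda>i j l. real (L i j l)) - y * (3 * ((real s - 2) * G))
     + 3 * ((real s - 2) * Q) - k * (3 * ((real s - 2) * ((real s - 1) * real (card I))))"
    unfolding W tsum_add tsum_scale g1 m1 i1 by (simp add: algebra_simps)
  moreover have "k * (3 * ((real s - 2) * ((real s - 1) * real (card I)))) = (real s - 2) * (36 * y * real (card I))"
    unfolding k_def using s by (simp add: field_simps)
  ultimately have "?T (W y) = (real s - 2) * (?T (\<lambda>i j l. real (L i j l)) + 3 * Q - 3 * y * (G + 12 * real (card I)))"
    by (simp add: algebra_simps)
  then have "0 \<le> (real s - 2) * (?T (\<lambda>i j l. real (L i j l)) + 3 * Q - 3 * y * (G + 12 * real (card I)))"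
    using tsum_W_nonneg by simp
  moreover have "0 < real s - 2" using s by simp
  ultimately have "0 \<le> ?T (\<lambda>i j l. real (L i j l)) + 3 * Q - 3 * y * (G + 12 * real (card I))"
    using zero_le_mult_iff by (metis less_le_not_le)
  then show ?thesis unfolding G_def Q_def by simp
qed

end
end

section \<open>From local to global counts\<close>

lemma card_ordered_triples_le:
  fixes Z :: "('a \<times> 'a \<times> 'a) set"
  assumes fX: "finite X" and c3: "\<And>e. e \<in> X \<Longrightarrow> card e = 3"
    and Z: "\<And>a b c. (a, b, c) \<in> Z \<Longrightarrow> {a, b, c} \<in> X"
  shows "card Z \<le> 6 * card X"
proof -
  define fib where "fib e = (SIGMA a:e. SIGMA b:e - {a}. e - {a, b})" for e :: "'a set"
  have fin: "finite e" if "e \<in> X" for e using c3[OF that] by (metis card.infinite zero_neq_numeral)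
  have fc: "card (fib e) = 6" if "e \<in> X" for e
  proof -
    note f = fin[OF that] and c = c3[OF that]
    have "card (SIGMA b:e - {a}. e - {a, b}) = 2" if "a \<in> e" for a
    proof -
      have "card (e - {a, b}) = 1" if "b \<in> e - {a}" for b
        using that \<open>a \<in> e\<close> f c by (auto simp: card_Diff_subset card_insert_if)
      then have "card (SIGMA b:e - {a}. e - {a, b}) = (\<Sum>b\<in>e - {a}. 1)"
        using f by (subst card_SigmaI) auto
      then show ?thesis using that f c by simp
    qed
    then have "card (fib e) = (\<Sum>a\<in>e. 2)" unfolding fib_def using f by (subst card_SigmaI) auto
    then show ?thesis using c by simp
  qed
  have "Z \<subseteq> (\<Union>e\<in>X. fib e)"
  proof
    fix t assume t: "t \<in> Z"
    obtain a b c where abc: "t = (a, b, c)" by (cases t)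
    have X: "{a, b, c} \<in> X" using Z t abc by blast
    have "card {a, b, c} = 3" using c3[OF X] .
    then have "a \<noteq> b" "b \<noteq> c" "a \<noteq> c" by (auto simp: card_insert_if split: if_splits)
    then have "t \<in> fib {a, b, c}" by (auto simp: fib_def abc)
    then show "t \<in> (\<Union>e\<in>X. fib e)" using X by blast
  qed
  then have "card Z \<le> card (\<Union>e\<in>X. fib e)"
    using fX fin unfolding fib_def by (intro card_mono) auto
  also have "\<dots> \<le> (\<Sum>e\<in>X. card (fib e))" by (rule card_UN_le[OF fX])
  also have "\<dots> = 6 * card X" using fc by simp
  finally show ?thesis .
qed

lemma card_ordered_pairs_le:
  fixes Z :: "('a \<times> 'a) set"
  assumes fX: "finite X" and c3: "\<And>e. e \<in> X \<Longrightarrow> card e = 3"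
    and Z: "\<And>a b. (a, b) \<in> Z \<Longrightarrow> {a, b, w} \<in> X"
  shows "card Z \<le> 2 * card X"
proof -
  define fib where "fib e = (SIGMA a:e - {w}. e - {w, a})" for e :: "'a set"
  have fin: "finite e" if "e \<in> X" for e using c3[OF that] by (metis card.infinite zero_neq_numeral)
  have fc: "card (fib e) = 2" "finite (fib e)" if "e \<in> X" "w \<in> e" for e
  proof -
    note f = fin[OF that(1)] and c = c3[OF that(1)]
    show "finite (fib e)" using f by (simp add: fib_def)
    have "card (e - {w, a}) = 1" if "a \<in> e - {w}" for a
      using that \<open>w \<in> e\<close> f c by (auto simp: card_Diff_subset card_insert_if)
    then have "card (fib e) = (\<Sum>b\<in>e - {w}. 1)" unfolding fib_def
      using f by (subst card_SigmaI) auto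
    then show "card (fib e) = 2" using that f c by simp
  qed
  define X' where "X' = {e \<in> X. w \<in> e}"
  have "Z \<subseteq> (\<Union>e\<in>X'. fib e)"
  proof
    fix t assume t: "t \<in> Z"
    obtain a b where ab: "t = (a, b)" by (cases t)
    have X: "{a, b, w} \<in> X" using Z t ab by blast
    have "card {a, b, w} = 3" using c3[OF X] .
    then have "a \<noteq> b" "b \<noteq> w" "a \<noteq> w" by (auto simp: card_insert_if split: if_splits)
    then have "t \<in> fib {a, b, w}" by (auto simp: fib_def ab)
    then show "t \<in> (\<Union>e\<in>X'. fib e)" using X by (auto simp: X'_def)
  qed
  then have "card Z \<le> card (\<Union>e\<in>X'. fib e)"
    using fX fc by (intro card_mono) (auto simp: X'_def)
  also have "\<dots> \<le> (\<Sum>e\<in>X'. card (fib e))" by (rule card_UN_le) (use fX in \<open>simp add: X'_def\<close>)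
  also have "\<dots> = 2 * card X'" using fc by (simp add: X'_def)
  also have "\<dots> \<le> 2 * card X" using fX by (auto simp: X'_def intro!: card_mono)
  finally show ?thesis .
qed

context matched_family begin

definition own :: "nat \<Rightarrow> nat" where "own a = (THE i. i < s \<and> a \<in> M i)"

lemma own_eq: assumes "i < s" "a \<in> M i" shows "own a = i"
  unfolding own_def using M_distinct[of _ i a a] assms by (intro the_equality) auto

lemma sum_U: "(\<Sum>a\<in>{1..3 * s}. f a) = (\<Sum>i<s. \<Sum>a\<in>M i. f a :: real)"
  unfolding M_Union[symmetric] by (rule sum.UNION_disjoint) (use M_finite M_disjoint in auto)

lemma pair_sum:
  "(\<Sum>i<s. \<Sum>j<s. if i \<noteq> j then (\<Sum>a\<in>M i. \<Sum>b\<in>M j. h a b) else 0)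
    = (\<Sum>a\<in>{1..3 * s}. \<Sum>b\<in>{1..3 * s}. if own a \<noteq> own b then h a b else (0::real))"
proof -
  have "(\<Sum>a\<in>{1..3 * s}. \<Sum>b\<in>{1..3 * s}. if own a \<noteq> own b then h a b else 0)
    = (\<Sum>i<s. \<Sum>a\<in>M i. \<Sum>j<s. \<Sum>b\<in>M j. if i \<noteq> j then h a b else 0)"
    unfolding sum_U by (intro sum.cong refl) (auto simp: own_eq)
  also have "\<dots> = (\<Sum>i<s. \<Sum>j<s. \<Sum>a\<in>M i. \<Sum>b\<in>M j. if i \<noteq> j then h a b else 0)"
    by (rule sum.cong[OF refl], rule sum.swap)
  also have "\<dots> = (\<Sum>i<s. \<Sum>j<s. if i \<noteq> j then (\<Sum>a\<in>M i. \<Sum>b\<in>M j. h a b) else 0)"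
    by (intro sum.cong refl) auto
  finally show ?thesis by simp
qed

lemma triple_sum:
  "tsum {..<s} {..<s} {..<s} (\<lambda>i j l. \<Sum>a\<in>M i. \<Sum>b\<in>M j. \<Sum>c\<in>M l. h a b c)
    = (\<Sum>a\<in>{1..3 * s}. \<Sum>b\<in>{1..3 * s}. \<Sum>c\<in>{1..3 * s}.
        if own a \<noteq> own b \<and> own b \<noteq> own c \<and> own a \<noteq> own c then h a b c else (0::real))"
proof -
  let ?d = "\<lambda>i j l :: nat. i \<noteq> j \<and> j \<noteq> l \<and> i \<noteq> l"
  have "(\<Sum>a\<in>{1..3 * s}. \<Sum>b\<in>{1..3 * s}. \<Sum>c\<in>{1..3 * s}.
        if own a \<noteq> own b \<and> own b \<noteq> own c \<and> own a \<noteq> own c then h a b c else 0)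
    = (\<Sum>i<s. \<Sum>a\<in>M i. \<Sum>j<s. \<Sum>b\<in>M j. \<Sum>l<s. \<Sum>c\<in>M l. if ?d i j l then h a b c else 0)"
    unfolding sum_U by (intro sum.cong refl) (auto simp: own_eq)
  also have "\<dots> = (\<Sum>i<s. \<Sum>j<s. \<Sum>a\<in>M i. \<Sum>b\<in>M j. \<Sum>l<s. \<Sum>c\<in>M l. if ?d i j l then h a b c else 0)"
    by (rule sum.cong[OF refl], rule sum.swap)
  also have "\<dots> = (\<Sum>i<s. \<Sum>j<s. \<Sum>a\<in>M i. \<Sum>l<s. \<Sum>b\<in>M j. \<Sum>c\<in>M l. if ?d i j l then h a b c else 0)"
    by (rule sum.cong[OF refl], rule sum.cong[OF refl], rule sum.cong[OF refl], rule sum.swap)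
  also have "\<dots> = (\<Sum>i<s. \<Sum>j<s. \<Sum>l<s. \<Sum>a\<in>M i. \<Sum>b\<in>M j. \<Sum>c\<in>M l. if ?d i j l then h a b c else 0)"
    by (rule sum.cong[OF refl], rule sum.cong[OF refl], rule sum.swap)
  also have "\<dots> = tsum {..<s} {..<s} {..<s} (\<lambda>i j l. \<Sum>a\<in>M i. \<Sum>b\<in>M j. \<Sum>c\<in>M l. h a b c)"
    unfolding tsum_def by (intro sum.cong refl) auto
  finally show ?thesis by simp
qed

text \<open>Vertices up to \<open>3 * s\<close> suffice: by \<open>two_low\<close> an edge has at
  most one vertex above that.\<close>

definition G :: "nat set set" where
  "G = {p. p \<subseteq> {..3 * s} \<and> card p = 2 \<and> insert (3 * s + 2) p \<in> F}"

definition missing :: "nat set set" where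
  "missing = {e. e \<subseteq> {..<3 * s + 2} \<and> card e = 3 \<and> e \<notin> F}"

lemma finite_missing: "finite missing"
  by (rule finite_subset[of _ "Pow {..<3 * s + 2}"]) (auto simp: missing_def)

lemma finite_G: "finite G"
  by (rule finite_subset[of _ "Pow {..3 * s}"]) (auto simp: G_def)

text \<open>A non-edge inside \<open>{1..3 * s}\<close> appears in at most six ordered triples, one
  through \<open>3 * s + 1\<close> in at most two ordered pairs; the factor 3 makes both count six
  times. The two kinds are disjoint.\<close>

lemma missing_lower:
  "tsum {..<s} {..<s} {..<s} (\<lambda>i j l. real (L i j l))
      + 3 * (\<Sum>i<s. \<Sum>j<s. if i \<noteq> j then real (miss i j) else 0) \<le> 6 * real (card missing)"
proof -
  define X where "X = {e \<in> missing. e \<subseteq> {1..3 * s}}"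
  define Y where "Y = {e \<in> missing. 3 * s + 1 \<in> e}"
  let ?U = "{1..3 * s}"
  define Z3 where "Z3 = {(a, b, c) \<in> ?U \<times> ?U \<times> ?U. own a \<noteq> own b \<and> own b \<noteq> own c \<and> own a \<noteq> own c \<and> {a, b, c} \<notin> F}"
  define Z2 where "Z2 = {(a, b) \<in> ?U \<times> ?U. own a \<noteq> own b \<and> {a, b, 3 * s + 1} \<notin> F}"
  have "tsum {..<s} {..<s} {..<s} (\<lambda>i j l. real (L i j l)) = (\<Sum>a\<in>?U. \<Sum>b\<in>?U. \<Sum>c\<in>?U.
        if own a \<noteq> own b \<and> own b \<noteq> own c \<and> own a \<noteq> own c then of_bool ({a, b, c} \<notin> F) else 0)"
    using triple_sum[of "\<lambda>a b c. of_bool ({a, b, c} \<notin> F)"] by (simp add: L_def del: sum_of_bool_eq)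
  also have "\<dots> = (\<Sum>t\<in>?U \<times> ?U \<times> ?U. if t \<in> Z3 then 1 else 0)"
    by (simp add: sum.cartesian_product split_def del: sum_of_bool_eq)
      (intro sum.cong refl, auto simp: Z3_def)
  also have "\<dots> = card Z3"
  proof -
    have "(?U \<times> ?U \<times> ?U) \<inter> {t. t \<in> Z3} = Z3" by (auto simp: Z3_def)
    then show ?thesis by (subst sum.If_cases) auto
  qed
  also have "card Z3 \<le> 6 * card X"
  proof (rule card_ordered_triples_le)
    fix a b c assume "(a, b, c) \<in> Z3"
    then show "{a, b, c} \<in> X" by (auto simp: Z3_def X_def missing_def card_insert_if)
  qed (use finite_missing in \<open>auto simp: X_def missing_def\<close>)
  finally have A: "tsum {..<s} {..<s} {..<s} (\<lambda>i j l. real (L i j l)) \<le> 6 * real (card X)"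
    by simp
  have "(\<Sum>i<s. \<Sum>j<s. if i \<noteq> j then real (miss i j) else 0) = (\<Sum>a\<in>?U. \<Sum>b\<in>?U.
        if own a \<noteq> own b then of_bool ({a, b, 3 * s + 1} \<notin> F) else 0)"
    unfolding miss_def of_nat_sum of_nat_of_bool by (rule pair_sum)
  also have "\<dots> = (\<Sum>t\<in>?U \<times> ?U. if t \<in> Z2 then 1 else 0)"
    by (simp add: sum.cartesian_product split_def del: sum_of_bool_eq)
      (intro sum.cong refl, auto simp: Z2_def)
  also have "\<dots> = card Z2"
  proof -
    have "(?U \<times> ?U) \<inter> {t. t \<in> Z2} = Z2" by (auto simp: Z2_def)
    then show ?thesis by (subst sum.If_cases) auto
  qed
  also have "card Z2 \<le> 2 * card Y"
  proof (rule card_ordered_pairs_le)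
    fix a b assume "(a, b) \<in> Z2"
    then show "{a, b, 3 * s + 1} \<in> Y" by (auto simp: Z2_def Y_def missing_def card_insert_if)
  qed (use finite_missing in \<open>auto simp: Y_def missing_def\<close>)
  finally have B: "(\<Sum>i<s. \<Sum>j<s. if i \<noteq> j then real (miss i j) else 0) \<le> 2 * real (card Y)" by simp
  have "card X + card Y = card (X \<union> Y)"
    using finite_missing by (intro card_Un_disjoint[symmetric]) (auto simp: X_def Y_def)
  also have "\<dots> \<le> card missing" using finite_missing by (intro card_mono) (auto simp: X_def Y_def)
  finally have "real (card X) + real (card Y) \<le> real (card missing)" by linarith
  then show ?thesis using A B by linarith
qed

lemma G_pair: "{a, b} \<in> G \<longleftrightarrow> a \<noteq> b \<and> a \<le> 3 * s \<and> b \<le> 3 * s \<and> {a, b, 3 * s + 2} \<in> F"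
  unfolding G_def by (auto simp: card_insert_if insert_commute)

text \<open>A pair of \<open>G\<close> that joins \<open>0\<close> to a vertex of \<open>M i\<close>
  or lies inside \<open>M i\<close> forces \<open>i\<close> into \<open>I\<close> by shiftedness.
  This allows \<open>3 + 3\<close> pairs per index of \<open>I\<close>, doubled to 12; all other
  pairs are counted by \<open>g\<close>.\<close>

lemma G_upper:
  "2 * real (card G) \<le> (\<Sum>i<s. \<Sum>j<s. if i \<noteq> j then real (g i j) else 0) + 12 * real (card I)"
proof -
  have fI: "finite I" by (rule finite_subset[of _ "{..<s}"]) (auto simp: I_def)
  define A where "A = (\<lambda>a. {0, a}) ` (\<Union>i\<in>I. M i)"
  define B where "B = (\<Union>i\<in>I. {p. p \<subseteq> M i \<and> card p = 2})"
  define T where "T i j = {(a, b) \<in> M i \<times> M j. {a, b, 3 * s + 2} \<in> F}" for i j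
  define C where "C = (\<Union>i<s. \<Union>j\<in>{i<..<s}. (\<lambda>(a, b). {a, b}) ` T i j)"
  have cM: "card (M i) = 3" "finite (M i)" if "i \<in> I" for i
    using that edge_card M_edge M_finite by (auto simp: I_def)
  have fA: "finite A" using fI cM by (auto simp: A_def)
  have fB: "finite B" using fI cM by (auto simp: B_def)
  have fT: "finite (T i j)" if "i < s" "j < s" for i j
    using that M_finite by (auto simp: T_def intro: finite_subset[of _ "M i \<times> M j"])
  have fC: "finite C" unfolding C_def using fT by auto
  have A: "card A \<le> 3 * card I"
  proof -
    have "card A \<le> card (\<Union>i\<in>I. M i)" unfolding A_def using fI cM by (intro card_image_le) auto
    also have "\<dots> \<le> (\<Sum>i\<in>I. card (M i))" by (rule card_UN_le[OF fI])
    also have "\<dots> = 3 * card I" using cM by simp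
    finally show ?thesis .
  qed
  have B: "card B \<le> 3 * card I"
  proof -
    have "card B \<le> (\<Sum>i\<in>I. card {p. p \<subseteq> M i \<and> card p = 2})" unfolding B_def by (rule card_UN_le[OF fI])
    also have "\<dots> = (\<Sum>i\<in>I. 3)" using cM by (intro sum.cong refl) (simp add: n_subsets choose_two)
    finally show ?thesis by simp
  qed
  have cT: "card (T i j) = g i j" if "i < s" "j < s" for i j
  proof -
    have "g i j = (\<Sum>t\<in>M i \<times> M j. if t \<in> T i j then 1 else 0)"
      unfolding g_def by (simp add: sum.cartesian_product split_def del: sum_of_bool_eq)
        (intro sum.cong refl, auto simp: T_def)
    also have "\<dots> = card ((M i \<times> M j) \<inter> {t. t \<in> T i j})"
      using M_finite that by (subst sum.If_cases) auto
    also have "(M i \<times> M j) \<inter> {t. t \<in> T i j} = T i j" by (auto simp: T_def)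
    finally show ?thesis by simp
  qed
  have C: "card C \<le> (\<Sum>i<s. \<Sum>j\<in>{i<..<s}. g i j)"
  proof -
    have "card C \<le> (\<Sum>i<s. card (\<Union>j\<in>{i<..<s}. (\<lambda>(a, b). {a, b}) ` T i j))"
      unfolding C_def by (rule card_UN_le) simp
    also have "\<dots> \<le> (\<Sum>i<s. \<Sum>j\<in>{i<..<s}. card ((\<lambda>(a, b). {a, b}) ` T i j))"
      by (intro sum_mono card_UN_le) simp
    also have "\<dots> \<le> (\<Sum>i<s. \<Sum>j\<in>{i<..<s}. g i j)"
      using card_image_le[OF fT] cT by (intro sum_mono) fastforce
    finally show ?thesis .
  qed
  have CI: "{a, b} \<in> C" if "i < j" "j < s" "(a, b) \<in> T i j" for i j a b
  proof -
    have "{a, b} \<in> (\<lambda>(a, b). {a, b}) ` T i j" using that(3) by (rule image_eqI[rotated]) simp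
    then have "{a, b} \<in> (\<Union>j\<in>{i<..<s}. (\<lambda>(a, b). {a, b}) ` T i j)" by (rule UN_I[rotated]) (use that in simp)
    then show ?thesis unfolding C_def by (rule UN_I[rotated]) (use that in simp)
  qed
  have sub: "G \<subseteq> A \<union> B \<union> C"
  proof
    fix p assume p: "p \<in> G"
    then have "card p = 2" by (simp add: G_def)
    then obtain x y where xy: "p = {x, y}" "x \<noteq> y" by (auto simp: card_2_iff)
    obtain a b where ab: "p = {a, b}" "a < b"
    proof (cases "x < y")
      case True
      then show ?thesis using that[of x y] xy(1) by simp
    next
      case False
      then show ?thesis using that[of y x] xy by (auto simp: insert_commute)
    qed
    have r: "a \<le> 3 * s" "b \<le> 3 * s" "{a, b, 3 * s + 2} \<in> F" using p ab G_pair by auto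
    have "b \<in> {1..3 * s}" using ab r by auto
    then obtain j where j: "j < s" "b \<in> M j" unfolding M_Union[symmetric] by blast
    show "p \<in> A \<union> B \<union> C"
    proof (cases "a = 0")
      case True
      then have "j \<in> I" using j r by (auto simp: I_def)
      then show ?thesis using ab True j by (auto simp: A_def)
    next
      case False
      then have "a \<in> {1..3 * s}" using r by auto
      then obtain i where i: "i < s" "a \<in> M i" unfolding M_Union[symmetric] by blast
      show ?thesis
      proof (cases "i = j")
        case True
        have "{0, b, 3 * s + 2} \<in> F" by (rule edge_dominated[OF r(3)]) (use r ab in auto)
        then have "j \<in> I" using j by (auto simp: I_def)
        then show ?thesis using i j True ab by (auto simp: B_def)
      next
        case False
        show ?thesis
        proof (cases "i < j")
          case True
          then have "(a, b) \<in> T i j" using i j r by (auto simp: T_def)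
          then show ?thesis using CI[OF True j(1)] ab(1) by simp
        next
          case F: False
          then have "(b, a) \<in> T j i" using i j r by (auto simp: T_def insert_commute)
          then show ?thesis using CI[of j i b a] F False i(1) ab(1) by (simp add: insert_commute)
        qed
      qed
    qed
  qed
  have "card G \<le> card (A \<union> B \<union> C)" using sub fA fB fC by (intro card_mono) auto
  also have "\<dots> \<le> card A + card B + card C" using card_Un_le[of "A \<union> B" C] card_Un_le[of A B] by linarith
  also have "\<dots> \<le> 6 * card I + (\<Sum>i<s. \<Sum>j\<in>{i<..<s}. g i j)" using A B C by linarith
  finally have "real (card G) \<le> real (6 * card I + (\<Sum>i<s. \<Sum>j\<in>{i<..<s}. g i j))"
    by (simp only: of_nat_le_iff)
  then have 1: "real (card G) \<le> 6 * real (card I) + (\<Sum>i<s. \<Sum>j\<in>{i<..<s}. real (g i j))" by simp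
  have S1: "(\<Sum>i<s. \<Sum>j\<in>{i<..<s}. real (g i j)) = (\<Sum>i<s. \<Sum>j<s. if i < j then real (g i j) else 0)"
  proof (rule sum.cong[OF refl])
    fix i
    have "{..<s} \<inter> {j. i < j} = {i<..<s}" by auto
    then show "(\<Sum>j\<in>{i<..<s}. real (g i j)) = (\<Sum>j<s. if i < j then real (g i j) else 0)"
      by (subst sum.If_cases) auto
  qed
  have S2: "(\<Sum>i<s. \<Sum>j<s. if i < j then real (g i j) else 0) = (\<Sum>i<s. \<Sum>j<s. if j < i then real (g i j) else 0)"
    by (subst sum.swap, intro sum.cong refl) (use g_sym in auto)
  have "(\<Sum>i<s. \<Sum>j<s. if i \<noteq> j then real (g i j) else 0)
    = (\<Sum>i<s. \<Sum>j<s. if i < j then real (g i j) else 0) + (\<Sum>i<s. \<Sum>j<s. if j < i then real (g i j) else 0)"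
    unfolding sum.distrib[symmetric] by (intro sum.cong refl) auto
  then show ?thesis using 1 S1 S2 by linarith
qed

text \<open>If \<open>{i, 2 * s + 1 - i, 3 * s + 2}\<close> were an edge for all
  \<open>i \<le> s\<close>, lowering the last vertex to \<open>2 * s + 2 + i\<close> would give
  \<open>s + 1\<close> disjoint edges. So some \<open>i\<close> fails, and by shiftedness each pair
  \<open>a < b\<close> of \<open>G\<close> has \<open>a < i\<close> or
  \<open>b < 2 * s + 1 - i\<close>.\<close>

lemma G_erdos_gallai: "2 * real (card G) \<le> 5 * real s ^ 2 + real s"
proof -
  have "\<exists>i\<le>s. {i, 2 * s + 1 - i, 3 * s + 2} \<notin> F"
  proof (rule ccontr)
    assume "\<not> ?thesis"
    then have all: "{i, 2 * s + 1 - i, 3 * s + 2} \<in> F" if "i \<le> s" for i using that by auto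
    define e where "e i = {i, 2 * s + 1 - i, 2 * s + 2 + i}" for i
    have eF: "e i \<in> F" if "i \<le> s" for i
      unfolding e_def by (rule edge_dominated[OF all[OF that]]) (use that in auto)
    have "e i \<inter> e j = {}" if "i < j" "j < Suc s" for i j using that by (auto simp: e_def)
    then have "has_matching F (Suc s)" using eF edge_card by (intro has_matching_indexed[of "Suc s" e]) fastforce+
    then show False using no_matching by simp
  qed
  then obtain i where i: "i \<le> s" "{i, 2 * s + 1 - i, 3 * s + 2} \<notin> F" by blast
  define A where "A = {p. p \<subseteq> {..<2 * s + 1 - i} \<and> card p = 2}"
  define B where "B = (\<lambda>(a, b). {a, b}) ` ({..<i} \<times> {2 * s + 1 - i..3 * s})"
  have "G \<subseteq> A \<union> B"
  proof
    fix p assume p: "p \<in> G"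
    then have "card p = 2" by (simp add: G_def)
    then obtain x y where xy: "p = {x, y}" "x \<noteq> y" by (auto simp: card_2_iff)
    obtain a b where ab: "p = {a, b}" "a < b"
    proof (cases "x < y")
      case True
      then show ?thesis using that[of x y] xy(1) by simp
    next
      case False
      then show ?thesis using that[of y x] xy by (auto simp: insert_commute)
    qed
    have r: "a \<le> 3 * s" "b \<le> 3 * s" "{a, b, 3 * s + 2} \<in> F" using p ab G_pair by auto
    have "a < i \<or> b < 2 * s + 1 - i"
    proof (rule ccontr)
      assume "\<not> ?thesis"
      then have "{i, 2 * s + 1 - i, 3 * s + 2} \<in> F"
        by (intro edge_dominated[OF r(3)]) (use i in auto)
      then show False using i by simp
    qed
    then show "p \<in> A \<union> B" using ab r by (cases "b < 2 * s + 1 - i") (auto simp: A_def B_def)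
  qed
  moreover have "finite A" "finite B" by (auto simp: A_def B_def)
  ultimately have "card G \<le> card (A \<union> B)" by (intro card_mono) auto
  also have "\<dots> \<le> card A + card B" by (rule card_Un_le)
  also have "card A = (2 * s + 1 - i) choose 2" unfolding A_def by (simp add: n_subsets)
  also have "card B \<le> i * (s + i)"
  proof -
    have "card B \<le> card ({..<i} \<times> {2 * s + 1 - i..3 * s})" unfolding B_def by (rule card_image_le) simp
    also have "\<dots> = i * (s + i)" using i by (simp add: card_cartesian_product)
    finally show ?thesis .
  qed
  finally have c: "card G \<le> ((2 * s + 1 - i) choose 2) + i * (s + i)" by simp
  have "real (2 * ((2 * s + 1 - i) choose 2)) = (2 * real s + 1 - i) * (2 * real s - i)"
  proof -
    have "2 * (m choose 2) = m * (m - 1)" for m :: nat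
    proof -
      have "even (m * (m - 1))" by (cases m) auto
      then show ?thesis by (simp add: choose_two)
    qed
    then have "2 * ((2 * s + 1 - i) choose 2) = (2 * s + 1 - i) * (2 * s - i)" by simp
    then show ?thesis using i by (simp add: of_nat_diff)
  qed
  moreover have "2 * real (card G) \<le> real (2 * ((2 * s + 1 - i) choose 2)) + 2 * (real i * (real s + real i))"
  proof -
    have "2 * card G \<le> 2 * ((2 * s + 1 - i) choose 2) + 2 * (i * (s + i))" using c by simp
    then have "real (2 * card G) \<le> real (2 * ((2 * s + 1 - i) choose 2) + 2 * (i * (s + i)))"
      by (simp only: of_nat_le_iff)
    then show ?thesis by simp
  qed
  \<comment> \<open>This is the count for \<open>i = s\<close>, which is the claimed bound, minus
    the count for the given \<open>i\<close>.\<close>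
  moreover have "0 \<le> (real s - i) * (real s + 3 * i - 1)"
    using i by (cases "s = 0") auto
  ultimately show ?thesis by (simp add: algebra_simps power2_eq_square)
qed

text \<open>Such an edge could be lowered to \<open>{0, 3 * s + 1, 3 * s + 2}\<close>, which is
  disjoint from the whole matching.\<close>

lemma two_low:
  assumes "e \<in> F" "u \<in> e" "v \<in> e" "u < v" "3 * s < u" shows False
proof -
  have c: "card e = 3" using edge_card assms by blast
  then have fe: "finite e" by (metis card.infinite zero_neq_numeral)
  then have "card (e - {u, v}) = 1" using c assms by (simp add: card_Diff_subset)
  then obtain x where x: "e - {u, v} = {x}" by (auto simp: card_1_singleton_iff)
  then have e: "{x, u, v} \<in> F" 
  proof -
    have "{x, u, v} = e" using x assms(2,3) by blast
    then show ?thesis using assms(1) by simp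
  qed
  have "{0, 3 * s + 1, 3 * s + 2} \<in> F" by (rule edge_dominated[OF e]) (use assms in auto)
  then show False using exchange[of "[{0, 3 * s + 1, 3 * s + 2}]" "[]"] by auto
qed

text \<open>The choice \<open>y = 0\<close> is the fallback where \<open>weighted_count\<close> does
  not apply. The coefficient of \<open>card G\<close> can be negative, so \<open>max 0\<close> is
  taken before the upper bound for \<open>card G\<close> is inserted.\<close>

lemma card_le:
  assumes range: "\<And>e. e \<in> F \<Longrightarrow> e \<subseteq> {..<n}" and n: "3 * s + 2 \<le> n"
    and y: "y = 0 \<or> 0 \<le> y \<and> 50 * y \<le> 27 * (real s - 2) \<and> 12 * y + 14 \<le> 7 * (real s - 2) \<and> 23 \<le> s"
  shows "real (card F) \<le> real ((3 * s + 2) choose 3)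
    + max 0 (real n - 3 * real s - 2 - y) * ((5 * real s ^ 2 + real s) / 2)"
proof -
  have fF: "finite F" by (rule finite_subset[of _ "Pow {..<n}"]) (use range in auto)
  define F1 where "F1 = {e \<in> F. e \<subseteq> {..<3 * s + 2}}"
  define F2 where "F2 = F - F1"
  have m0: "card F = card F1 + card F2"
  proof -
    have "F1 \<union> F2 = F" "F1 \<inter> F2 = {}" "finite F1" "finite F2" using fF by (auto simp: F1_def F2_def)
    then show ?thesis using card_Un_disjoint[of F1 F2] by simp
  qed
  have m1: "card F1 + card missing = (3 * s + 2) choose 3"
  proof -
    have "card (F1 \<union> missing) = card F1 + card missing"
      using fF finite_missing by (intro card_Un_disjoint) (auto simp: F1_def missing_def)
    moreover have "F1 \<union> missing = {e. e \<subseteq> {..<3 * s + 2} \<and> card e = 3}"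
      using edge_card by (auto simp: F1_def missing_def)
    ultimately show ?thesis by (simp add: n_subsets)
  qed
  have m2: "card F2 \<le> card G * (n - (3 * s + 2))"
  proof -
    have "F2 \<subseteq> (\<lambda>(p, z). insert z p) ` (G \<times> {3 * s + 2..<n})"
    proof
      fix e assume e: "e \<in> F2"
      then have eF: "e \<in> F" by (simp add: F2_def)
      then have "\<not> e \<subseteq> {..<3 * s + 2}" using e by (auto simp: F2_def F1_def)
      then obtain z where z: "z \<in> e" "3 * s + 2 \<le> z" by (meson lessThan_iff not_less subsetI)
      have c: "card e = 3" using edge_card eF by blast
      then have fe: "finite e" by (metis card.infinite zero_neq_numeral)
      have low: "x \<le> 3 * s" if "x \<in> e" "x \<noteq> z" for x
      proof (rule ccontr)
        assume "\<not> x \<le> 3 * s"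
        then show False
          using two_low[OF eF that(1) z(1)] two_low[OF eF z(1) that(1)] that(2) z(2) by linarith
      qed
      have "card (e - {z}) = 2" using c fe z by simp
      then obtain a b where ab: "e - {z} = {a, b}" "a \<noteq> b" by (auto simp: card_2_iff)
      have e': "e = {a, b, z}" using ab z by auto
      have abl: "a \<le> 3 * s" "b \<le> 3 * s" using low ab by auto
      have "{a, b, 3 * s + 2} \<in> F"
        by (rule edge_dominated[of a b z]) (use eF e' z ab abl in auto)
      then have "{a, b} \<in> G" using G_pair abl ab by blast
      moreover have "z < n" using range eF z by blast
      ultimately show "e \<in> (\<lambda>(p, z). insert z p) ` (G \<times> {3 * s + 2..<n})"
        using e' z by (intro image_eqI[of _ _ "({a, b}, z)"]) (auto simp: insert_commute)
    qed
    then have "card F2 \<le> card ((\<lambda>(p, z). insert z p) ` (G \<times> {3 * s + 2..<n}))"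
      using finite_G by (intro card_mono) auto
    also have "\<dots> \<le> card (G \<times> {3 * s + 2..<n})" using finite_G by (intro card_image_le) auto
    finally show ?thesis by (simp add: card_cartesian_product)
  qed
  have "real (card F) \<le> real ((3 * s + 2) choose 3) - card missing + real (card G) * real (n - (3 * s + 2))"
  proof -
    have "real (card F1 + card missing) = real ((3 * s + 2) choose 3)" using m1 by (simp only:)
    moreover have "real (card F2) \<le> real (card G * (n - (3 * s + 2)))" using m2 by (simp only: of_nat_le_iff)
    ultimately show ?thesis using m0 by simp
  qed
  moreover have "real (n - (3 * s + 2)) = real n - 3 * real s - 2" using n by (simp add: of_nat_diff)
  moreover have "y * real (card G) \<le> card missing"
  proof (cases "y = 0")
    case False
    then have y': "0 \<le> y" "50 * y \<le> 27 * (real s - 2)" "12 * y + 14 \<le> 7 * (real s - 2)" "23 \<le> s" using y by auto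
    have "3 * y * (2 * real (card G)) \<le> 3 * y * ((\<Sum>i<s. \<Sum>j<s. if i \<noteq> j then real (g i j) else 0) + 12 * real (card I))"
      using G_upper y'(1) by (intro mult_left_mono) auto
    also have "\<dots> \<le> 6 * real (card missing)"
      using weighted_count[OF y'] missing_lower by linarith
    finally show ?thesis by simp
  qed simp
  ultimately have 1: "real (card F) \<le> real ((3 * s + 2) choose 3) + (real n - 3 * real s - 2 - y) * real (card G)"
    by (simp add: algebra_simps)
  have "(real n - 3 * real s - 2 - y) * real (card G) \<le> max 0 (real n - 3 * real s - 2 - y) * real (card G)"
    by (intro mult_right_mono) auto
  also have "\<dots> \<le> max 0 (real n - 3 * real s - 2 - y) * ((5 * real s ^ 2 + real s) / 2)"
    using G_erdos_gallai by (intro mult_left_mono) auto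
  finally show ?thesis using 1 by linarith
qed

end

section \<open>Numerical estimates\<close>

lemma real_choose_3: "real (m choose 3) = real m * (real m - 1) * (real m - 2) / 6"
proof (induction m)
  case (Suc m)
  have "real (m choose 2) = real m * (real m - 1) / 2"
    by (induction m) (simp_all add: numeral_2_eq_2 field_simps)
  then show ?case using Suc by (simp add: numeral_3_eq_3 numeral_2_eq_2 field_simps)
qed simp

definition star :: "real \<Rightarrow> real \<Rightarrow> real" where
  "star n s = s * (3 * n ^ 2 - 3 * n * s + s ^ 2 - 6 * n + 3 * s + 2) / 6"

lemma star_eq: "s \<le> n \<Longrightarrow> real (n choose 3) - real ((n - s) choose 3) = star n s"
  unfolding real_choose_3 star_def by (simp add: of_nat_diff field_simps power2_eq_square)

lemma clique_eq: "real ((3 * s + 2) choose 3) = s * (27 * real s ^ 2 + 27 * s + 6) / 6"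
  unfolding real_choose_3 by (simp add: field_simps power2_eq_square)

text \<open>The value \<open>354/100 * s + 92/100\<close> is \<open>3 * s + 2 + y\<close> for \<open>y = 54/100 * (s - 2)\<close>; it lies just above the
  root (about \<open>3.486 * s + 2.5\<close>) of \<open>star n s = (3 * s + 2) choose 3\<close>.\<close>

lemma star_ge_at_crossing:
  fixes n s :: real
  assumes "33 \<le> s" "354/100 * s + 92/100 \<le> n"
  shows "s * (27 * s ^ 2 + 27 * s + 6) / 6 + (n - (354/100 * s + 92/100)) * ((5 * s ^ 2 + s) / 2) \<le> star n s"
proof -
  define u where "u = n - (354/100 * s + 92/100)"
  have n: "n = 354/100 * s + 92/100 + u" by (simp add: u_def)
  have u: "0 \<le> u" using assms by (simp add: u_def)
  have "33 * s \<le> s * s" using assms by (intro mult_right_mono) auto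
  then have 1: "0 \<le> 9748/10000 * (s * s) - 284592/10000 * s - 69808/10000" using assms by argo
  have 2: "0 \<le> u * (324/100 * s - 348/100)" using u assms by (intro mult_nonneg_nonneg) auto
  have "star n s - s * (27 * s ^ 2 + 27 * s + 6) / 6 - u * ((5 * s ^ 2 + s) / 2)
    = s / 6 * ((9748/10000 * (s * s) - 284592/10000 * s - 69808/10000) + u * (324/100 * s - 348/100) + 3 * u ^ 2)"
    unfolding star_def n by (simp add: field_simps power2_eq_square)
  also have "0 \<le> \<dots>" using 1 2 assms by (intro mult_nonneg_nonneg) auto
  finally show ?thesis unfolding u_def by linarith
qed


text \<open>Here \<open>d\<close> stands for \<open>n - s\<close>, which is unchanged when the first vertices are peeled off.\<close>

lemma star_ge_small:
  fixes d s y :: real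
  assumes d: "84 \<le> d" and s: "1 \<le> s"
    and y: "y = 0 \<and> s \<le> 22 \<or> y = (s - 2) / 2 \<and> s \<le> 30 \<or> y = 54/100 * (s - 2) \<and> s \<le> 32"
  shows "s * (27 * s ^ 2 + 27 * s + 6) / 6 + max 0 (d - 2 * s - 2 - y) * ((5 * s ^ 2 + s) / 2) \<le> star (d + s) s"
proof -
  have s32: "s \<le> 32" using y by auto
  then have pos: "0 \<le> d - 2 * s - 2 - y" using y d by argo
  define u where "u = d - 84"
  have d': "d = 84 + u" and u: "0 \<le> u" using d by (auto simp: u_def)
  define q where "q c = (s - c) * (s - c)" for c
  have sq: "0 \<le> q c" for c by (simp add: q_def)
  \<comment> \<open>This is the part free of \<open>u\<close> once \<open>d = 84 + u\<close> is
    inserted. Each case expands it at the right end of its range for \<open>s\<close>, where all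
    coefficients become positive.\<close>
  have p1: "0 \<le> 4 * (s * s) - 1002 * s + 20414 + (15 * s + 3) * y"
    using y
  proof (elim disjE conjE)
    assume h: "y = 0" "s \<le> 22"
    have "4 * (s * s) - 1002 * s + 20414 + (15 * s + 3) * y = 4 * q 22 + 826 * (22 - s) + 306"
      unfolding h(1) q_def by (simp add: algebra_simps)
    then show ?thesis using sq[of 22] h(2) by argo
  next
    assume h: "y = (s - 2) / 2" "s \<le> 30"
    have "4 * (s * s) - 1002 * s + 20414 + (15 * s + 3) * y = 23/2 * q 30 + 651/2 * (30 - s) + 296"
      unfolding h(1) q_def by (simp add: field_simps)
    then show ?thesis using sq[of 30] h(2) by argo
  next
    assume h: "y = 54/100 * (s - 2)" "s \<le> 32"
    have "4 * (s * s) - 1002 * s + 20414 + (15 * s + 3) * y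
      = 121/10 * q 32 + 24218/100 * (32 - s) + 2706/10"
      unfolding h(1) q_def by (simp add: field_simps)
    then show ?thesis using sq[of 32] h(2) by argo
  qed
  have p2: "0 \<le> u * (495 - 12 * s)" using u s32 by (intro mult_nonneg_nonneg) auto
  have "star (d + s) s - s * (27 * s ^ 2 + 27 * s + 6) / 6 - (d - 2 * s - 2 - y) * ((5 * s ^ 2 + s) / 2)
    = s / 6 * ((4 * (s * s) - 1002 * s + 20414 + (15 * s + 3) * y) + u * (495 - 12 * s) + 3 * u ^ 2)"
    unfolding star_def d' by (simp add: field_simps power2_eq_square)
  also have "0 \<le> \<dots>" by (rule mult_nonneg_nonneg) (use s p1 p2 in simp_all)
  finally have "s * (27 * s ^ 2 + 27 * s + 6) / 6 + (d - 2 * s - 2 - y) * ((5 * s ^ 2 + s) / 2) \<le> star (d + s) s"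
    by linarith
  then show ?thesis using pos by (simp add: max_absorb2)
qed

text \<open>\<open>A\<close> is \<open>6 / s\<close> times the star size minus the clique size.
  \<open>H\<close> says that the same form is nonnegative at \<open>d + 1\<close> and
  \<open>s + 1\<close>; going back to \<open>d\<close> and \<open>s\<close> gains
  \<open>49 * s + 56 - 9 * d\<close>, which is positive near the crossing. Here \<open>s\<close>
  belongs to the family left after peeling at least one vertex, which is where the gain comes
  from.\<close>

lemma star_ge_large:
  fixes d s :: real
  assumes s: "33 \<le> s" and H: "0 \<le> 3 * d ^ 2 + 3 * d * s + 3 * d - 26 * s ^ 2 - 79 * s - 60"
  shows "s * (27 * s ^ 2 + 27 * s + 6) / 6 + max 0 (d - 2 * s - 2 - 54/100 * (s - 2)) * ((5 * s ^ 2 + s) / 2)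
    \<le> star (d + s) s"
proof -
  let ?m = "d - 2 * s - 2 - 54/100 * (s - 2)"
  define A where "A = 3 * d ^ 2 + 3 * d * s - 6 * d - 26 * s ^ 2 - 30 * s - 4"
  have st: "star (d + s) s - s * (27 * s ^ 2 + 27 * s + 6) / 6 = s / 6 * A"
    unfolding star_def A_def by (simp add: field_simps power2_eq_square)
  have AH: "49 * s + 56 - 9 * d \<le> A" using H unfolding A_def by simp
  have "3 * (5 * s + 1) * max 0 ?m \<le> A"
  proof -
    consider "d \<le> 254/100 * s + 92/100" | "254/100 * s + 92/100 \<le> d" "d \<le> 254/100 * s + 26/10"
      | "254/100 * s + 26/10 \<le> d" by linarith
    then show ?thesis
    proof cases
      case 1
      then have "?m \<le> 0" by argo
      then have "max 0 ?m = 0" by simp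
      then show ?thesis using AH 1 s by simp
    next
      \<comment> \<open>On this short interval, where \<open>?m\<close> has just become positive,
        the linear gain from \<open>H\<close> is enough. Above it the quadratic \<open>A\<close>
        suffices without \<open>H\<close>.\<close>
      case 2
      have "0 \<le> ?m" using 2 by argo
      then have "max 0 ?m = ?m" by simp
      moreover have "?m \<le> 168/100" using 2 by argo
      then have "3 * (5 * s + 1) * ?m \<le> 3 * (5 * s + 1) * (168/100)" using s by (intro mult_left_mono) auto
      moreover have "3 * (5 * s + 1) * (168/100) \<le> 49 * s + 56 - 9 * d" using 2 s by argo
      ultimately show ?thesis using AH by simp
    next
      case 3
      define u where "u = d - (254/100 * s + 26/10)"
      have d': "d = 254/100 * s + 26/10 + u" and u: "0 \<le> u" using 3 by (auto simp: u_def)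
      have "0 \<le> ?m" using 3 by argo
      then have m: "max 0 ?m = ?m" by simp
      have "33 * s \<le> s * s" using s by (intro mult_right_mono) auto
      then have 1: "0 \<le> 9748/10000 * (s * s) - 23016/1000 * s - 436/100" using s by argo
      have 2: "0 \<le> u * (324/100 * s + 66/10)" using u s by (intro mult_nonneg_nonneg) auto
      have "A - 3 * (5 * s + 1) * ?m = (9748/10000 * (s * s) - 23016/1000 * s - 436/100)
        + u * (324/100 * s + 66/10) + 3 * u ^ 2"
        unfolding A_def d' by (simp add: field_simps power2_eq_square)
      then show ?thesis using 1 2 unfolding m by (smt (verit) zero_le_power2)
    qed
  qed
  then have "s / 6 * (3 * (5 * s + 1) * max 0 ?m) \<le> s / 6 * A" using s by (intro mult_left_mono) auto
  moreover have "s / 6 * (3 * (5 * s + 1) * max 0 ?m) = max 0 ?m * ((5 * s ^ 2 + s) / 2)"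
    by (simp add: field_simps power2_eq_square)
  ultimately show ?thesis using st by linarith
qed

text \<open>As a function of \<open>s\<close>, the quadratic form \<open>h\<close> below is concave and nonnegative at \<open>0\<close>, so its
  nonnegativity passes from \<open>s\<close> to all smaller values.\<close>

lemma crossing_consequences:
  fixes d s t :: nat
  assumes s: "33 \<le> s" and t: "t < s"
    and cross: "real s * (27 * real s ^ 2 + 27 * s + 6) / 6 \<le> star (real d + 1 + s) s"
  shows "84 \<le> d" "0 \<le> 3 * real d ^ 2 + 3 * real d * t + 3 * real d - 26 * real t ^ 2 - 79 * real t - 60"
proof -
  define D where "D = real d + 1"
  define h where "h u = 3 * (D * D) + 3 * D * u - 6 * D - 26 * (u * u) - 30 * u - 4" for u :: real
  have "star (D + s) s - real s * (27 * real s ^ 2 + 27 * s + 6) / 6 = real s / 6 * h s"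
    unfolding star_def h_def by (simp add: field_simps power2_eq_square)
  then have "0 \<le> real s / 6 * h s" using cross by (simp add: D_def)
  then have hs: "0 \<le> h s" using s by (simp add: zero_le_mult_iff)
  show d84: "84 \<le> d"
  proof (rule ccontr)
    assume "\<not> 84 \<le> d"
    then have D: "D \<le> 84" "1 \<le> D" by (auto simp: D_def)
    \<comment> \<open>The product is the increase of \<open>h s\<close> when \<open>D\<close> is
      raised to 84. The value there, \<open>20660 + 222 * s - 26 * s^2\<close>, is negative from
      \<open>s = 33\<close> on but not yet at \<open>s = 32\<close>.\<close>
    have "0 \<le> (84 - D) * (3 * D + 246 + 3 * s)" using D by (intro mult_nonneg_nonneg) auto
    then have "h s \<le> 20660 + 222 * s - 26 * (real s * s)" unfolding h_def by (simp add: algebra_simps)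
    moreover have "33 * real s \<le> real s * s" using s by (intro mult_right_mono) auto
    ultimately show False using hs s by simp
  qed
  \<comment> \<open>Both \<open>D\<close> and \<open>u\<close> are one larger than the parameters of
    the peeled family: \<open>D\<close> because \<open>cross\<close> speaks of one vertex more,
    \<open>u\<close> because \<open>t < s\<close> leaves room for it.\<close>
  define u where "u = real t + 1"
  have u: "0 \<le> u" "u \<le> s" using t by (auto simp: u_def)
  have c: "0 \<le> 3 * (D * D) - 6 * D - 4"
  proof -
    have "85 * D \<le> D * D" using d84 by (intro mult_right_mono) (auto simp: D_def)
    then show ?thesis using d84 by (simp add: D_def)
  qed
  have "real s * h u = (s - u) * (3 * (D * D) - 6 * D - 4) + u * h s + 26 * (u * (s * (s - u)))"
    unfolding h_def by (simp add: algebra_simps)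
  also have "0 \<le> \<dots>" using u c hs by (intro add_nonneg_nonneg mult_nonneg_nonneg) auto
  finally have "0 \<le> h u" using s by (simp add: zero_le_mult_iff)
  moreover have "h u = 3 * real d ^ 2 + 3 * real d * t + 3 * real d - 26 * real t ^ 2 - 79 * real t - 60"
    unfolding h_def u_def D_def by (simp add: algebra_simps power2_eq_square)
  ultimately show "0 \<le> 3 * real d ^ 2 + 3 * real d * t + 3 * real d - 26 * real t ^ 2 - 79 * real t - 60" by simp
qed

section \<open>The upper bound\<close>

text \<open>Replacing every vertex of a matching by its rank among the covered vertices moves vertices down
  only, so shiftedness keeps the edges.\<close>

lemma compress_matching:
  fixes F :: "nat set set"
  assumes shift: "shifted F" and c3: "\<And>e. e \<in> F \<Longrightarrow> card e = 3"
    and N: "has_matching {e \<in> F. 0 \<notin> e} s"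
  obtains M where "\<And>i. i < s \<Longrightarrow> M i \<in> F" "\<And>i j. i < s \<Longrightarrow> j < s \<Longrightarrow> i \<noteq> j \<Longrightarrow> M i \<inter> M j = {}"
    "(\<Union>i<s. M i) = {1..3 * s}"
proof -
  obtain N where N: "N \<subseteq> F" "\<forall>e\<in>N. 0 \<notin> e" "pairwise disjnt N" "finite N" "card N = s"
    using N by (auto simp: has_matching_def is_matching_def)
  have fe: "finite e" if "e \<in> N" for e
    using c3 N(1) that by (metis card.infinite subsetD zero_neq_numeral)
  define U where "U = \<Union>N"
  have fU: "finite U" using N(4) fe by (auto simp: U_def)
  have cU: "card U = 3 * s"
  proof -
    have "card U = (\<Sum>e\<in>N. card e)" unfolding U_def
      using card_Union_disjoint[OF N(3)] fe by simp
    also have "\<dots> = (\<Sum>e\<in>N. 3)" using c3 N(1) by (intro sum.cong refl) auto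
    finally show ?thesis using N(5) by simp
  qed
  have U0: "0 \<notin> U" using N(2) by (auto simp: U_def)
  define \<phi> where "\<phi> u = card {v \<in> U. v \<le> u}" for u
  have less: "\<phi> u < \<phi> v" if "u \<in> U" "v \<in> U" "u < v" for u v
  proof -
    have "v \<in> {x \<in> U. x \<le> v}" "v \<notin> {x \<in> U. x \<le> u}" using that by auto
    then have "{x \<in> U. x \<le> u} \<subset> {x \<in> U. x \<le> v}" using that by fastforce
    then show ?thesis unfolding \<phi>_def using fU by (intro psubset_card_mono) auto
  qed
  have le: "\<phi> u \<le> u" for u
  proof -
    have "v \<noteq> 0" if "v \<in> U" for v using that U0 by (cases v) auto
    then have "{v \<in> U. v \<le> u} \<subseteq> {1..u}" by (auto simp: Suc_le_eq)
    then have "\<phi> u \<le> card {1..u}" unfolding \<phi>_def by (intro card_mono) auto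
    then show ?thesis by simp
  qed
  have inj: "inj_on \<phi> U"
    by (rule inj_onI, rule ccontr) (metis less less_irrefl linorder_neqE_nat)
  have im: "\<phi> ` U = {1..3 * s}"
  proof (rule card_subset_eq)
    show "\<phi> ` U \<subseteq> {1..3 * s}"
    proof
      fix x assume "x \<in> \<phi> ` U"
      then obtain u where u: "u \<in> U" "x = \<phi> u" by blast
      have "{v \<in> U. v \<le> u} \<noteq> {}" "{v \<in> U. v \<le> u} \<subseteq> U" using u by auto
      then have "1 \<le> \<phi> u" "\<phi> u \<le> card U"
        unfolding \<phi>_def using fU by (auto simp: Suc_le_eq card_gt_0_iff intro: card_mono)
      then show "x \<in> {1..3 * s}" using u cU by simp
    qed
    show "card (\<phi> ` U) = card {1..3 * s}" using card_image[OF inj] cU by simp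
  qed simp
  obtain E where E: "bij_betw E {..<s} N"
    using ex_bij_betw_nat_finite[OF N(4)] N(5) by (auto simp: atLeast0LessThan)
  have EN: "E i \<in> N" if "i < s" for i using E that by (auto simp: bij_betw_def)
  have EU: "E i \<subseteq> U" if "i < s" for i using EN[OF that] by (auto simp: U_def)
  show thesis
  proof (rule that[of "\<lambda>i. \<phi> ` E i"])
    fix i assume i: "i < s"
    have EF: "E i \<in> F" using EN[OF i] N(1) by blast
    then obtain a b c where abc: "E i = {a, b, c}" "a \<noteq> b" "b \<noteq> c" "a \<noteq> c"
      using c3[OF EF] by (auto simp: card_3_iff)
    have m: "a \<in> U" "b \<in> U" "c \<in> U" using EU[OF i] abc by auto
    have "{\<phi> a, \<phi> b, \<phi> c} \<in> F"
      by (rule shifted_dominated[OF shift, of a b c])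
        (use EF abc le m inj in \<open>auto simp: inj_on_eq_iff\<close>)
    then show "\<phi> ` E i \<in> F" using abc by simp
  next
    fix i j assume ij: "i < s" "j < s" "i \<noteq> j"
    have "E i \<noteq> E j" using E ij by (auto simp: bij_betw_def inj_on_def)
    then have "E i \<inter> E j = {}" using N(3) EN ij by (auto simp: pairwise_def disjnt_def)
    then show "\<phi> ` E i \<inter> \<phi> ` E j = {}" using inj_on_image_Int[OF inj EU[OF ij(1)] EU[OF ij(2)]] by simp
  next
    have "(\<Union>i<s. \<phi> ` E i) = \<phi> ` (\<Union> (E ` {..<s}))" by auto
    also have "E ` {..<s} = N" using E by (simp add: bij_betw_def)
    finally show "(\<Union>i<s. \<phi> ` E i) = {1..3 * s}" using im by (simp add: U_def)
  qed
qed

lemma has_matching_image: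
  assumes "has_matching F k" "inj f" "\<And>e. e \<in> F \<Longrightarrow> f ` e \<in> H"
  shows "has_matching H k"
proof -
  obtain N where N: "N \<subseteq> F" "pairwise disjnt N" "finite N" "card N = k"
    using assms(1) by (auto simp: has_matching_def is_matching_def)
  have "inj ((`) f)" using assms(2) by (simp add: inj_image_eq_iff inj_def)
  then have "card ((`) f ` N) = k" using N(4) by (simp add: card_image inj_on_subset)
  moreover have "pairwise disjnt ((`) f ` N)"
    using N(2) assms(2) by (auto simp: pairwise_def disjnt_def image_Int[symmetric])
  ultimately show ?thesis using N assms(3) unfolding has_matching_def is_matching_def
    by (intro exI[of _ "(`) f ` N"]) auto
qed

lemma card_meeting:
  assumes "t \<le> n"
  shows "real (card {e. e \<subseteq> {..<n} \<and> card e = 3 \<and> e \<inter> {..<t} \<noteq> {}})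
    = real (n choose 3) - real ((n - t) choose 3)"
proof -
  let ?A = "{e. e \<subseteq> {..<n} \<and> card e = 3}" and ?B = "{e. e \<subseteq> {t..<n} \<and> card e = 3}"
  have fin: "finite ?A" "finite ?B" by auto
  have "{e. e \<subseteq> {..<n} \<and> card e = 3 \<and> e \<inter> {..<t} \<noteq> {}} = ?A - ?B"
    by (auto simp: subset_iff)
  moreover have "?B \<subseteq> ?A" by auto
  moreover have "card ?A = n choose 3" "card ?B = (n - t) choose 3" by (simp_all add: n_subsets)
  moreover have "card ?B \<le> card ?A" using fin \<open>?B \<subseteq> ?A\<close> by (intro card_mono)
  ultimately show ?thesis using fin by (simp add: card_Diff_subset of_nat_diff)
qed

text \<open>The hypothesis \<open>cross\<close> does not ask the star to be the larger family at
  \<open>n\<close>, only at \<open>n + 1\<close>. This is enough to bound every remainder after a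
  nontrivial peeling by its star.\<close>

lemma shifted_bound:
  assumes s: "33 \<le> s" and n: "3 * s + 2 \<le> n"
    and F: "\<And>e. e \<in> F \<Longrightarrow> e \<subseteq> {..<n} \<and> card e = 3" and shift: "shifted F"
    and nm: "\<not> has_matching F (Suc s)"
    and cross: "real ((3 * s + 2) choose 3) \<le> star (real n + 1) s"
  shows "real (card F) \<le> max (real ((3 * s + 2) choose 3)) (star n s)"
proof -
  have fF: "finite F" by (rule finite_subset[of _ "Pow {..<n}"]) (use F in auto)
  define R where "R t = {e \<in> F. e \<subseteq> {t..}}" for t
  \<comment> \<open>\<open>Q t\<close> says that deleting the first \<open>t\<close> vertices lowers
    the bound on the matching number by \<open>t\<close>.\<close>
  define Q where "Q t \<longleftrightarrow> t \<le> s \<and> \<not> has_matching (R t) (Suc (s - t))" for t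
  have "R 0 = F" by (auto simp: R_def)
  then have "Q 0" using nm by (simp add: Q_def)
  then obtain t where t: "Q t" and max: "\<And>t'. Q t' \<Longrightarrow> t' \<le> t"
    using GreatestI_nat[of Q 0 s] Greatest_le_nat[of Q _ s] by (auto simp: Q_def)
  have ts: "t \<le> s" using t by (simp add: Q_def)
  have cF: "real (card F) \<le> real (card (R t)) + (real (n choose 3) - real ((n - t) choose 3))"
  proof -
    have "F = R t \<union> (F - R t)" by (auto simp: R_def)
    then have "card F \<le> card (R t) + card (F - R t)" by (metis card_Un_le)
    moreover have "F - R t \<subseteq> {e. e \<subseteq> {..<n} \<and> card e = 3 \<and> e \<inter> {..<t} \<noteq> {}}"
      using F by (auto simp: R_def)
    then have "card (F - R t) \<le> card {e. e \<subseteq> {..<n} \<and> card e = 3 \<and> e \<inter> {..<t} \<noteq> {}}"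
      by (intro card_mono) auto
    ultimately have "real (card F) \<le> real (card (R t)) + real (card {e. e \<subseteq> {..<n} \<and> card e = 3 \<and> e \<inter> {..<t} \<noteq> {}})"
      by linarith
    then show ?thesis using card_meeting[of t n] ts n by simp
  qed
  show ?thesis
  proof (cases "t = s")
    case True
    have "R t = {}"
    proof (rule ccontr)
      assume "R t \<noteq> {}"
      then obtain e where "e \<in> R t" by blast
      then have "has_matching (R t) (Suc 0)" unfolding has_matching_def is_matching_def
        by (intro exI[of _ "{e}"]) auto
      then show False using t True by (simp add: Q_def)
    qed
    then show ?thesis using cF True star_eq[of s n] n by simp
  next
    case False
    define m where "m = s - t"
    have m: "1 \<le> m" "m \<le> s" "t + m = s" using False ts by (auto simp: m_def)
    \<comment> \<open>Maximality of \<open>t\<close> gives a largest possible matching of the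
      remainder that also avoids the vertex \<open>t\<close>, which becomes \<open>0\<close> after
      relabelling.\<close>
    have "\<not> Q (Suc t)" using max[of "Suc t"] by auto
    then have hm: "has_matching (R (Suc t)) m" using False ts by (simp add: Q_def m_def Suc_diff_Suc)
    define F' where "F' = {e. (\<lambda>x. x + t) ` e \<in> F}"
    have inj: "inj (\<lambda>x::nat. x + t)" by (simp add: inj_def)
    have F': "e \<subseteq> {..<n - t}" "card e = 3" if "e \<in> F'" for e
    proof -
      have e: "(\<lambda>x. x + t) ` e \<subseteq> {..<n}" "card ((\<lambda>x. x + t) ` e) = 3" using that F by (auto simp: F'_def)
      then show "e \<subseteq> {..<n - t}" by auto
      show "card e = 3" using e(2) by (simp add: card_image inj_on_def)
    qed
    have sh: "shifted F'" unfolding shifted_def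
    proof (intro ballI allI impI)
      fix e x y assume h: "e \<in> F'" "x \<in> e" "y < x" "y \<notin> e"
      have "(\<lambda>x. x + t) ` insert y (e - {x}) = insert (y + t) ((\<lambda>x. x + t) ` e - {x + t})" by auto
      moreover have "insert (y + t) ((\<lambda>x. x + t) ` e - {x + t}) \<in> F"
      proof -
        have "(\<lambda>x. x + t) ` e \<in> F" "x + t \<in> (\<lambda>x. x + t) ` e" "y + t < x + t" "y + t \<notin> (\<lambda>x. x + t) ` e"
          using h by (auto simp: F'_def)
        then show ?thesis using shift unfolding shifted_def by blast
      qed
      ultimately show "insert y (e - {x}) \<in> F'" by (simp add: F'_def)
    qed
    have unshift: "(\<lambda>x. x + t) ` ((\<lambda>x. x - t) ` e) = e" if "e \<subseteq> {t..}" for e :: "nat set"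
      using that by (force simp: image_image)
    have nm': "\<not> has_matching F' (Suc m)"
    proof
      assume "has_matching F' (Suc m)"
      then have "has_matching (R t) (Suc m)" by (rule has_matching_image[OF _ inj]) (auto simp: F'_def R_def)
      then show False using t by (simp add: Q_def m_def)
    qed
    have card': "card F' = card (R t)"
    proof (rule bij_betw_same_card)
      show "bij_betw ((`) (\<lambda>x. x + t)) F' (R t)"
      proof (rule bij_betw_byWitness[where f' = "(`) (\<lambda>x. x - t)"])
        show "\<forall>e\<in>F'. (\<lambda>x. x - t) ` (\<lambda>x. x + t) ` e = e" by (simp add: image_image)
        show "\<forall>e\<in>R t. (\<lambda>x. x + t) ` (\<lambda>x. x - t) ` e = e" using unshift by (simp add: R_def)
        show "(`) (\<lambda>x. x + t) ` F' \<subseteq> R t" by (auto simp: F'_def R_def)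
        show "(`) (\<lambda>x. x - t) ` R t \<subseteq> F'"
        proof
          fix a assume "a \<in> (`) (\<lambda>x. x - t) ` R t"
          then obtain e where "e \<in> F" "e \<subseteq> {t..}" "a = (\<lambda>x. x - t) ` e" by (auto simp: R_def)
          then show "a \<in> F'" using unshift[of e] by (simp add: F'_def)
        qed
      qed
    qed
    have hm': "has_matching {e \<in> F'. 0 \<notin> e} m"
    proof -
      obtain N where N: "N \<subseteq> R (Suc t)" "pairwise disjnt N" "finite N" "card N = m"
        using hm by (auto simp: has_matching_def is_matching_def)
      let ?p = "(`) (\<lambda>x. x - t)"
      have sub: "e \<subseteq> {Suc t..}" "e \<subseteq> {t..}" "e \<in> F" if "e \<in> N" for e
        using N(1) that by (auto simp: R_def) force
      have "inj_on ?p N" by (rule inj_on_inverseI[where g = "(`) (\<lambda>x. x + t)"]) (use unshift sub in auto)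
      then have "card (?p ` N) = m" using N(4) by (simp add: card_image)
      moreover have "pairwise disjnt (?p ` N)"
      proof (rule pairwiseI)
        fix a b assume "a \<in> ?p ` N" "b \<in> ?p ` N" "a \<noteq> b"
        then obtain e f where ef: "e \<in> N" "f \<in> N" "a = ?p e" "b = ?p f" "e \<noteq> f" by blast
        then have d: "e \<inter> f = {}" using N(2) by (auto simp: pairwise_def disjnt_def)
        show "disjnt a b" unfolding disjnt_iff ef
        proof (intro allI notI)
          fix z assume "z \<in> ?p e \<and> z \<in> ?p f"
          then obtain u v where uv: "u \<in> e" "v \<in> f" "u - t = v - t" by auto
          moreover have "t \<le> u" "t \<le> v" using sub(2) ef uv by auto
          ultimately have "u = v" by simp
          then show False using uv d by blast
        qed
      qed
      moreover have "?p ` N \<subseteq> {e \<in> F'. 0 \<notin> e}"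
      proof
        fix a assume "a \<in> ?p ` N"
        then obtain e where e: "e \<in> N" "a = ?p e" by blast
        have "a \<in> F'" using e unshift[OF sub(2)[OF e(1)]] sub(3) by (simp add: F'_def)
        moreover have "0 \<notin> a" using sub(1)[OF e(1)] unfolding e(2) by force
        ultimately show "a \<in> {e \<in> F'. 0 \<notin> e}" by simp
      qed
      ultimately show ?thesis using N(3) unfolding has_matching_def is_matching_def
        by (intro exI[of _ "?p ` N"]) auto
    qed
    obtain M where M: "\<And>i. i < m \<Longrightarrow> M i \<in> F'" "\<And>i j. i < m \<Longrightarrow> j < m \<Longrightarrow> i \<noteq> j \<Longrightarrow> M i \<inter> M j = {}"
      "(\<Union>i<m. M i) = {1..3 * m}"
      using compress_matching[OF sh F'(2) hm'] by blast
    interpret matched_family F' m M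
      by unfold_locales (use F' sh nm' M in auto)
    have n': "3 * m + 2 \<le> n - t" using n m by linarith
    have bound: "real (card F') \<le> real ((3 * m + 2) choose 3)
        + max 0 (real (n - t) - 3 * real m - 2 - y) * ((5 * real m ^ 2 + real m) / 2)"
      if "y = 0 \<or> 0 \<le> y \<and> 50 * y \<le> 27 * (real m - 2) \<and> 12 * y + 14 \<le> 7 * (real m - 2) \<and> 23 \<le> m" for y
      by (rule card_le[OF _ n' that]) (rule F'(1))
    define d where "d = n - s"
    have nd: "real (n - t) = real d + real m" "real (n - t) - 3 * real m - 2 = real d - 2 * real m - 2"
      using n m by (auto simp: d_def of_nat_diff)
    have clq: "real ((3 * m + 2) choose 3) = real m * (27 * real m ^ 2 + 27 * real m + 6) / 6"
      by (rule clique_eq)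
    \<comment> \<open>With nothing peeled off the clique can be the larger family, and both terms of
      the maximum are used. Otherwise the remainder is compared with its star only.\<close>
    show ?thesis
    proof (cases "t = 0")
      case True
      then have ms: "m = s" using m by simp
      define y where "y = 54/100 * (real s - 2)"
      have "33 \<le> real s" using s by simp
      then have "0 \<le> y" "50 * y \<le> 27 * (real m - 2)" "12 * y + 14 \<le> 7 * (real m - 2)"
        unfolding y_def ms by argo+
      moreover have "23 \<le> m" using s ms by simp
      ultimately have b: "real (card F') \<le> real ((3 * s + 2) choose 3)
          + max 0 (real n - 3 * real s - 2 - y) * ((5 * real s ^ 2 + real s) / 2)"
        using bound[of y] True ms by simp
      have FF: "real (card F) \<le> real (card F')" using cF card' True by simp
      show ?thesis
      proof (cases "354/100 * real s + 92/100 \<le> real n")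
        case True
        have "real n - 3 * real s - 2 - y = real n - (354/100 * real s + 92/100)" by (simp add: y_def field_simps)
        then have "max 0 (real n - 3 * real s - 2 - y) = real n - (354/100 * real s + 92/100)" using True by simp
        then have "real (card F') \<le> star n s"
          using b star_ge_at_crossing[of "real s" "real n"] True s clique_eq[of s] by simp
        then show ?thesis using FF by simp
      next
        case False
        then have "real n - 3 * real s - 2 - y \<le> 0" unfolding y_def by argo
        then have "max 0 (real n - 3 * real s - 2 - y) = 0" by simp
        then show ?thesis using FF b by simp
      qed
    next
      case t0: False
      then have mlt: "m < s" using m by simp
      have cr: "real s * (27 * real s ^ 2 + 27 * s + 6) / 6 \<le> star (real d + 1 + s) s"
        using cross clique_eq[of s] n by (simp add: d_def of_nat_diff algebra_simps)
      note cc = crossing_consequences[OF s mlt cr]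
      have "real (card F') \<le> star (real d + real m) m"
      proof (cases "m \<le> 32")
        case True
        \<comment> \<open>The requirement \<open>12 * y + 14 \<le> 7 * (real m - 2)\<close> admits
          the factor \<open>54/100\<close> only from \<open>m = 29\<close> on, but
          \<open>1/2\<close> already from 16 on. At \<open>m = 31\<close> and \<open>d = 84\<close>
          the factor \<open>1/2\<close> no longer satisfies the estimate behind
          \<open>star_ge_small\<close>, just as \<open>y = 0\<close> fails at
          \<open>m = 23\<close>.\<close>
        define y where "y = (if m \<le> 22 then 0 else if m \<le> 30 then (real m - 2) / 2 else 54/100 * (real m - 2))"
        have "y = 0 \<or> 0 \<le> y \<and> 50 * y \<le> 27 * (real m - 2) \<and> 12 * y + 14 \<le> 7 * (real m - 2) \<and> 23 \<le> m"
        proof -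
          consider "m \<le> 22" | "23 \<le> m" "m \<le> 30" | "31 \<le> m" by linarith
          then show ?thesis
          proof cases
            case 2
            then have "23 \<le> real m" by simp
            moreover have "y = (real m - 2) / 2" using 2 by (simp add: y_def)
            ultimately show ?thesis using 2 by auto
          next
            case 3
            then have "31 \<le> real m" by simp
            moreover have y: "y = 54/100 * (real m - 2)" using 3 by (simp add: y_def)
            ultimately have "0 \<le> y" "50 * y \<le> 27 * (real m - 2)" "12 * y + 14 \<le> 7 * (real m - 2)"
              unfolding y by argo+
            then show ?thesis using 3 by auto
          qed (simp add: y_def)
        qed
        from bound[OF this] have "real (card F') \<le> real m * (27 * real m ^ 2 + 27 * real m + 6) / 6
          + max 0 (real d - 2 * real m - 2 - y) * ((5 * real m ^ 2 + real m) / 2)"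
          unfolding clq nd(2) .
        also have "\<dots> \<le> star (real d + real m) m"
          by (rule star_ge_small) (use cc(1) m True in \<open>auto simp: y_def\<close>)
        finally show ?thesis .
      next
        case False
        define y where "y = 54/100 * (real m - 2)"
        have "y = 0 \<or> 0 \<le> y \<and> 50 * y \<le> 27 * (real m - 2) \<and> 12 * y + 14 \<le> 7 * (real m - 2) \<and> 23 \<le> m"
        proof -
          have "33 \<le> real m" using False by simp
          then have "0 \<le> y" "50 * y \<le> 27 * (real m - 2)" "12 * y + 14 \<le> 7 * (real m - 2)"
            unfolding y_def by argo+
          then show ?thesis using False by auto
        qed
        from bound[OF this] have "real (card F') \<le> real m * (27 * real m ^ 2 + 27 * real m + 6) / 6
          + max 0 (real d - 2 * real m - 2 - 54/100 * (real m - 2)) * ((5 * real m ^ 2 + real m) / 2)"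
          unfolding clq nd(2) y_def .
        also have "\<dots> \<le> star (real d + real m) m"
          by (rule star_ge_large) (use cc(2) False in auto)
        finally show ?thesis .
      qed
      \<comment> \<open>Star sizes telescope: the star of the remainder and the triples meeting the
        \<open>t\<close> peeled vertices add up to the star of the whole.\<close>
      moreover have "star (real d + real m) m = real ((n - t) choose 3) - real ((n - s) choose 3)"
        using star_eq[of m "n - t"] nd(1) n m by (simp add: diff_diff_add)
      moreover have "star n s = real (n choose 3) - real ((n - s) choose 3)"
        using star_eq[of s n] n by simp
      ultimately show ?thesis using cF card' by linarith
    qed
  qed
qed

lemma finite_family: "three_graph V F \<Longrightarrow> finite F"
  by (rule finite_subset[of _ "Pow V"]) (auto simp: three_graph_def)

lemma matching_number_eqI:
  assumes "finite F" "has_matching F s" "\<not> has_matching F (Suc s)"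
  shows "matching_number F = s"
  unfolding matching_number_def
proof (rule Max_eqI)
  have "{card N |N. is_matching F N} \<subseteq> card ` Pow F" by (auto simp: is_matching_def)
  then show "finite {card N |N. is_matching F N}" using assms(1) finite_subset by blast
  show "s \<in> {card N |N. is_matching F N}" using assms(2) by (auto simp: has_matching_def)
  fix k assume "k \<in> {card N |N. is_matching F N}"
  then obtain N where N: "is_matching F N" "k = card N" by blast
  then have "has_matching F k"
    using finite_subset[OF _ assms(1)] by (auto simp: has_matching_def is_matching_def)
  then show "k \<le> s" using assms(3) has_matching_mono[of F k "Suc s"] by (meson not_less_eq_eq)
qed

lemma no_matching_of_number:
  assumes "finite F" "matching_number F = s" shows "\<not> has_matching F (Suc s)"
proof
  assume "has_matching F (Suc s)"
  then have "Suc s \<in> {card N |N. is_matching F N}" unfolding has_matching_def by (auto; metis)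
  moreover have "finite {card N |N. is_matching F N}"
    by (rule finite_subset[of _ "card ` Pow F"]) (use assms in \<open>auto simp: is_matching_def\<close>)
  ultimately have "Suc s \<le> matching_number F" unfolding matching_number_def by (intro Max_ge)
  then show False using assms by simp
qed

lemma star_nat:
  assumes "s \<le> n" shows "real ((n choose 3) - ((n - s) choose 3)) = star n s"
proof -
  have "(n - s) choose 3 \<le> n choose 3" by (rule binomial_right_mono) simp
  then show ?thesis using star_eq[OF assms] by (simp add: of_nat_diff)
qed

lemma three_graph_bound:
  fixes F :: "'a set set"
  assumes s: "33 \<le> s" and n: "3 * s + 3 \<le> n"
    and F: "three_graph V F" "card V = n" "matching_number F = s"
  shows "card F \<le> edge_bound n s"
proof -
  have fV: "finite V" and FV: "\<And>e. e \<in> F \<Longrightarrow> e \<subseteq> V \<and> card e = 3" using F by (auto simp: three_graph_def)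
  have nm: "\<not> has_matching F (Suc s)" using no_matching_of_number finite_family F by blast
  obtain f where f: "bij_betw f V {..<n}"
    using ex_bij_betw_finite_nat[OF fV] F(2) by (auto simp: atLeast0LessThan)
  then have inj: "inj_on f V" by (simp add: bij_betw_def)
  define H where "H = (`) f ` F"
  have injF: "inj_on ((`) f) F"
    using inj FV by (meson inj_onI inj_on_image_eq_iff)
  have "\<not> has_matching H (Suc s)"
  proof
    assume "has_matching H (Suc s)"
    then obtain N where N: "N \<subseteq> H" "pairwise disjnt N" "finite N" "card N = Suc s"
      by (auto simp: has_matching_def is_matching_def)
    then obtain N' where N': "N' \<subseteq> F" "N = (`) f ` N'" unfolding H_def by (meson subset_image_iff)
    have injN: "inj_on ((`) f) N'" using injF N'(1) by (rule inj_on_subset)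
    have "finite N'" using N(3) N'(2) injN by (simp add: finite_image_iff)
    moreover have "card N' = Suc s" using N(4) N'(2) injN by (simp add: card_image)
    moreover have "pairwise disjnt N'"
    proof (rule pairwiseI)
      fix a b assume ab: "a \<in> N'" "b \<in> N'" "a \<noteq> b"
      then have "f ` a \<noteq> f ` b" using injN by (auto simp: inj_on_def)
      then have "disjnt (f ` a) (f ` b)" using N(2) N'(2) ab by (auto simp: pairwise_def)
      then show "disjnt a b" by (auto simp: disjnt_def)
    qed
    ultimately show False using nm N'(1) unfolding has_matching_def is_matching_def by blast
  qed
  moreover have "e \<subseteq> {..<n} \<and> card e = 3" if eH: "e \<in> H" for e
  proof -
    obtain e' where e': "e' \<in> F" "e = f ` e'" using eH by (auto simp: H_def)
    then show ?thesis using FV[of e'] f card_image[of f e'] inj_on_subset[OF inj]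
      by (auto simp: bij_betw_def)
  qed
  ultimately obtain F' where F': "\<And>e. e \<in> F' \<Longrightarrow> e \<subseteq> {..<n} \<and> card e = 3"
    "\<not> has_matching F' (Suc s)" "card F' = card H" "shifted F'"
    using exists_shifted[of H n "Suc s"] by blast
  have cF: "card F' = card F" using F'(3) injF by (simp add: H_def card_image)
  \<comment> \<open>The vertex set is enlarged from \<open>n\<close> to the least \<open>m\<close>
    with \<open>cr m\<close>, which provides \<open>cross\<close>. If \<open>m > n\<close>,
    minimality puts the star at \<open>m\<close> below the clique, so the bound at \<open>m\<close>
    is just the clique.\<close>
  define cr where "cr m \<longleftrightarrow> n \<le> m \<and> real ((3 * s + 2) choose 3) \<le> star (real m + 1) s" for m
  have "cr (n + 5 * s)"
  proof -
    \<comment> \<open>A crude witness: \<open>5 * s\<close> vertices lie well beyond the crossing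
      near \<open>3.486 * s\<close>.\<close>
    define N where "N = real (n + 5 * s) + 1"
    have N: "5 * real s \<le> N" by (simp add: N_def)
    have s': "33 \<le> real s" using s by simp
    have "5 * real s * (12 * real s - 6) \<le> N * (3 * N - 3 * real s - 6)"
      using N s' by (intro mult_mono) auto
    then have "60 * (real s * real s) - 30 * real s \<le> 3 * (N * N) - 3 * (N * real s) - 6 * N"
      by (simp add: algebra_simps)
    moreover have "33 * real s \<le> real s * real s" using s' by (intro mult_right_mono) auto
    ultimately have "26 * (real s * real s) + 24 * real s + 4 \<le> 3 * (N * N) - 3 * (N * real s) - 6 * N"
      using s' by argo
    then have "27 * real s ^ 2 + 27 * real s + 6 \<le> 3 * N ^ 2 - 3 * N * real s + real s ^ 2 - 6 * N + 3 * real s + 2"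
      by (simp add: algebra_simps power2_eq_square)
    then have "real s * (27 * real s ^ 2 + 27 * real s + 6) \<le> real s * (3 * N ^ 2 - 3 * N * real s + real s ^ 2 - 6 * N + 3 * real s + 2)"
      by (intro mult_left_mono) auto
    then show ?thesis unfolding cr_def clique_eq star_def N_def by simp
  qed
  define m where "m = (LEAST m. cr m)"
  have m: "cr m" using \<open>cr (n + 5 * s)\<close> unfolding m_def by (rule LeastI)
  have nm: "n \<le> m" using m by (simp add: cr_def)
  have "real (card F') \<le> max (real ((3 * s + 2) choose 3)) (star m s)"
  proof (rule shifted_bound[OF s])
    show "3 * s + 2 \<le> m" using n nm by simp
    show "e \<subseteq> {..<m} \<and> card e = 3" if "e \<in> F'" for e using F'(1)[OF that] nm by auto
    show "real ((3 * s + 2) choose 3) \<le> star (real m + 1) s" using m by (simp add: cr_def)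
  qed (use F' in auto)
  also have "\<dots> \<le> max (real ((3 * s + 2) choose 3)) (star n s)"
  proof (cases "m = n")
    case False
    then obtain k where k: "m = Suc k" "n \<le> k" using nm by (cases m) auto
    then have "\<not> cr k" unfolding m_def using not_less_Least[of k cr] by auto
    then have "star m s < real ((3 * s + 2) choose 3)" using k by (simp add: cr_def add.commute)
    then show ?thesis by simp
  qed simp
  also have "\<dots> = real (edge_bound n s)"
    using star_nat[of s n] n by (simp add: edge_bound_def of_nat_max)
  finally show ?thesis using cF by simp
qed

section \<open>Extremal families\<close>

lemma clique_extremal:
  assumes "3 * s + 3 \<le> n"
  defines "F \<equiv> {e. e \<subseteq> {..<3 * s + 2} \<and> card e = 3}"
  shows "three_graph {..<n} F" "matching_number F = s" "card F = (3 * s + 2) choose 3"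
proof -
  show tg: "three_graph {..<n} F" using assms by (auto simp: three_graph_def)
  show "card F = (3 * s + 2) choose 3" by (simp add: F_def n_subsets)
  show "matching_number F = s"
  proof (rule matching_number_eqI)
    show "finite F" using tg by (rule finite_family)
    define e where "e i = {3 * i, 3 * i + 1, 3 * i + 2}" for i :: nat
    have "e i \<inter> e j = {}" if "i < j" for i j using that unfolding e_def by auto
    moreover have "e i \<in> F" if "i < s" for i using that by (auto simp: F_def e_def)
    ultimately show "has_matching F s" by (intro has_matching_indexed[of s e]) (auto simp: F_def)
    show "\<not> has_matching F (Suc s)"
    proof
      assume "has_matching F (Suc s)"
      then obtain N where N: "N \<subseteq> F" "pairwise disjnt N" "finite N" "card N = Suc s"
        by (auto simp: has_matching_def is_matching_def)
      have "finite e" if "e \<in> N" for e using that N(1) finite_subset[of e "{..<3 * s + 2}"] by (auto simp: F_def)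
      then have "card (\<Union>N) = (\<Sum>e\<in>N. card e)" using card_Union_disjoint[OF N(2)] by simp
      also have "\<dots> = (\<Sum>e\<in>N. 3)" using N(1) by (intro sum.cong refl) (auto simp: F_def)
      also have "\<dots> = 3 * Suc s" using N(4) by simp
      finally have "card (\<Union>N) = 3 * Suc s" .
      moreover have "card (\<Union>N) \<le> card {..<3 * s + 2}" using N(1) by (intro card_mono) (auto simp: F_def)
      ultimately show False by simp
    qed
  qed
qed

lemma star_extremal:
  assumes "3 * s + 3 \<le> n"
  defines "F \<equiv> {e. e \<subseteq> {..<n} \<and> card e = 3 \<and> e \<inter> {..<s} \<noteq> {}}"
  shows "three_graph {..<n} F" "matching_number F = s" "card F = (n choose 3) - ((n - s) choose 3)"
proof -
  show tg: "three_graph {..<n} F" by (auto simp: three_graph_def F_def)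
  have "real (card F) = real ((n choose 3) - ((n - s) choose 3))"
    using card_meeting[of s n] star_nat[of s n] star_eq[of s n] assms by (simp add: F_def)
  then show "card F = (n choose 3) - ((n - s) choose 3)" by (simp only: of_nat_eq_iff)
  show "matching_number F = s"
  proof (rule matching_number_eqI)
    show "finite F" using tg by (rule finite_family)
    define e where "e i = {i, s + 2 * i, s + 2 * i + 1}" for i :: nat
    have "e i \<inter> e j = {}" if "i < j" "j < s" for i j using that unfolding e_def by auto
    moreover have "e i \<in> F" if "i < s" for i using that assms by (auto simp: F_def e_def)
    ultimately show "has_matching F s" by (intro has_matching_indexed[of s e]) (auto simp: F_def)
    show "\<not> has_matching F (Suc s)"
    proof
      assume "has_matching F (Suc s)"
      then obtain N where N: "N \<subseteq> F" "pairwise disjnt N" "finite N" "card N = Suc s"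
        by (auto simp: has_matching_def is_matching_def)
      have "\<forall>e\<in>N. \<exists>x. x \<in> e \<and> x < s" using N(1) by (auto simp: F_def)
      then obtain h where h: "\<And>e. e \<in> N \<Longrightarrow> h e \<in> e \<and> h e < s" by metis
      have "inj_on h N"
      proof (rule inj_onI, rule ccontr)
        fix a b assume ab: "a \<in> N" "b \<in> N" "h a = h b" "a \<noteq> b"
        then have "disjnt a b" using N(2) by (auto simp: pairwise_def)
        then show False using h ab by (metis disjnt_iff)
      qed
      then have "card N \<le> card {..<s}" using h by (intro card_inj_on_le[of h]) auto
      then show False using N(4) by simp
    qed
  qed
qed

theorem theorem1:
  fixes n s :: nat
  assumes "s \<ge> 33" and "n \<ge> 3 * s + 3"
  shows "max_edges n s = edge_bound n s
    \<and> (\<forall>(V :: 'a set) F. three_graph V F \<and> card V = n \<and> matching_number F = s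
          \<longrightarrow> card F \<le> edge_bound n s)
    \<and> (\<exists>(V :: nat set) F. three_graph V F \<and> card V = n \<and> matching_number F = s
          \<and> card F = edge_bound n s)"
proof (intro conjI)
  show ub: "\<forall>(V :: 'a set) F. three_graph V F \<and> card V = n \<and> matching_number F = s
          \<longrightarrow> card F \<le> edge_bound n s"
    using three_graph_bound[OF assms] by blast
  show ex: "\<exists>(V :: nat set) F. three_graph V F \<and> card V = n \<and> matching_number F = s
          \<and> card F = edge_bound n s"
  proof (cases "(3 * s + 2) choose 3 \<le> (n choose 3) - ((n - s) choose 3)")
    case True
    then have "edge_bound n s = (n choose 3) - ((n - s) choose 3)" by (simp add: edge_bound_def)
    then show ?thesis using star_extremal[OF assms(2)] by (metis card_lessThan)
  next
    case False
    then have "edge_bound n s = (3 * s + 2) choose 3" by (simp add: edge_bound_def)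
    then show ?thesis using clique_extremal[OF assms(2)] by (metis card_lessThan)
  qed
  let ?S = "{card F |(V :: nat set) (F :: nat set set).
     three_graph V F \<and> card V = n \<and> matching_number F = s}"
  show "max_edges n s = edge_bound n s" unfolding max_edges_def
  proof (rule Max_eqI)
    have le: "k \<le> edge_bound n s" if "k \<in> ?S" for k
      using that three_graph_bound[OF assms] by blast
    then show "finite ?S" by (meson finite_nat_set_iff_bounded_le)
    show "k \<le> edge_bound n s" if "k \<in> ?S" for k using le[OF that] .
    obtain V :: "nat set" and F where "three_graph V F" "card V = n" "matching_number F = s" "card F = edge_bound n s"
      using ex by blast
    then show "edge_bound n s \<in> ?S" by (intro CollectI exI[of _ V] exI[of _ F]) simp
  qed
qed

end
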